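(* Let $\mathcal{O}\subset\mathbb{R}^n$ be the closure of a bounded connected open subset of $\mathbb{R}^n$ with boundary of class $C^2$, such that $\mathbb{R}^n\setminus\mathcal{O}$ is connected. Let $k_0\in\mathbb{R}^n\setminus\mathcal{O}$, and let $x\mapsto A(x)$ be a map of class $C^2$ on $\mathbb{R}^n$ taking values in the set of all positive definite (symmetric) $n\times n$ matrices. Let $d:\overline{\mathbb{R}^n\setminus\mathcal{O}}\to[0,+\infty[$ be the distance function from $k_0$ in the presence of the obstacle $\mathcal{O}$, associated with $A$. Then $d\in SC^{\frac12}_{loc}\big(\overline{\mathbb{R}^n\setminus\mathcal{O}}\setminus\{k_0\}\big)$.
   Context: Distance function: let $\Gamma$ be the set of all (locally) absolutely continuous curves $\gamma:[0,+\infty[\to\overline{\mathbb{R}^n\setminus\mathcal{O}}$ with $\langle A(\gamma(t))\dot\gamma(t),\dot\gamma(t)\rangle\le 1$ for a.e. $t\ge0$. For $x\in\overline{\mathbb{R}^n\setminus\mathcal{O}}$ let $\Gamma[x]=\{\gamma\in\Gamma : \gamma(0)=x\}$, and let $\tau(\gamma)=\inf\{t\ge0 : \gamma(t)=k_0\}\in[0,+\infty]$. Then $d(x)=\inf_{\gamma\in\Gamma[x]}\tau(\gamma)$ (finite for every $x$, since $\mathbb{R}^n\setminus\mathcal{O}$ is connected). Fractional semiconcavity: given a set $U\subset\mathbb{R}^n$ and $\alpha\in]0,1]$, $SC^\alpha(U)$ is the set of all $u:U\to\mathbb{R}$ that are locally Lipschitz continuous on $U$ and for which there exists $C>0$ such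 that $$\lambda u(x)+(1-\lambda)u(y)-u(\lambda x+(1-\lambda)y)\le C\lambda(1-\lambda)|x-y|^{1+\alpha}$$ for all $x,y\in U$ such that the segment $[x,y]$ is contained in $U$ and all $\lambda\in[0,1]$. $SC^\alpha_{loc}(U)$ is the local version: $u|_K\in SC^\alpha(K)$ for every compact $K\subset U$, with constant depending on $K$. *)

theory Defs
  imports "HOL-Analysis.Analysis"
begin

definition C1_on :: "('a::real_normed_vector \<Rightarrow> 'b::real_normed_vector) \<Rightarrow> 'a set \<Rightarrow> bool" where
  "C1_on f S \<longleftrightarrow>
     (\<exists>f' :: 'a \<Rightarrow> 'a \<Rightarrow>\<^sub>L 'b.
        (\<forall>x\<in>S. (f has_derivative blinfun_apply (f' x)) (at x)) \<and> continuous_on S f')"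

definition C2_on :: "('a::real_normed_vector \<Rightarrow> 'b::real_normed_vector) \<Rightarrow> 'a set \<Rightarrow> bool" where
  "C2_on f S \<longleftrightarrow>
     (\<exists>f' :: 'a \<Rightarrow> 'a \<Rightarrow>\<^sub>L 'b.
        (\<forall>x\<in>S. (f has_derivative blinfun_apply (f' x)) (at x)) \<and> C1_on f' S)"

(* Near each boundary point, U is the strict sublevel set, and its boundary the zero level set,
   of a C^2 function without critical points; so U lies locally on one side of its boundary. *)
definition C2_boundary :: "'a::euclidean_space set \<Rightarrow> bool" where
  "C2_boundary U \<longleftrightarrow>
     (\<forall>p\<in>frontier U. \<exists>V (g :: 'a \<Rightarrow> real).
        open V \<and> p \<in> V \<and> C2_on g V \<and>
        (\<forall>x\<in>V. \<not> (g has_derivative (\<lambda>_. 0)) (at x)) \<and>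
        U \<inter> V = {x \<in> V. g x < 0} \<and>
        frontier U \<inter> V = {x \<in> V. g x = 0})"

definition sym_pos_def :: "real ^ 'n ^ 'n \<Rightarrow> bool" where
  "sym_pos_def M \<longleftrightarrow> transpose M = M \<and> (\<forall>v. v \<noteq> 0 \<longrightarrow> 0 < inner (M *v v) v)"

(* A pair (s, t) in P encodes the interval from s to t. *)
definition abs_continuous_on_interval :: "real \<Rightarrow> real \<Rightarrow> (real \<Rightarrow> 'a::metric_space) \<Rightarrow> bool" where
  "abs_continuous_on_interval a b \<gamma> \<longleftrightarrow>
     (\<forall>\<epsilon>>0. \<exists>\<delta>>0. \<forall>P :: (real \<times> real) set.
        finite P \<and>
        (\<forall>(s, t)\<in>P. a \<le> s \<and> s \<le> t \<and> t \<le> b) \<and>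
        pairwise (\<lambda>(s, t) (s', t'). {s<..<t} \<inter> {s'<..<t'} = {}) P \<and>
        (\<Sum>(s, t)\<in>P. t - s) < \<delta>
        \<longrightarrow> (\<Sum>(s, t)\<in>P. dist (\<gamma> s) (\<gamma> t)) < \<epsilon>)"

definition locally_abs_continuous :: "(real \<Rightarrow> 'a::metric_space) \<Rightarrow> bool" where
  "locally_abs_continuous \<gamma> \<longleftrightarrow> (\<forall>T\<ge>0. abs_continuous_on_interval 0 T \<gamma>)"

(* Curves live on [0, \<infinity>[; their values at negative times are irrelevant throughout. *)
definition admissible_curves ::
    "(real ^ 'n) set \<Rightarrow> (real ^ 'n \<Rightarrow> real ^ 'n ^ 'n) \<Rightarrow> (real \<Rightarrow> real ^ 'n) set" where
  "admissible_curves Obs A =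
     {\<gamma>. locally_abs_continuous \<gamma> \<and>
         (\<forall>t\<ge>0. \<gamma> t \<in> closure (- Obs)) \<and>
         (AE t in lebesgue. 0 \<le> t \<longrightarrow>
            (\<exists>v. (\<gamma> has_vector_derivative v) (at t within {0..}) \<and> inner (A (\<gamma> t) *v v) v \<le> 1))}"

definition hitting_time :: "'a \<Rightarrow> (real \<Rightarrow> 'a) \<Rightarrow> ereal" where
  "hitting_time k\<^sub>0 \<gamma> = Inf {ereal t | t. 0 \<le> t \<and> \<gamma> t = k\<^sub>0}"

(* Under the standing assumptions the infimum is finite at every point of closure (- Obs),
   so real_of_ereal loses nothing there. *)
definition obstacle_dist ::
    "(real ^ 'n) set \<Rightarrow> (real ^ 'n \<Rightarrow> real ^ 'n ^ 'n) \<Rightarrow> real ^ 'n \<Rightarrow> real ^ 'n \<Rightarrow> real" where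
  "obstacle_dist Obs A k\<^sub>0 x =
     real_of_ereal (INF \<gamma>\<in>{\<gamma> \<in> admissible_curves Obs A. \<gamma> 0 = x}. hitting_time k\<^sub>0 \<gamma>)"

definition locally_lipschitz_on :: "'a::metric_space set \<Rightarrow> ('a \<Rightarrow> 'b::metric_space) \<Rightarrow> bool" where
  "locally_lipschitz_on U u \<longleftrightarrow>
     (\<forall>x\<in>U. \<exists>\<epsilon>>0. \<exists>L. L-lipschitz_on (cball x \<epsilon> \<inter> U) u)"

(* A function on U is represented by a total function; only its values on U matter. *)
definition SC :: "real \<Rightarrow> 'a::euclidean_space set \<Rightarrow> ('a \<Rightarrow> real) set" where
  "SC \<alpha> U =
     {u. locally_lipschitz_on U u \<and>
         (\<exists>C>0. \<forall>x\<in>U. \<forall>y\<in>U. closed_segment x y \<subseteq> U \<longrightarrow>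
            (\<forall>c\<in>{0..1}.
               c * u x + (1 - c) * u y - u (c *\<^sub>R x + (1 - c) *\<^sub>R y)
                 \<le> C * c * (1 - c) * norm (x - y) powr (1 + \<alpha>)))}"

definition SC_loc :: "real \<Rightarrow> 'a::euclidean_space set \<Rightarrow> ('a \<Rightarrow> real) set" where
  "SC_loc \<alpha> U = {u. \<forall>K. compact K \<and> K \<subseteq> U \<longrightarrow> u \<in> SC \<alpha> K}"

end

(*
  Let S be the closure of the complement of the obstacle. Near each of its points there is a Lipschitz
  retraction Phi onto S that increases the squared A-speed of a curve w by at most C |w - s| |w'|^2, for
  every s in S. Given a near-optimal curve gamma from z and a point x near z, the curve
  Phi (gamma t + (1 - t/r) (x - z)), 0 <= t <= r, leads in S from x to gamma r. Its squared speed exceeds 1 by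
  -2 <A(z) gamma', (x - z)/r> up to O(|x - z| + |x - z|^2/r^2); after a reparametrization,
    d x <= d z + q . (x - z) + C (r |x - z| + |x - z|^2/r) + eps
  with q independent of x. For z = c x + (1 - c) y the linear terms cancel in the convex combination of
  the estimates for x and y, and r = |x - y|^(1/2) gives the exponent 3/2. No existence or regularity of
  geodesics is needed.
*)
theory Submission
  imports Defs
begin

text \<open>The translated curve may run inside the obstacle, at a depth of order norm (x - z), for
  a time of order \<open>r\<close>. A retraction that is merely Lipschitz would stretch it there by
  a constant factor and cost a multiple of \<open>r\<close>; only r norm (x - z) is affordable. This
  dictates the direction of the displacement: along the conormal A^-1 grad g the one-sided
  derivative of \<open>\<Phi>\<close> at the boundary is the A-orthogonal projection onto the
  tangent space, which does not increase the A-norm, so the excess is proportional to the depth. The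
  depth is measured against the original curve, which lies in \<open>S\<close>; hence the comparison
  with points of \<open>S\<close> in \<open>local_retraction\<close>.

  The two errors compete: a large \<open>r\<close> means a long stay in the obstacle, a small
  \<open>r\<close> a large change (x - z) / r of the velocity. Their balance yields the exponent.
  Freezing \<open>A\<close> at \<open>z\<close> makes the first order term integrate to an increment
  of \<gamma>, so \<open>q\<close> is explicit. Admissible curves are first replaced by Lipschitz
  curves on compact intervals, for which changes of time preserve null sets.\<close>

section \<open>Calculus of C^1 maps\<close>

lemma C1_onE:
  assumes "C1_on f S"
  obtains f' where "\<forall>x\<in>S. (f has_derivative blinfun_apply (f' x)) (at x)"
    "continuous_on S f'" "continuous_on S f"
proof -
  obtain f' where *: "\<forall>x\<in>S. (f has_derivative blinfun_apply (f' x)) (at x)" "continuous_on S f'"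
    using assms unfolding C1_on_def by (elim exE conjE)
  then have "continuous (at x) f" if "x \<in> S" for x
    using has_derivative_continuous[of f] that by blast
  then have "continuous_on S f"
    by (intro continuous_at_imp_continuous_on ballI)
  with * show ?thesis by (intro that[of f']) auto
qed

lemma C1_on_const: "C1_on (\<lambda>x. c) S"
  unfolding C1_on_def by (rule exI[of _ "\<lambda>x. 0"]) (simp add: zero_blinfun.rep_eq)

lemma (in bounded_bilinear) C1_on_bilinear:
  assumes "C1_on f S" "C1_on g S"
  shows "C1_on (\<lambda>x. prod (f x) (g x)) S"
proof -
  obtain f' where df0: "\<forall>x\<in>S. (f has_derivative blinfun_apply (f' x)) (at x)"
    and cf: "continuous_on S f'" "continuous_on S f"
    by (rule C1_onE[OF assms(1)])
  note df = df0[rule_format]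
  obtain g' where dg0: "\<forall>x\<in>S. (g has_derivative blinfun_apply (g' x)) (at x)"
    and cg: "continuous_on S g'" "continuous_on S g"
    by (rule C1_onE[OF assms(2)])
  note dg = dg0[rule_format]
  show ?thesis
    unfolding C1_on_def
  proof (intro exI[of _ "\<lambda>x. (prod_right (f x) o\<^sub>L g' x) + (prod_left (g x) o\<^sub>L f' x)"] conjI ballI)
    fix x assume "x \<in> S"
    have "blinfun_apply ((prod_right (f x) o\<^sub>L g' x) + (prod_left (g x) o\<^sub>L f' x))
        = (\<lambda>h. prod (f x) (g' x h) + prod (f' x h) (g x))"
      by (simp add: fun_eq_iff blinfun.add_left)
    with FDERIV[OF df dg, OF \<open>x \<in> S\<close> \<open>x \<in> S\<close>]
    show "((\<lambda>x. prod (f x) (g x)) has_derivative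
        blinfun_apply ((prod_right (f x) o\<^sub>L g' x) + (prod_left (g x) o\<^sub>L f' x))) (at x)"
      by simp
  next
    show "continuous_on S (\<lambda>x. (prod_right (f x) o\<^sub>L g' x) + (prod_left (g x) o\<^sub>L f' x))"
      using cf cg
      by (intro continuous_intros bounded_linear.continuous_on[OF bounded_linear_prod_right]
          bounded_linear.continuous_on[OF bounded_linear_prod_left])
  qed
qed

lemmas C1_on_scaleR = bounded_bilinear.C1_on_bilinear[OF bounded_bilinear_scaleR]
lemmas C1_on_mult = bounded_bilinear.C1_on_bilinear[OF bounded_bilinear_mult]

lemma C1_on_bounded_linear:
  assumes "C1_on f S" "bounded_linear h"
  shows "C1_on (\<lambda>x. h (f x)) S"
proof -
  obtain f' where d0: "\<forall>x\<in>S. (f has_derivative blinfun_apply (f' x)) (at x)"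
    and c: "continuous_on S f'" "continuous_on S f"
    by (rule C1_onE[OF assms(1)])
  note d = d0[rule_format]
  show ?thesis
    unfolding C1_on_def
  proof (intro exI[of _ "\<lambda>x. Blinfun h o\<^sub>L f' x"] conjI ballI)
    fix x assume "x \<in> S"
    then show "((\<lambda>x. h (f x)) has_derivative blinfun_apply (Blinfun h o\<^sub>L f' x)) (at x)"
      using bounded_linear.has_derivative[OF assms(2) d]
      by (simp add: bounded_linear_Blinfun_apply[OF assms(2)] comp_def blinfun_compose.rep_eq)
  next
    show "continuous_on S (\<lambda>x. Blinfun h o\<^sub>L f' x)"
      using c(1) by (intro continuous_intros)
  qed
qed

lemma C1_on_add:
  assumes "C1_on f S" "C1_on g S"
  shows "C1_on (\<lambda>x. f x + g x) S"
proof -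
  obtain f' where df0: "\<forall>x\<in>S. (f has_derivative blinfun_apply (f' x)) (at x)"
    and cf: "continuous_on S f'" "continuous_on S f"
    by (rule C1_onE[OF assms(1)])
  note df = df0[rule_format]
  obtain g' where dg0: "\<forall>x\<in>S. (g has_derivative blinfun_apply (g' x)) (at x)"
    and cg: "continuous_on S g'" "continuous_on S g"
    by (rule C1_onE[OF assms(2)])
  note dg = dg0[rule_format]
  show ?thesis
    unfolding C1_on_def
    by (rule exI[of _ "\<lambda>x. f' x + g' x"])
      (auto intro!: has_derivative_add df dg continuous_on_add cf cg simp: plus_blinfun.rep_eq)
qed

lemma C1_on_sum:
  assumes "\<And>i. i \<in> I \<Longrightarrow> C1_on (f i) S"
  shows "C1_on (\<lambda>x. \<Sum>i\<in>I. f i x) S"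
  using assms by (induction I rule: infinite_finite_induct) (auto intro: C1_on_const C1_on_add)

lemma C1_on_prod:
  fixes f :: "'i \<Rightarrow> 'a::real_normed_vector \<Rightarrow> real"
  assumes "\<And>i. i \<in> I \<Longrightarrow> C1_on (f i) S"
  shows "C1_on (\<lambda>x. \<Prod>i\<in>I. f i x) S"
  using assms by (induction I rule: infinite_finite_induct) (auto intro: C1_on_const C1_on_mult)

lemma C1_on_divide:
  fixes f g :: "'a::real_normed_vector \<Rightarrow> real"
  assumes "C1_on f S" "C1_on g S" "\<And>x. x \<in> S \<Longrightarrow> g x \<noteq> 0"
  shows "C1_on (\<lambda>x. f x / g x) S"
proof -
  obtain g' where d0: "\<forall>x\<in>S. (g has_derivative blinfun_apply (g' x)) (at x)"
    and c: "continuous_on S g'" and cg: "continuous_on S g"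
    by (rule C1_onE[OF assms(2)])
  note d = d0[rule_format]
  have "C1_on (\<lambda>x. inverse (g x)) S"
    unfolding C1_on_def
  proof (intro exI[of _ "\<lambda>x. - (inverse (g x) * inverse (g x)) *\<^sub>R g' x"] conjI ballI)
    fix x assume "x \<in> S"
    then show "((\<lambda>x. inverse (g x)) has_derivative
        blinfun_apply (- (inverse (g x) * inverse (g x)) *\<^sub>R g' x)) (at x)"
      using assms(3) 
      by (auto intro!: derivative_eq_intros d simp: blinfun.scaleR_left blinfun.minus_left)
  next
    show "continuous_on S (\<lambda>x. - (inverse (g x) * inverse (g x)) *\<^sub>R g' x)"
      using assms(3) by (intro continuous_intros c cg) auto
  qed
  from C1_on_mult[OF assms(1) this] show ?thesis by (simp add: divide_inverse)
qed

lemma C1_on_vec_lambda: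
  fixes f :: "'i::finite \<Rightarrow> 'a::real_normed_vector \<Rightarrow> real"
  assumes "\<And>i. C1_on (f i) S"
  shows "C1_on (\<lambda>x. \<chi> i. f i x) S"
proof -
  have "(\<chi> i. f i x) = (\<Sum>i\<in>UNIV. f i x *\<^sub>R axis i 1)" for x
    using basis_expansion[of "\<chi> i. f i x"] by (simp add: scalar_mult_eq_scaleR)
  then show ?thesis
    by (simp only:) (intro C1_on_sum C1_on_scaleR assms C1_on_const)
qed

lemma C1_on_subset: "C1_on f S \<Longrightarrow> T \<subseteq> S \<Longrightarrow> C1_on f T"
  unfolding C1_on_def by (meson continuous_on_subset subsetD)

lemma C2_imp_C1:
  assumes "C2_on f S" shows "C1_on f S"
  using assms unfolding C2_on_def C1_on_def[of f] by (auto elim: C1_onE)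

text \<open>By the Leibniz formula. Needed because the conormal field is obtained from Cramer's
  rule, as a quotient of determinants.\<close>

lemma C1_on_det:
  fixes M :: "'a::real_normed_vector \<Rightarrow> real^'n^'n"
  assumes "\<And>i j. C1_on (\<lambda>x. M x $ i $ j) S"
  shows "C1_on (\<lambda>x. det (M x)) S"
  unfolding det_def by (intro C1_on_sum C1_on_mult C1_on_const C1_on_prod assms)

text \<open>Continuity of the derivative at \<open>p\<close> bounds it by
  \<open>norm (f' p) + 1\<close> nearby, and the mean value inequality on the convex ball gives the
  Lipschitz bound. The local constants for \<open>A\<close>, the gradient and the conormal all come
  from here.\<close>

lemma C1_on_local_bound:
  fixes f :: "'a::real_normed_vector \<Rightarrow> 'b::real_normed_vector"
  assumes "C1_on f V" "open V" "p \<in> V"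
  obtains r B f' where "0 < r" "0 < B" "ball p r \<subseteq> V" "B-lipschitz_on (ball p r) f"
    "\<And>x. x \<in> ball p r \<Longrightarrow> (f has_derivative blinfun_apply (f' x)) (at x)"
    "\<And>x. x \<in> ball p r \<Longrightarrow> norm (f' x) \<le> B"
    "\<And>x. x \<in> ball p r \<Longrightarrow> norm (f x) \<le> B"
proof -
  obtain f' where d0: "\<forall>x\<in>V. (f has_derivative blinfun_apply (f' x)) (at x)"
    and c: "continuous_on V f'" "continuous_on V f"
    by (rule C1_onE[OF assms(1)])
  note d = d0[rule_format]
  have "continuous (at p) f'"
    using c(1) assms(2,3) continuous_on_eq_continuous_at by blast
  then obtain r1 where r1: "r1 > 0" "\<And>x. dist x p < r1 \<Longrightarrow> dist (f' x) (f' p) < 1"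
    unfolding continuous_at_eps_delta by (metis zero_less_one)
  have "continuous (at p) f"
    using d assms(3) has_derivative_continuous by blast
  then obtain r3 where r3: "r3 > 0" "\<And>x. dist x p < r3 \<Longrightarrow> dist (f x) (f p) < 1"
    unfolding continuous_at_eps_delta by (metis zero_less_one)
  obtain r2 where r2: "r2 > 0" "ball p r2 \<subseteq> V" using assms openE by blast
  define r where "r = min r1 (min r2 r3)"
  define B where "B = norm (f' p) + norm (f p) + 1"
  have b: "norm (f' x) \<le> B" if "x \<in> ball p r" for x
  proof -
    have "dist (f' x) (f' p) < 1" using r1(2)[of x] that by (simp add: r_def dist_commute)
    then show ?thesis
      using norm_triangle_sub[of "f' x" "f' p"] norm_ge_zero[of "f p"]
      unfolding B_def dist_norm by linarith
  qed
  have b2: "norm (f x) \<le> B" if "x \<in> ball p r" for x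
  proof -
    have "dist (f x) (f p) < 1" using r3(2)[of x] that by (simp add: r_def dist_commute)
    then show ?thesis
      using norm_triangle_sub[of "f x" "f p"] norm_ge_zero[of "f' p"]
      unfolding B_def dist_norm by linarith
  qed
  have sub: "ball p r \<subseteq> V" using r2 by (auto simp: r_def)
  have "B-lipschitz_on (ball p r) f"
  proof (rule lipschitz_onI)
    fix x y assume xy: "x \<in> ball p r" "y \<in> ball p r"
    have "norm (f x - f y) \<le> B * norm (x - y)"
    proof (rule differentiable_bound[OF convex_ball _ _ xy])
      show "(f has_derivative blinfun_apply (f' u)) (at u within ball p r)" if "u \<in> ball p r" for u
        by (rule has_derivative_at_withinI[OF d]) (use that sub in blast)
      show "onorm (blinfun_apply (f' u)) \<le> B" if "u \<in> ball p r" for u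
        using b[OF that] by (simp add: norm_blinfun.rep_eq)
    qed
    then show "dist (f x) (f y) \<le> B * dist x y" by (simp add: dist_norm)
  qed (auto simp: B_def)
  moreover have "r > 0" "B > 0" using r1 r2 r3 
    by (auto simp: r_def B_def intro!: add_nonneg_pos)
  moreover have "(f has_derivative blinfun_apply (f' x)) (at x)" if "x \<in> ball p r" for x
    using d[of x] that sub by blast
  ultimately show ?thesis by (intro that[of r B f'] b b2 sub)
qed

section \<open>Absolutely continuous curves\<close>

lemma abs_continuous_on_intervalE:
  assumes "abs_continuous_on_interval a b \<gamma>" "\<epsilon> > 0"
  obtains \<delta> where "\<delta> > 0" "\<forall>P. finite P \<and> (\<forall>(s, t)\<in>P. a \<le> s \<and> s \<le> t \<and> t \<le> b) \<and>
      pairwise (\<lambda>(s, t) (s', t'). {s<..<t} \<inter> {s'<..<t'} = {}) P \<and> (\<Sum>(s, t)\<in>P. t - s) < \<delta>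
      \<longrightarrow> (\<Sum>(s, t)\<in>P. dist (\<gamma> s) (\<gamma> t)) < \<epsilon>"
  using spec[OF assms(1)[unfolded abs_continuous_on_interval_def], of \<epsilon>, THEN mp, OF assms(2)]
  by (elim exE conjE) (rule that)

lemma lipschitz_imp_abs_continuous:
  fixes \<gamma> :: "real \<Rightarrow> 'a::metric_space"
  assumes "L-lipschitz_on {a..b} \<gamma>"
  shows "abs_continuous_on_interval a b \<gamma>"
  unfolding abs_continuous_on_interval_def
proof (intro allI impI)
  fix \<epsilon> :: real assume "\<epsilon> > 0"
  have L: "L \<ge> 0" using lipschitz_on_nonneg[OF assms] .
  show "\<exists>\<delta>>0. \<forall>P. finite P \<and> (\<forall>(s, t)\<in>P. a \<le> s \<and> s \<le> t \<and> t \<le> b) \<and>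
      pairwise (\<lambda>(s, t) (s', t'). {s<..<t} \<inter> {s'<..<t'} = {}) P \<and> (\<Sum>(s, t)\<in>P. t - s) < \<delta>
      \<longrightarrow> (\<Sum>(s, t)\<in>P. dist (\<gamma> s) (\<gamma> t)) < \<epsilon>"
  \<comment> \<open>\<open>L + 1\<close> instead of \<open>L\<close>, since \<open>L\<close> may be
    0.\<close>
  proof (intro exI[of _ "\<epsilon> / (L + 1)"] conjI allI impI)
    show "\<epsilon> / (L + 1) > 0" using L \<open>\<epsilon> > 0\<close> by simp
    fix P :: "(real \<times> real) set"
    assume P: "finite P \<and> (\<forall>(s, t)\<in>P. a \<le> s \<and> s \<le> t \<and> t \<le> b) \<and>
      pairwise (\<lambda>(s, t) (s', t'). {s<..<t} \<inter> {s'<..<t'} = {}) P \<and> (\<Sum>(s, t)\<in>P. t - s) < \<epsilon> / (L + 1)"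
    have "(\<Sum>(s, t)\<in>P. dist (\<gamma> s) (\<gamma> t)) \<le> (\<Sum>(s, t)\<in>P. (L + 1) * (t - s))"
    proof (rule sum_mono, clarify)
      fix s t assume "(s, t) \<in> P"
      then have st: "a \<le> s" "s \<le> t" "t \<le> b" using P by auto
      then have "dist (\<gamma> s) (\<gamma> t) \<le> L * dist s t"
        by (intro lipschitz_onD[OF assms]) auto
      also have "\<dots> \<le> (L + 1) * (t - s)" using st by (simp add: dist_real_def algebra_simps)
      finally show "dist (\<gamma> s) (\<gamma> t) \<le> (L + 1) * (t - s)" .
    qed
    also have "\<dots> = (L + 1) * (\<Sum>(s, t)\<in>P. t - s)"
      by (simp add: sum_distrib_left case_prod_unfold)
    also have "\<dots> < \<epsilon>"
      using P L by (simp add: pos_less_divide_eq mult.commute)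
    finally show "(\<Sum>(s, t)\<in>P. dist (\<gamma> s) (\<gamma> t)) < \<epsilon>" .
  qed
qed

lemma abs_continuous_subset:
  assumes "abs_continuous_on_interval a b \<gamma>" "a \<le> a'" "b' \<le> b"
  shows "abs_continuous_on_interval a' b' \<gamma>"
  unfolding abs_continuous_on_interval_def
proof (intro allI impI)
  fix \<epsilon> :: real assume "\<epsilon> > 0"
  obtain \<delta> where "\<delta> > 0" and \<delta>: "\<forall>P. finite P \<and> (\<forall>(s, t)\<in>P. a \<le> s \<and> s \<le> t \<and> t \<le> b) \<and>
      pairwise (\<lambda>(s, t) (s', t'). {s<..<t} \<inter> {s'<..<t'} = {}) P \<and> (\<Sum>(s, t)\<in>P. t - s) < \<delta>
      \<longrightarrow> (\<Sum>(s, t)\<in>P. dist (\<gamma> s) (\<gamma> t)) < \<epsilon>"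
    by (rule abs_continuous_on_intervalE[OF assms(1) \<open>\<epsilon> > 0\<close>])
  have "(\<Sum>(s, t)\<in>P. dist (\<gamma> s) (\<gamma> t)) < \<epsilon>" 
    if P: "finite P \<and> (\<forall>(s, t)\<in>P. a' \<le> s \<and> s \<le> t \<and> t \<le> b') \<and>
      pairwise (\<lambda>(s, t) (s', t'). {s<..<t} \<inter> {s'<..<t'} = {}) P \<and> (\<Sum>(s, t)\<in>P. t - s) < \<delta>" for P
  proof (rule \<delta>[THEN spec, THEN mp])
    have "\<forall>(s, t)\<in>P. a \<le> s \<and> s \<le> t \<and> t \<le> b" using P assms(2,3) by fastforce
    with P show "finite P \<and> (\<forall>(s, t)\<in>P. a \<le> s \<and> s \<le> t \<and> t \<le> b) \<and>
      pairwise (\<lambda>(s, t) (s', t'). {s<..<t} \<inter> {s'<..<t'} = {}) P \<and> (\<Sum>(s, t)\<in>P. t - s) < \<delta>" by blast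
  qed
  with \<open>\<delta> > 0\<close> show "\<exists>\<delta>>0. \<forall>P. finite P \<and> (\<forall>(s, t)\<in>P. a' \<le> s \<and> s \<le> t \<and> t \<le> b') \<and>
      pairwise (\<lambda>(s, t) (s', t'). {s<..<t} \<inter> {s'<..<t'} = {}) P \<and> (\<Sum>(s, t)\<in>P. t - s) < \<delta>
      \<longrightarrow> (\<Sum>(s, t)\<in>P. dist (\<gamma> s) (\<gamma> t)) < \<epsilon>" by blast
qed

text \<open>The null set \<open>N\<close> is covered by an open set \<open>W\<close> of measure below the modulus \<open>\<delta>\<close> of absolute
  continuity. In a division that is fine for a suitable gauge, the intervals tagged in \<open>N\<close> lie in \<open>W\<close>
  and contribute at most \<open>\<epsilon>\<close>; on the others the derivative at the tag controls the increment.\<close>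

lemma abs_continuous_deriv_bound:
  fixes \<gamma> :: "real \<Rightarrow> 'a::real_normed_vector"
  assumes ac: "abs_continuous_on_interval s t \<gamma>" and st: "s < t" and N: "negligible N"
    and M: "0 \<le> M"
    and der: "\<And>u. u \<in> {s<..<t} - N \<Longrightarrow> \<exists>v. (\<gamma> has_vector_derivative v) (at u) \<and> norm v \<le> M"
  shows "norm (\<gamma> t - \<gamma> s) \<le> M * (t - s)"
proof (rule field_le_epsilon)
  fix e :: real assume "e > 0"
  \<comment> \<open>The good intervals contribute an error \<epsilon> (t - s), the bad ones an error
    \<epsilon>; together this is \<open>e\<close>.\<close>
  define \<epsilon> where "\<epsilon> = e / (1 + (t - s))"
  have \<epsilon>: "\<epsilon> > 0" using \<open>e > 0\<close> st by (simp add: \<epsilon>_def)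
  \<comment> \<open>With the endpoints added, every tag outside \<open>N'\<close> is an interior
    point at which the derivative exists.\<close>
  define N' where "N' = N \<union> {s, t}"
  have "negligible N'" unfolding N'_def using N by (intro negligible_Un) auto
  obtain \<delta> where "\<delta> > 0" and \<delta>: "\<forall>P. finite P \<and> (\<forall>(s', t')\<in>P. s \<le> s' \<and> s' \<le> t' \<and> t' \<le> t) \<and>
      pairwise (\<lambda>(s, t) (s', t'). {s<..<t} \<inter> {s'<..<t'} = {}) P \<and> (\<Sum>(s, t)\<in>P. t - s) < \<delta>
      \<longrightarrow> (\<Sum>(s, t)\<in>P. dist (\<gamma> s) (\<gamma> t)) < \<epsilon>"
    by (rule abs_continuous_on_intervalE[OF ac \<epsilon>])
  have "N' \<in> sets lebesgue" "emeasure lebesgue N' = 0"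
    using \<open>negligible N'\<close> by (auto simp: negligible_iff_null_sets)
  obtain W where W: "open W" "N' \<subseteq> W" "W \<in> lmeasurable" "measure lebesgue W < \<delta>"
  proof -
    obtain W where W: "open W" "N' \<subseteq> W" "(W - N') \<in> lmeasurable" "emeasure lebesgue (W - N') < ennreal \<delta>"
      using sets_lebesgue_outer_open[OF \<open>N' \<in> sets lebesgue\<close> \<open>\<delta> > 0\<close>] by blast
    have "N' \<in> lmeasurable" using \<open>negligible N'\<close> negligible_imp_measurable by blast
    then have *: "W \<in> lmeasurable"
      using W(2,3) fmeasurable.Un[of "W - N'" lebesgue N'] by (simp add: Un_absorb2)
    have "measure lebesgue (W - N') < \<delta>"
      using W(3,4) \<open>\<delta> > 0\<close> by (simp add: emeasure_eq_measure2 ennreal_less_iff)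
    moreover have "measure lebesgue (W - N') = measure lebesgue W"
      using \<open>negligible N'\<close> * by (intro measure_negligible_symdiff) (auto intro: negligible_subset)
    ultimately show ?thesis using that W(1,2) * by simp
  qed
  have "\<exists>q. 0 < fst q \<and> norm (snd q) \<le> M \<and>
      (\<forall>y. \<bar>y - u\<bar> < fst q \<longrightarrow> norm (\<gamma> y - \<gamma> u - (y - u) *\<^sub>R snd q) \<le> \<epsilon> * \<bar>y - u\<bar>)"
    if u: "u \<in> {s<..<t} - N" for u
  proof -
    from der[OF u] obtain v where v: "(\<gamma> has_vector_derivative v) (at u)" "norm v \<le> M" by blast
    from v(1) obtain \<rho> where "\<rho> > 0" "\<forall>y. norm (y - u) < \<rho> \<longrightarrow> norm (\<gamma> y - \<gamma> u - (y - u) *\<^sub>R v) \<le> \<epsilon> * norm (y - u)"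
      unfolding has_vector_derivative_def has_derivative_at_alt using \<epsilon> by blast
    with v(2) show ?thesis by (intro exI[of _ "(\<rho>, v)"]) simp
  qed
  then have "\<forall>u\<in>{s<..<t} - N. \<exists>q. 0 < fst q \<and> norm (snd q) \<le> M \<and>
      (\<forall>y. \<bar>y - u\<bar> < fst q \<longrightarrow> norm (\<gamma> y - \<gamma> u - (y - u) *\<^sub>R snd q) \<le> \<epsilon> * \<bar>y - u\<bar>)"
    by blast
  from bchoice[OF this] obtain q where q: "\<forall>u\<in>{s<..<t} - N. 0 < fst (q u) \<and> norm (snd (q u)) \<le> M \<and>
      (\<forall>y. \<bar>y - u\<bar> < fst (q u) \<longrightarrow> norm (\<gamma> y - \<gamma> u - (y - u) *\<^sub>R snd (q u)) \<le> \<epsilon> * \<bar>y - u\<bar>)"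
    by (rule exE)
  define \<rho> where "\<rho> u = fst (q u)" for u
  define V where "V u = snd (q u)" for u
  have \<rho>: "\<rho> u > 0" and V: "norm (V u) \<le> M" if "u \<in> {s<..<t} - N" for u
    using bspec[OF q that] by (simp_all add: \<rho>_def V_def)
  have \<rho>V: "norm (\<gamma> y - \<gamma> u - (y - u) *\<^sub>R V u) \<le> \<epsilon> * \<bar>y - u\<bar>"
    if "u \<in> {s<..<t} - N" "\<bar>y - u\<bar> < \<rho> u" for u y
    using bspec[OF q that(1)] that(2) by (simp add: \<rho>_def V_def)
  \<comment> \<open>The last branch concerns points outside [s, t] and only makes \<open>g\<close> a
    gauge.\<close>
  define g where "g u = (if u \<in> N' then W else if u \<in> {s<..<t} then ball u (\<rho> u) else ball u 1)" for u
  have "gauge g"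
    unfolding gauge_def g_def using W \<rho> by (auto simp: N'_def)
  obtain p where p: "p tagged_division_of {s..t}" "g fine p"
    using fine_division_exists_real[OF \<open>gauge g\<close>] by blast
  note pD = tagged_division_ofD[OF p(1)]
  \<comment> \<open>The empty set gets the value 0 because \<open>f\<close> has to vanish on every
    box with empty interior when sums over tagged pairs are rewritten below.\<close>
  define f where "f K = (if K = {} then 0 else norm (\<gamma> (Sup K) - \<gamma> (Inf K)))" for K
  have ivl: "\<exists>l r. K = {l..r} \<and> s \<le> l \<and> l \<le> x \<and> x \<le> r \<and> r \<le> t \<and> Inf K = l \<and> Sup K = r \<and> measure lborel K = r - l"
    if K: "(x, K) \<in> p" for x K
  proof -
    obtain l r where "K = cbox l r" using pD(4)[OF K] by blast
    with pD(2,3)[OF K] have "K = {l..r}" "x \<in> K" "l \<le> x" "x \<le> r" "{l..r} \<subseteq> {s..t}" by auto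
    then show ?thesis by (intro exI[of _ l] exI[of _ r]) auto
  qed
  have f: "f K = norm (\<gamma> (Sup K) - \<gamma> (Inf K))" if "(x, K) \<in> p" for x K
    using pD(2)[OF that] by (auto simp: f_def)
  define p1 where "p1 = {(x, K) \<in> p. x \<in> N'}"
  have p1p: "p1 \<subseteq> p" by (auto simp: p1_def)
  have fin: "finite p" "finite p1" using pD(1) p1p finite_subset by auto
  have p1: "p1 tagged_partial_division_of {s..t}"
    using tagged_partial_division_subset[OF _ p1p] p(1) tagged_division_of_def by blast
  have p1d: "snd ` p1 division_of \<Union> (snd ` p1)"
    by (rule partial_division_of_tagged_division[OF p1])
  define D where "D = snd ` p1"
  have Div: "D division_of \<Union> D" using p1d D_def by simp
  have ivlD: "\<exists>l r. K = {l..r} \<and> s \<le> l \<and> l \<le> r \<and> r \<le> t \<and> Inf K = l \<and> Sup K = r \<and> measure lborel K = r - l \<and> K \<subseteq> W"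
    if K: "K \<in> D" for K
  proof -
    from K obtain x where x: "(x, K) \<in> p" "x \<in> N'" by (auto simp: D_def p1_def)
    then have "K \<subseteq> W" using fineD[OF p(2), of x K] by (simp add: g_def)
    moreover obtain l r where "K = {l..r} \<and> s \<le> l \<and> l \<le> x \<and> x \<le> r \<and> r \<le> t \<and> Inf K = l \<and> Sup K = r \<and> measure lborel K = r - l"
      using ivl[OF x(1)] by blast
    ultimately show ?thesis by (intro exI[of _ l] exI[of _ r]) auto
  qed
  \<comment> \<open>Absolute continuity speaks of a set of intervals, while a degenerate interval
    may occur in \<open>p1\<close> with several tags; such intervals contribute 0.\<close>
  have S1: "(\<Sum>(x, K)\<in>p1. f K) = sum f D"
    unfolding D_def
  proof (rule sum.over_tagged_division_lemma[OF tagged_partial_division_of_Union_self[OF p1]])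
    fix u v :: real assume "box u v = {}"
    then have "cbox u v = {} \<or> cbox u v = {u}" by (auto simp: box_eq_empty)
    then show "f (cbox u v) = 0" by (auto simp: f_def)
  qed
  have "sum f D < \<epsilon>"
  proof -
    define P where "P = (\<lambda>K. (Inf K, Sup K)) ` D"
    have inj: "inj_on (\<lambda>K. (Inf K, Sup K)) D"
      by (rule inj_onI) (use ivlD in \<open>metis Pair_inject\<close>)
    have "finite D" using Div by blast
    have "(\<Sum>(s, t)\<in>P. dist (\<gamma> s) (\<gamma> t)) < \<epsilon>"
    proof (rule \<delta>[THEN spec, THEN mp], intro conjI)
      show "finite P" using \<open>finite D\<close> by (simp add: P_def)
      show "\<forall>(s', t')\<in>P. s \<le> s' \<and> s' \<le> t' \<and> t' \<le> t"
        using ivlD by (fastforce simp: P_def)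
      show "pairwise (\<lambda>(s, t) (s', t'). {s<..<t} \<inter> {s'<..<t'} = {}) P"
      proof -
        have "{Inf K<..<Sup K} \<inter> {Inf K'<..<Sup K'} = {}" if "K \<in> D" "K' \<in> D" "K \<noteq> K'" for K K'
        proof -
          have "interior K \<inter> interior K' = {}" using division_ofD(5)[OF Div that] .
          moreover have "interior K'' = {Inf K''<..<Sup K''}" if "K'' \<in> D" for K''
            using ivlD[OF that] interior_atLeastAtMost_real by metis
          ultimately show ?thesis using that by simp
        qed
        then show ?thesis unfolding pairwise_def P_def by fastforce
      qed
      have "(\<Sum>(s, t)\<in>P. t - s) = (\<Sum>K\<in>D. Sup K - Inf K)"
        unfolding P_def by (subst sum.reindex[OF inj]) simp
      also have "\<dots> = (\<Sum>K\<in>D. measure lebesgue K)"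
      proof (rule sum.cong[OF refl])
        fix K assume "K \<in> D"
        from ivlD[OF this] obtain l r where "K = {l..r}" "l \<le> r" "Inf K = l" "Sup K = r" by blast
        then show "Sup K - Inf K = measure lebesgue K" by simp
      qed
      also have "\<dots> = measure lebesgue (\<Union>D)" by (rule content_division[OF Div])
      also have "\<dots> \<le> measure lebesgue W"
        using ivlD Div by (intro measure_mono_fmeasurable W lmeasurable_division[THEN fmeasurableD]) blast+
      finally show "(\<Sum>(s, t)\<in>P. t - s) < \<delta>" using W(4) by simp
    qed
    also have "(\<Sum>(s, t)\<in>P. dist (\<gamma> s) (\<gamma> t)) = sum f D"
      unfolding P_def by (subst sum.reindex[OF inj], simp, rule sum.cong[OF refl])
        (auto simp: f dist_norm norm_minus_commute D_def p1_def)
    finally show ?thesis .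
  qed
  have S2: "f K \<le> (M + \<epsilon>) * measure lborel K" if K: "(x, K) \<in> p - p1" for x K
  proof -
    have xN: "x \<notin> N'" and Kp: "(x, K) \<in> p" using K by (auto simp: p1_def)
    obtain l r where lr: "K = {l..r}" "s \<le> l" "l \<le> x" "x \<le> r" "r \<le> t" "Inf K = l" "Sup K = r" "measure lborel K = r - l"
      using ivl[OF Kp] by blast
    have x: "x \<in> {s<..<t} - N" using xN lr by (auto simp: N'_def)
    have "K \<subseteq> ball x (\<rho> x)" using fineD[OF p(2) Kp] xN x by (simp add: g_def)
    moreover have "l \<in> K" "r \<in> K" using lr by auto
    ultimately have *: "\<bar>l - x\<bar> < \<rho> x" "\<bar>r - x\<bar> < \<rho> x" by (auto simp: dist_real_def)
    have "\<gamma> r - \<gamma> l = (\<gamma> r - \<gamma> x - (r - x) *\<^sub>R V x) - (\<gamma> l - \<gamma> x - (l - x) *\<^sub>R V x) + (r - l) *\<^sub>R V x"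
      by (simp add: algebra_simps)
    also have "norm \<dots> \<le> norm (\<gamma> r - \<gamma> x - (r - x) *\<^sub>R V x) + norm (\<gamma> l - \<gamma> x - (l - x) *\<^sub>R V x) + norm ((r - l) *\<^sub>R V x)"
      by (meson add_mono norm_triangle_ineq norm_triangle_ineq4 order_trans order_refl)
    also have "\<dots> \<le> \<epsilon> * (r - x) + \<epsilon> * (x - l) + (r - l) * M"
      using \<rho>V[OF x *(1)] \<rho>V[OF x *(2)] V[OF x] lr by (intro add_mono) (auto intro: mult_left_mono)
    also have "\<dots> = (M + \<epsilon>) * measure lborel K" using lr by (simp add: algebra_simps)
    finally show ?thesis using f[OF Kp] lr by simp
  qed
  have "norm (\<gamma> t - \<gamma> s) = norm (\<Sum>(x, K)\<in>p. \<gamma> (Sup K) - \<gamma> (Inf K))"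
    using additive_tagged_division_1[OF less_imp_le[OF st] p(1), of \<gamma>] by simp
  also have "\<dots> \<le> (\<Sum>(x, K)\<in>p. f K)"
    by (rule order_trans[OF norm_sum], rule sum_mono) (auto simp: f)
  also have "\<dots> = (\<Sum>(x, K)\<in>p - p1. f K) + (\<Sum>(x, K)\<in>p1. f K)"
    by (rule sum.subset_diff[OF p1p fin(1)])
  also have "(\<Sum>(x, K)\<in>p - p1. f K) \<le> (\<Sum>(x, K)\<in>p - p1. (M + \<epsilon>) * measure lborel K)"
    by (rule sum_mono) (use S2 in auto)
  also have "\<dots> \<le> (\<Sum>(x, K)\<in>p. (M + \<epsilon>) * measure lborel K)"
    using M \<epsilon> by (intro sum_mono2 fin) auto
  also have "\<dots> = (M + \<epsilon>) * (t - s)"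
    using additive_content_tagged_division[of p s t] p(1) st
    by (simp add: sum_distrib_left[symmetric] case_prod_unfold)
  finally have "norm (\<gamma> t - \<gamma> s) \<le> (M + \<epsilon>) * (t - s) + \<epsilon>"
    using \<open>sum f D < \<epsilon>\<close> S1 by simp
  also have "\<dots> = M * (t - s) + \<epsilon> * (1 + (t - s))" by (simp add: algebra_simps)
  also have "\<epsilon> * (1 + (t - s)) = e" using st by (simp add: \<epsilon>_def)
  finally show "norm (\<gamma> t - \<gamma> s) \<le> M * (t - s) + e" .
qed

section \<open>Curves of speed at most 1 and travel times\<close>

text \<open>Takes the place of admissible curves in all constructions: this class is stable under
  restriction, concatenation and bi-Lipschitz changes of time, because Lipschitz maps send null sets
  to null sets. The constant \<open>L\<close> is left open;
  \<open>unit_speed_curve_lipschitz\<close> recovers a uniform one.\<close>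

definition unit_speed_curve ::
    "(real ^ 'n) set \<Rightarrow> (real ^ 'n \<Rightarrow> real ^ 'n ^ 'n) \<Rightarrow> real \<Rightarrow> (real \<Rightarrow> real ^ 'n) \<Rightarrow> bool" where
  "unit_speed_curve S A T \<gamma> \<longleftrightarrow>
     \<gamma> ` {0..T} \<subseteq> S \<and> (\<exists>L. L-lipschitz_on {0..T} \<gamma>) \<and>
     (\<exists>N. negligible N \<and> (\<forall>t\<in>{0<..<T} - N.
        \<exists>v. (\<gamma> has_vector_derivative v) (at t) \<and> inner (A (\<gamma> t) *v v) v \<le> 1))"

text \<open>\<open>T\<close> is some travel time, not the least one: speeds below 1 are
  allowed.\<close>

definition joined ::
    "(real ^ 'n) set \<Rightarrow> (real ^ 'n \<Rightarrow> real ^ 'n ^ 'n) \<Rightarrow> real ^ 'n \<Rightarrow> real ^ 'n \<Rightarrow> real \<Rightarrow> bool" where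
  "joined S A a b T \<longleftrightarrow> 0 \<le> T \<and> (\<exists>\<gamma>. unit_speed_curve S A T \<gamma> \<and> \<gamma> 0 = a \<and> \<gamma> T = b)"

lemma unit_speed_curveI:
  assumes "\<And>t. t \<in> {0..T} \<Longrightarrow> \<gamma> t \<in> S" "L-lipschitz_on {0..T} \<gamma>" "negligible N"
    "\<And>t. t \<in> {0<..<T} - N \<Longrightarrow> \<exists>v. (\<gamma> has_vector_derivative v) (at t) \<and> inner (A (\<gamma> t) *v v) v \<le> 1"
  shows "unit_speed_curve S A T \<gamma>"
  using assms unfolding unit_speed_curve_def by blast

lemma unit_speed_curveE:
  assumes "unit_speed_curve S A T \<gamma>"
  obtains L N where "\<forall>t\<in>{0..T}. \<gamma> t \<in> S" "L-lipschitz_on {0..T} \<gamma>" "negligible N"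
    "\<forall>t\<in>{0<..<T} - N. \<exists>v. (\<gamma> has_vector_derivative v) (at t) \<and> inner (A (\<gamma> t) *v v) v \<le> 1"
  using assms unfolding unit_speed_curve_def image_subset_iff by (elim conjE exE) (rule that)

lemma lipschitz_on_shift:
  fixes f :: "real \<Rightarrow> 'a::metric_space"
  assumes "L-lipschitz_on {a..b} f"
  shows "L-lipschitz_on {a - h..b - h} (\<lambda>t. f (h + t))"
proof (rule lipschitz_onI)
  fix x y assume "x \<in> {a - h..b - h}" "y \<in> {a - h..b - h}"
  then have "dist (f (h + x)) (f (h + y)) \<le> L * dist (h + x) (h + y)"
    by (intro lipschitz_onD[OF assms]) auto
  then show "dist (f (h + x)) (f (h + y)) \<le> L * dist x y" by (simp add: dist_real_def)
qed (rule lipschitz_on_nonneg[OF assms])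

lemma joined_suffix:
  assumes "unit_speed_curve S A T \<gamma>" "0 \<le> r" "r \<le> T"
  shows "joined S A (\<gamma> r) (\<gamma> T) (T - r)"
proof -
  obtain L N where S_all: "\<forall>t\<in>{0..T}. \<gamma> t \<in> S" and L: "L-lipschitz_on {0..T} \<gamma>" and N: "negligible N"
    and d_ae: "\<forall>t\<in>{0<..<T} - N. \<exists>v. (\<gamma> has_vector_derivative v) (at t) \<and> inner (A (\<gamma> t) *v v) v \<le> 1"
    by (rule unit_speed_curveE[OF assms(1)])
  note S = bspec[OF S_all] and d = bspec[OF d_ae]
  have "unit_speed_curve S A (T - r) (\<lambda>t. \<gamma> (r + t))"
  proof (rule unit_speed_curveI)
    show "\<gamma> (r + t) \<in> S" if "t \<in> {0..T - r}" for t using S that assms(2,3) by auto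
    show "L-lipschitz_on {0..T - r} (\<lambda>t. \<gamma> (r + t))"
      using lipschitz_on_shift[OF lipschitz_on_subset[OF L], of r T r] assms(2,3) by simp
    show "negligible ((+) (- r) ` N)" by (rule negligible_translation[OF N])
    fix t assume t: "t \<in> {0<..<T - r} - (+) (- r) ` N"
    then have "r + t \<notin> N" by (metis DiffE add_minus_cancel minus_add_cancel image_eqI)
    with t assms(2) have "r + t \<in> {0<..<T} - N" by auto
    from d[OF this] obtain v where v: "(\<gamma> has_vector_derivative v) (at (r + t))" "inner (A (\<gamma> (r + t)) *v v) v \<le> 1" by blast
    have "((\<lambda>t. r + t) has_vector_derivative 1) (at t)"
      by (auto intro!: derivative_eq_intros)
    from vector_diff_chain_at[OF this v(1)] have "((\<lambda>t. \<gamma> (r + t)) has_vector_derivative v) (at t)"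
      by (simp add: comp_def)
    with v(2) show "\<exists>v. ((\<lambda>t. \<gamma> (r + t)) has_vector_derivative v) (at t) \<and> inner (A (\<gamma> (r + t)) *v v) v \<le> 1"
      by blast
  qed
  then show ?thesis unfolding joined_def using assms(3) by (intro conjI exI[of _ "\<lambda>t. \<gamma> (r + t)"]) auto
qed

lemma joined_trans:
  assumes "joined S A a b T1" "joined S A b c T2"
  shows "joined S A a c (T1 + T2)"
proof -
  obtain \<gamma>1 \<gamma>2 where T: "0 \<le> T1" "0 \<le> T2"
    and u: "unit_speed_curve S A T1 \<gamma>1" "unit_speed_curve S A T2 \<gamma>2"
    and e: "\<gamma>1 0 = a" "\<gamma>1 T1 = b" "\<gamma>2 0 = b" "\<gamma>2 T2 = c"
    using assms unfolding joined_def by blast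
  obtain L1 N1 where S1_all: "\<forall>t\<in>{0..T1}. \<gamma>1 t \<in> S" and L1: "L1-lipschitz_on {0..T1} \<gamma>1" and N1: "negligible N1"
    and d1_ae: "\<forall>t\<in>{0<..<T1} - N1. \<exists>v. (\<gamma>1 has_vector_derivative v) (at t) \<and> inner (A (\<gamma>1 t) *v v) v \<le> 1"
    by (rule unit_speed_curveE[OF u(1)])
  note S1 = bspec[OF S1_all] and d1 = bspec[OF d1_ae]
  obtain L2 N2 where S2_all: "\<forall>t\<in>{0..T2}. \<gamma>2 t \<in> S" and L2: "L2-lipschitz_on {0..T2} \<gamma>2" and N2: "negligible N2"
    and d2_ae: "\<forall>t\<in>{0<..<T2} - N2. \<exists>v. (\<gamma>2 has_vector_derivative v) (at t) \<and> inner (A (\<gamma>2 t) *v v) v \<le> 1"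
    by (rule unit_speed_curveE[OF u(2)])
  note S2 = bspec[OF S2_all] and d2 = bspec[OF d2_ae]
  define \<gamma> where "\<gamma> t = (if t \<le> T1 then \<gamma>1 t else \<gamma>2 (t - T1))" for t
  have "unit_speed_curve S A (T1 + T2) \<gamma>"
  proof (rule unit_speed_curveI)
    show "\<gamma> t \<in> S" if "t \<in> {0..T1 + T2}" for t using S1 S2 T that by (auto simp: \<gamma>_def)
    have "L2-lipschitz_on {T1..T1 + T2} (\<lambda>t. \<gamma>2 (t - T1))"
      using lipschitz_on_shift[OF L2, of "- T1"] by (simp add: algebra_simps)
    then show "(max L1 L2)-lipschitz_on {0..T1 + T2} \<gamma>"
      unfolding \<gamma>_def using e by (intro lipschitz_on_concat_max L1) auto
    \<comment> \<open>The concatenation may have a corner at \<open>T1\<close>.\<close>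
    show "negligible (N1 \<union> (+) T1 ` N2 \<union> {T1})"
      by (intro negligible_Un N1 negligible_translation[OF N2]) auto
    fix t assume t: "t \<in> {0<..<T1 + T2} - (N1 \<union> (+) T1 ` N2 \<union> {T1})"
    show "\<exists>v. (\<gamma> has_vector_derivative v) (at t) \<and> inner (A (\<gamma> t) *v v) v \<le> 1"
    proof (cases "t < T1")
      case True
      with t have "t \<in> {0<..<T1} - N1" by auto
      from d1[OF this] obtain v where v: "(\<gamma>1 has_vector_derivative v) (at t)" "inner (A (\<gamma>1 t) *v v) v \<le> 1" by blast
      have "(\<gamma> has_vector_derivative v) (at t)"
        by (rule has_vector_derivative_transform_within_open[OF v(1), of "{..<T1}"])
          (use True in \<open>auto simp: \<gamma>_def\<close>)
      with v(2) True show ?thesis by (auto simp: \<gamma>_def)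
    next
      case False
      have "t - T1 \<notin> N2" using t by (metis DiffE UnI1 UnI2 add_diff_cancel_left' diff_add_cancel add.commute image_eqI)
      with False t have tt: "t - T1 \<in> {0<..<T2} - N2" "T1 < t" by auto
      from d2[OF tt(1)] obtain v where v: "(\<gamma>2 has_vector_derivative v) (at (t - T1))" "inner (A (\<gamma>2 (t - T1)) *v v) v \<le> 1" by blast
      have "((\<lambda>t. t - T1) has_vector_derivative 1) (at t)"
        by (auto intro!: derivative_eq_intros)
      from vector_diff_chain_at[OF this v(1)] have "((\<lambda>t. \<gamma>2 (t - T1)) has_vector_derivative v) (at t)"
        by (simp add: comp_def)
      then have "(\<gamma> has_vector_derivative v) (at t)"
        by (rule has_vector_derivative_transform_within_open[of _ _ _ "{T1<..}"])
          (use tt in \<open>auto simp: \<gamma>_def\<close>)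
      with v(2) tt show ?thesis by (auto simp: \<gamma>_def)
    qed
  qed
  moreover have "\<gamma> 0 = a" "\<gamma> (T1 + T2) = c" using e T by (auto simp: \<gamma>_def)
  ultimately show ?thesis using T unfolding joined_def by (intro conjI exI[of _ \<gamma>]) auto
qed

text \<open>With \<sigma> as the clock the velocity becomes v / q, whose squared speed is at most 1.
  The lower bound \<open>c\<close> makes the inverse clock Lipschitz, and the upper bound
  \<open>B\<close> keeps the image of the null set \<open>N\<close> null. This allows curves that
  are too fast to be traded for a longer travel time.\<close>

lemma joined_reparametrize:
  fixes \<sigma> :: "real \<Rightarrow> real"
  assumes r: "0 \<le> r" and L: "L-lipschitz_on {0..r} \<eta>" and S: "\<And>t. t \<in> {0..r} \<Longrightarrow> \<eta> t \<in> S"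
    and B: "B-lipschitz_on {0..r} \<sigma>" and \<sigma>0: "\<sigma> 0 = 0"
    and c: "0 < c" "\<And>s t. 0 \<le> s \<Longrightarrow> s \<le> t \<Longrightarrow> t \<le> r \<Longrightarrow> c * (t - s) \<le> \<sigma> t - \<sigma> s"
    and N: "negligible N"
    and d: "\<And>t. t \<in> {0<..<r} - N \<Longrightarrow> \<exists>v q. (\<eta> has_vector_derivative v) (at t) \<and>
        (\<sigma> has_real_derivative q) (at t) \<and> 0 < q \<and> inner (A (\<eta> t) *v v) v \<le> q\<^sup>2"
  shows "joined S A (\<eta> 0) (\<eta> r) (\<sigma> r)"
proof -
  have cont: "continuous_on {0..r} \<sigma>" using B lipschitz_on_continuous_on by blast
  have mono: "\<sigma> s \<le> \<sigma> t" if "0 \<le> s" "s \<le> t" "t \<le> r" for s t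
    using c(2)[OF that] mult_nonneg_nonneg[of c "t - s"] c(1) that by linarith
  have inj: "inj_on \<sigma> {0..r}"
  proof (rule linorder_inj_onI)
    fix s t assume "s < t" "s \<in> {0..r}" "t \<in> {0..r}"
    then have "c * (t - s) \<le> \<sigma> t - \<sigma> s" "0 < c * (t - s)" using c by auto
    then show "\<sigma> s \<noteq> \<sigma> t" by linarith
  qed auto
  have r0: "0 \<le> \<sigma> r" using mono[of 0 r] r \<sigma>0 by simp
  have img: "\<sigma> ` {0..r} = {0..\<sigma> r}"
  proof
    show "\<sigma> ` {0..r} \<subseteq> {0..\<sigma> r}" using mono[of 0] mono[of _ r] \<sigma>0 by auto
    show "{0..\<sigma> r} \<subseteq> \<sigma> ` {0..r}"
      using IVT'[of \<sigma> 0 _ r] cont r \<sigma>0 by fastforce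
  qed
  define \<tau> where "\<tau> = inv_into {0..r} \<sigma>"
  have \<tau>: "\<tau> u \<in> {0..r}" "\<sigma> (\<tau> u) = u" if "u \<in> {0..\<sigma> r}" for u
    using that img inv_into_into[of u \<sigma> "{0..r}"] f_inv_into_f[of u \<sigma> "{0..r}"] unfolding \<tau>_def by auto
  have \<tau>\<sigma>: "\<tau> (\<sigma> t) = t" if "t \<in> {0..r}" for t
    unfolding \<tau>_def using inv_into_f_f[OF inj that] .
  have L\<tau>: "(1 / c)-lipschitz_on {0..\<sigma> r} \<tau>"
  proof (rule lipschitz_on_leI)
    fix u u' assume u: "u \<in> {0..\<sigma> r}" "u' \<in> {0..\<sigma> r}" "u \<le> u'"
    have "\<tau> u \<le> \<tau> u'"
    proof (rule ccontr)
      assume "\<not> \<tau> u \<le> \<tau> u'"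
      then have "c * (\<tau> u - \<tau> u') \<le> u - u'" "\<tau> u - \<tau> u' > 0"
        using c(2)[of "\<tau> u'" "\<tau> u"] \<tau>[OF u(1)] \<tau>[OF u(2)] by auto
      with u(3) mult_pos_pos[OF c(1), of "\<tau> u - \<tau> u'"] show False by linarith
    qed
    moreover have "c * (\<tau> u' - \<tau> u) \<le> u' - u"
      using c(2)[of "\<tau> u" "\<tau> u'"] calculation \<tau>[OF u(1)] \<tau>[OF u(2)] by auto
    ultimately show "dist (\<tau> u) (\<tau> u') \<le> 1 / c * dist u u'"
      using c(1) u(3) by (simp add: dist_real_def field_simps)
  qed (use c in auto)
  have "unit_speed_curve S A (\<sigma> r) (\<eta> \<circ> \<tau>)"
  proof (rule unit_speed_curveI)
    show "(\<eta> \<circ> \<tau>) t \<in> S" if "t \<in> {0..\<sigma> r}" for t using \<tau>(1) S that by auto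
    show "(L * (1 / c))-lipschitz_on {0..\<sigma> r} (\<eta> \<circ> \<tau>)"
      by (rule lipschitz_on_compose[OF L\<tau> lipschitz_on_subset[OF L]]) (use \<tau>(1) in auto)
    show "negligible (\<sigma> ` (N \<inter> {0..r}))"
    proof (rule negligible_locally_Lipschitz_image)
      show "negligible (N \<inter> {0..r})" using N by (rule negligible_subset) auto
      fix x assume "x \<in> N \<inter> {0..r}"
      then show "\<exists>T B. open T \<and> x \<in> T \<and> (\<forall>y\<in>N \<inter> {0..r} \<inter> T. norm (\<sigma> y - \<sigma> x) \<le> B * norm (y - x))"
        using lipschitz_onD[OF B] by (intro exI[of _ UNIV] exI[of _ B]) (auto simp: dist_norm)
    qed simp
    fix u assume u: "u \<in> {0<..<\<sigma> r} - \<sigma> ` (N \<inter> {0..r})"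
    then have u': "u \<in> {0..\<sigma> r}" by auto
    have "\<tau> u \<noteq> 0" "\<tau> u \<noteq> r" using \<tau>(2)[OF u'] u \<sigma>0 by auto
    moreover have "\<tau> u \<notin> N" using u \<tau>[OF u'] by (metis DiffE IntI image_eqI)
    ultimately have "\<tau> u \<in> {0<..<r} - N" using \<tau>(1)[OF u'] by auto
    from d[OF this] obtain v q where v: "(\<eta> has_vector_derivative v) (at (\<tau> u))"
      and q: "(\<sigma> has_real_derivative q) (at (\<tau> u))" "0 < q" and le: "inner (A (\<eta> (\<tau> u)) *v v) v \<le> q\<^sup>2"
      by blast
    have "isCont \<tau> u"
      using lipschitz_on_continuous_on[OF L\<tau>] u
      by (metis DiffD1 at_within_interior continuous_on_eq_continuous_within interior_atLeastAtMost_real u')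
    then have "(\<tau> has_real_derivative inverse q) (at u)"
      using q u \<tau>(2) by (intro DERIV_inverse_function[of \<sigma> _ _ _ 0 "\<sigma> r"]) auto
    then have "(\<tau> has_vector_derivative inverse q) (at u)"
      by (simp add: has_real_derivative_iff_has_vector_derivative)
    from vector_diff_chain_at[OF this v]
    have "(\<eta> \<circ> \<tau> has_vector_derivative inverse q *\<^sub>R v) (at u)" .
    moreover have "inner (A ((\<eta> \<circ> \<tau>) u) *v (inverse q *\<^sub>R v)) (inverse q *\<^sub>R v) \<le> 1"
    proof -
      have "inner (A ((\<eta> \<circ> \<tau>) u) *v (inverse q *\<^sub>R v)) (inverse q *\<^sub>R v) = inner (A (\<eta> (\<tau> u)) *v v) v / q\<^sup>2"
        by (simp add: matrix_vector_mult_scaleR power2_eq_square field_simps)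
      also have "\<dots> \<le> 1" using le q by (simp add: divide_le_eq)
      finally show ?thesis .
    qed
    ultimately show "\<exists>v. (\<eta> \<circ> \<tau> has_vector_derivative v) (at u) \<and> inner (A ((\<eta> \<circ> \<tau>) u) *v v) v \<le> 1" by blast
  qed
  then show ?thesis
    unfolding joined_def using r0 \<tau>\<sigma>[of 0] \<tau>\<sigma>[of r] \<sigma>0 r
    by (intro conjI exI[of _ "\<eta> \<circ> \<tau>"]) auto
qed

section \<open>Coercivity of \<open>A\<close>; passage between admissible and unit speed
  curves\<close>

text \<open>Replaces the unknown Lipschitz constant of the curve by one that depends only on the
  coercivity of \<open>A\<close> along it. Coercivity is asked at times strictly before
  \<open>t\<close>, because the first exit argument in \<open>unit_speed_curve_stays\<close>
  provides it only there.\<close>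

lemma unit_speed_curve_lipschitz:
  assumes u: "unit_speed_curve S A T \<gamma>" and M: "0 \<le> M" and t: "t \<le> T"
    and coer: "\<And>s v. 0 < s \<Longrightarrow> s < t \<Longrightarrow> (norm v)\<^sup>2 \<le> M\<^sup>2 * inner (A (\<gamma> s) *v v) v"
  shows "M-lipschitz_on {0..t} \<gamma>"
proof -
  obtain L N where "\<forall>t\<in>{0..T}. \<gamma> t \<in> S" and L: "L-lipschitz_on {0..T} \<gamma>" and N: "negligible N"
    and d_ae: "\<forall>t\<in>{0<..<T} - N. \<exists>v. (\<gamma> has_vector_derivative v) (at t) \<and> inner (A (\<gamma> t) *v v) v \<le> 1"
    by (rule unit_speed_curveE[OF u])
  note d = bspec[OF d_ae]
  show ?thesis
  proof (rule lipschitz_on_leI)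
    fix x y assume xy: "x \<in> {0..t}" "y \<in> {0..t}" "x \<le> y"
    show "dist (\<gamma> x) (\<gamma> y) \<le> M * dist x y"
    proof (cases "x = y")
      case False
      with xy have "x < y" by simp
      have "norm (\<gamma> y - \<gamma> x) \<le> M * (y - x)"
      proof (rule abs_continuous_deriv_bound[OF _ \<open>x < y\<close> N M])
        show "abs_continuous_on_interval x y \<gamma>"
          using lipschitz_on_subset[OF L, of "{x..y}"] xy t by (intro lipschitz_imp_abs_continuous) auto
        fix s assume s: "s \<in> {x<..<y} - N"
        with xy t have "s \<in> {0<..<T} - N" by auto
        from d[OF this] obtain v where v: "(\<gamma> has_vector_derivative v) (at s)" "inner (A (\<gamma> s) *v v) v \<le> 1" by blast
        have "(norm v)\<^sup>2 \<le> M\<^sup>2 * inner (A (\<gamma> s) *v v) v" using coer[of s v] s xy by auto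
        also have "\<dots> \<le> M\<^sup>2 * 1" by (rule mult_left_mono[OF v(2)]) simp
        finally have "norm v \<le> M" using M by (simp add: power2_le_iff_abs_le)
        with v(1) show "\<exists>v. (\<gamma> has_vector_derivative v) (at s) \<and> norm v \<le> M" by blast
      qed
      with \<open>x < y\<close> show ?thesis by (simp add: dist_norm norm_minus_commute dist_real_def)
    qed simp
  qed (rule M)
qed

text \<open>By compactness the quadratic form has a positive minimum \<open>m\<close> over
  \<open>C\<close> times the unit sphere; homogeneity then gives the bound with M = 1 / sqrt
  m.\<close>

lemma locally_coercive:
  fixes A :: "real ^ 'n \<Rightarrow> real ^ 'n ^ 'n"
  assumes C: "compact C" and cont: "continuous_on C A" and pd: "\<And>x. sym_pos_def (A x)"
  obtains M where "0 < M" "\<forall>x\<in>C. \<forall>v. (norm v)\<^sup>2 \<le> M\<^sup>2 * inner (A x *v v) v"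
proof (cases "C = {}")
  case True
  then show ?thesis using that[of 1] by simp
next
  case False
  define f where "f = (\<lambda>(x, v). inner (A x *v v) v)"
  have bl: "continuous_on (C \<times> sphere 0 1) (\<lambda>y. A (fst y) *v snd y)"
    unfolding matrix_vector_mult_def
    by (intro continuous_on_vec_lambda continuous_intros continuous_on_compose2[OF cont]) auto
  have cf: "continuous_on (C \<times> sphere 0 1) f"
    unfolding f_def case_prod_unfold by (intro continuous_intros bl)
  have "compact (C \<times> sphere (0::real^'n) 1)" "C \<times> sphere (0::real^'n) 1 \<noteq> {}"
    using C False by (auto intro: compact_Times)
  from continuous_attains_inf[OF this cf] obtain x0 v0 where
    0: "x0 \<in> C" "norm v0 = 1" "\<forall>x\<in>C. \<forall>v. norm v = 1 \<longrightarrow> f (x0, v0) \<le> f (x, v)"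
    by auto
  define m where "m = f (x0, v0)"
  have "v0 \<noteq> 0" using 0(2) by auto
  then have m: "m > 0" using pd[of x0] 0(2) unfolding m_def f_def sym_pos_def_def by simp
  show ?thesis
  proof (rule that[of "1 / sqrt m"])
    show "0 < 1 / sqrt m" using m by simp
    show "\<forall>x\<in>C. \<forall>v. (norm v)\<^sup>2 \<le> (1 / sqrt m)\<^sup>2 * inner (A x *v v) v"
    proof (intro ballI allI)
      fix x v assume x: "x \<in> C"
      show "(norm v)\<^sup>2 \<le> (1 / sqrt m)\<^sup>2 * inner (A x *v v) v"
      proof (cases "v = 0")
        case False
        have "m \<le> f (x, (1 / norm v) *\<^sub>R v)" using 0(3) x False by (simp add: m_def)
        also have "\<dots> = inner (A x *v v) v / (norm v)\<^sup>2"
          by (simp add: f_def matrix_vector_mult_scaleR power2_eq_square)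
        finally show ?thesis using m False by (simp add: field_simps)
      qed simp
    qed
  qed
qed

lemma locally_abs_continuous_imp_continuous:
  assumes "locally_abs_continuous \<gamma>"
  shows "continuous_on {0..} \<gamma>"
  unfolding continuous_on_iff
proof (intro ballI allI impI)
  fix t e :: real assume t: "t \<in> {0..}" and "e > 0"
  have "abs_continuous_on_interval 0 (t + 1) \<gamma>"
    using assms t unfolding locally_abs_continuous_def by auto
  then obtain \<delta> where "\<delta> > 0" and \<delta>: "\<forall>P. finite P \<and> (\<forall>(s, s')\<in>P. 0 \<le> s \<and> s \<le> s' \<and> s' \<le> t + 1) \<and>
      pairwise (\<lambda>(s, t) (s', t'). {s<..<t} \<inter> {s'<..<t'} = {}) P \<and> (\<Sum>(s, t)\<in>P. t - s) < \<delta>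
      \<longrightarrow> (\<Sum>(s, t)\<in>P. dist (\<gamma> s) (\<gamma> t)) < e"
    by (rule abs_continuous_on_intervalE[OF _ \<open>e > 0\<close>])
  have *: "dist (\<gamma> a) (\<gamma> b) < e" if "0 \<le> a" "a \<le> b" "b \<le> t + 1" "b - a < \<delta>" for a b
    using \<delta>[THEN spec, of "{(a, b)}"] that by simp
  show "\<exists>d>0. \<forall>x'\<in>{0..}. dist x' t < d \<longrightarrow> dist (\<gamma> x') (\<gamma> t) < e"
  proof (intro exI[of _ "min \<delta> 1"] conjI ballI impI)
    fix x' assume "x' \<in> {0..}" "dist x' t < min \<delta> 1"
    then show "dist (\<gamma> x') (\<gamma> t) < e"
      using *[of x' t] *[of t x'] t by (cases "x' \<le> t") (auto simp: dist_real_def dist_commute)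
  qed (use \<open>\<delta> > 0\<close> in simp)
qed

text \<open>The image of [0, T] is compact, so \<open>A\<close> is coercive on it and the velocity
  is bounded by \<open>M\<close> almost everywhere. Absolute continuity turns this into a Lipschitz
  bound; a merely continuous curve of Cantor type could move with zero velocity almost
  everywhere.\<close>

lemma admissible_imp_unit_speed:
  fixes A :: "real ^ 'n \<Rightarrow> real ^ 'n ^ 'n"
  assumes \<gamma>: "\<gamma> \<in> admissible_curves Obs A" and T: "0 \<le> T"
    and cont: "continuous_on UNIV A" and pd: "\<And>x. sym_pos_def (A x)"
  shows "unit_speed_curve (closure (- Obs)) A T \<gamma>"
proof -
  have ac: "locally_abs_continuous \<gamma>" and S: "\<And>t. 0 \<le> t \<Longrightarrow> \<gamma> t \<in> closure (- Obs)"
    and ae: "AE t in lebesgue. 0 \<le> t \<longrightarrow>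
            (\<exists>v. (\<gamma> has_vector_derivative v) (at t within {0..}) \<and> inner (A (\<gamma> t) *v v) v \<le> 1)"
    using \<gamma> unfolding admissible_curves_def by auto
  from ae obtain N where N: "N \<in> null_sets lebesgue" and
    *: "{t \<in> space lebesgue. \<not> (0 \<le> t \<longrightarrow>
            (\<exists>v. (\<gamma> has_vector_derivative v) (at t within {0..}) \<and> inner (A (\<gamma> t) *v v) v \<le> 1))} \<subseteq> N"
    unfolding eventually_ae_filter by (elim bexE)
  have d: "\<exists>v. (\<gamma> has_vector_derivative v) (at t) \<and> inner (A (\<gamma> t) *v v) v \<le> 1"
    if "0 < t" "t \<notin> N" for t
  proof -
    \<comment> \<open>At positive times the derivative within the half-line is a two-sided
      one.\<close>
    have "at t within {0..} = at t" using that(1) by (intro at_within_interior) simp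
    moreover have "\<not> \<not> (0 \<le> t \<longrightarrow>
            (\<exists>v. (\<gamma> has_vector_derivative v) (at t within {0..}) \<and> inner (A (\<gamma> t) *v v) v \<le> 1))"
      using subsetD[OF *, of t] that(2) by (intro notI) simp
    ultimately show ?thesis using that(1) by simp
  qed
  have cpt: "compact (\<gamma> ` {0..T})"
    by (intro compact_continuous_image continuous_on_subset[OF locally_abs_continuous_imp_continuous[OF ac]]) auto
  obtain M where M: "0 < M" "\<forall>x\<in>\<gamma> ` {0..T}. \<forall>v. (norm v)\<^sup>2 \<le> M\<^sup>2 * inner (A x *v v) v"
    by (rule locally_coercive[OF cpt continuous_on_subset[OF cont] pd]) auto
  show ?thesis
  proof (rule unit_speed_curveI)
    show "M-lipschitz_on {0..T} \<gamma>"
    proof (rule lipschitz_on_leI)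
      fix x y assume xy: "x \<in> {0..T}" "y \<in> {0..T}" "x \<le> y"
      show "dist (\<gamma> x) (\<gamma> y) \<le> M * dist x y"
      proof (cases "x = y")
        case False
        with xy have "x < y" by simp
        have "norm (\<gamma> y - \<gamma> x) \<le> M * (y - x)"
        proof (rule abs_continuous_deriv_bound[OF _ \<open>x < y\<close> _ less_imp_le[OF M(1)]])
          show "abs_continuous_on_interval x y \<gamma>"
            using ac[unfolded locally_abs_continuous_def, THEN spec, THEN mp, OF T] xy
            by (rule_tac abs_continuous_subset) auto
          show "negligible N" using N by (simp add: negligible_iff_null_sets)
          fix s assume s: "s \<in> {x<..<y} - N"
          with xy obtain v where v: "(\<gamma> has_vector_derivative v) (at s)" "inner (A (\<gamma> s) *v v) v \<le> 1"
            using d[of s] by auto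
          have "(norm v)\<^sup>2 \<le> M\<^sup>2 * inner (A (\<gamma> s) *v v) v" using M(2) s xy by auto
          also have "\<dots> \<le> M\<^sup>2 * 1" by (rule mult_left_mono[OF v(2)]) simp
          finally have "norm v \<le> M" using M by (simp add: power2_le_iff_abs_le)
          with v(1) show "\<exists>v. (\<gamma> has_vector_derivative v) (at s) \<and> norm v \<le> M" by blast
        qed
        with \<open>x < y\<close> show ?thesis by (simp add: dist_norm norm_minus_commute dist_real_def)
      qed simp
    qed (use M in simp)
    show "negligible N" using N by (simp add: negligible_iff_null_sets)
  qed (use S d in auto)
qed

text \<open>The curve rests at its endpoint after time \<open>T\<close>; velocity 0 satisfies the
  speed bound. The outer \<open>max\<close> settles negative times.\<close>

lemma unit_speed_imp_admissible:
  fixes A :: "real ^ 'n \<Rightarrow> real ^ 'n ^ 'n"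
  assumes u: "unit_speed_curve (closure (- Obs)) A T \<gamma>" and T: "0 \<le> T"
  shows "(\<lambda>t. \<gamma> (max 0 (min t T))) \<in> admissible_curves Obs A"
proof -
  let ?c = "\<lambda>t. \<gamma> (max 0 (min t T))"
  obtain L N where S: "\<forall>t\<in>{0..T}. \<gamma> t \<in> closure (- Obs)" and L: "L-lipschitz_on {0..T} \<gamma>" and N: "negligible N"
    and d: "\<forall>t\<in>{0<..<T} - N. \<exists>v. (\<gamma> has_vector_derivative v) (at t) \<and> inner (A (\<gamma> t) *v v) v \<le> 1"
    by (rule unit_speed_curveE[OF u])
  have Lc: "L-lipschitz_on X ?c" for X
  proof (rule lipschitz_onI)
    fix x y
    have "dist (?c x) (?c y) \<le> L * dist (max 0 (min x T)) (max 0 (min y T))"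
      using T by (intro lipschitz_onD[OF L]) auto
    also have "\<dots> \<le> L * dist x y"
      using lipschitz_on_nonneg[OF L] by (intro mult_left_mono) (auto simp: dist_real_def)
    finally show "dist (?c x) (?c y) \<le> L * dist x y" .
  qed (rule lipschitz_on_nonneg[OF L])
  have ne: "negligible (N \<union> {0, T})" using N by (intro negligible_Un) auto
  have "AE t in lebesgue. t \<notin> N \<union> {0, T}"
    using ne by (intro AE_not_in) (simp add: negligible_iff_null_sets)
  then have "AE t in lebesgue. 0 \<le> t \<longrightarrow>
            (\<exists>v. (?c has_vector_derivative v) (at t within {0..}) \<and> inner (A (?c t) *v v) v \<le> 1)"
  proof (rule AE_mp, intro AE_I2 impI)
    fix t assume t: "t \<notin> N \<union> {0, T}" "0 \<le> t"
    show "\<exists>v. (?c has_vector_derivative v) (at t within {0..}) \<and> inner (A (?c t) *v v) v \<le> 1"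
    proof (cases "t < T")
      case True
      with t have "t \<in> {0<..<T} - N" by auto
      with d obtain v where v: "(\<gamma> has_vector_derivative v) (at t)" "inner (A (\<gamma> t) *v v) v \<le> 1" by blast
      have "(?c has_vector_derivative v) (at t)"
        by (rule has_vector_derivative_transform_within_open[OF v(1), of "{0<..<T}"])
          (use True t in auto)
      with v(2) True t show ?thesis by (auto intro: has_vector_derivative_at_within)
    next
      case False
      have "((\<lambda>t. \<gamma> T) has_vector_derivative 0) (at t)" by simp
      then have "(?c has_vector_derivative 0) (at t)"
        by (rule has_vector_derivative_transform_within_open[of _ _ _ "{T<..}"])
          (use False t T in auto)
      then show ?thesis by (intro exI[of _ 0]) (auto intro: has_vector_derivative_at_within)
    qed
  qed
  moreover have "locally_abs_continuous ?c"
    unfolding locally_abs_continuous_def by (auto intro: lipschitz_imp_abs_continuous[OF Lc])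
  ultimately show ?thesis
    unfolding admissible_curves_def using S T by auto
qed

section \<open>The distance as an infimum of travel times\<close>

locale obstacle_problem =
  fixes Obs :: "(real ^ 'n) set" and A :: "real ^ 'n \<Rightarrow> real ^ 'n ^ 'n" and k\<^sub>0 :: "real ^ 'n"
  assumes cont_A: "continuous_on UNIV A" and pos_def_A: "\<And>x. sym_pos_def (A x)"
begin

abbreviation "d \<equiv> obstacle_dist Obs A k\<^sub>0"
abbreviation "S \<equiv> closure (- Obs)"

lemma hitting_time_le: "0 \<le> t \<Longrightarrow> \<gamma> t = k\<^sub>0 \<Longrightarrow> hitting_time k\<^sub>0 \<gamma> \<le> ereal t"
  unfolding hitting_time_def by (rule Inf_lower) auto

lemma hitting_time_nonneg: "0 \<le> hitting_time k\<^sub>0 (\<gamma> :: real \<Rightarrow> real ^ 'n)"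
  unfolding hitting_time_def by (rule Inf_greatest) auto

lemma joined_imp_INF_le:
  assumes "joined S A x k\<^sub>0 T"
  shows "(INF \<gamma>\<in>{\<gamma> \<in> admissible_curves Obs A. \<gamma> 0 = x}. hitting_time k\<^sub>0 \<gamma>) \<le> ereal T"
proof -
  obtain \<gamma> where T: "0 \<le> T" and u: "unit_speed_curve S A T \<gamma>" and e: "\<gamma> 0 = x" "\<gamma> T = k\<^sub>0"
    using assms unfolding joined_def by blast
  show ?thesis
  proof (rule INF_lower2)
    show "(\<lambda>t. \<gamma> (max 0 (min t T))) \<in> {\<gamma> \<in> admissible_curves Obs A. \<gamma> 0 = x}"
      using unit_speed_imp_admissible[OF u T] e T by simp
    show "hitting_time k\<^sub>0 (\<lambda>t. \<gamma> (max 0 (min t T))) \<le> ereal T"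
      by (rule hitting_time_le) (use e T in auto)
  qed
qed

lemma INF_nonneg: "0 \<le> (INF \<gamma>\<in>{\<gamma> \<in> admissible_curves Obs A. \<gamma> 0 = x}. hitting_time k\<^sub>0 \<gamma>)"
  by (rule INF_greatest) (rule hitting_time_nonneg)

lemma obstacle_dist_le:
  assumes "joined S A x k\<^sub>0 T" shows "d x \<le> T"
proof -
  let ?E = "INF \<gamma>\<in>{\<gamma> \<in> admissible_curves Obs A. \<gamma> 0 = x}. hitting_time k\<^sub>0 \<gamma>"
  obtain e where "?E = ereal e"
    using joined_imp_INF_le[OF assms] INF_nonneg[of x] by (cases ?E) auto
  with joined_imp_INF_le[OF assms] show ?thesis by (simp add: obstacle_dist_def)
qed

text \<open>The given travel time \<open>T\<close> makes the infimum finite. For an infinite one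
  \<open>real_of_ereal\<close> would return its default 0, and no curve would come close to it.
  These near-optimal curves stand in for geodesics.\<close>

lemma obstacle_dist_approx:
  assumes "joined S A x k\<^sub>0 T" "\<epsilon> > 0"
  obtains T' where "joined S A x k\<^sub>0 T'" "T' \<le> d x + \<epsilon>"
proof -
  let ?E = "INF \<gamma>\<in>{\<gamma> \<in> admissible_curves Obs A. \<gamma> 0 = x}. hitting_time k\<^sub>0 \<gamma>"
  obtain e where e: "?E = ereal e"
    using joined_imp_INF_le[OF assms(1)] INF_nonneg[of x] by (cases ?E) auto
  then have "d x = e" by (simp add: obstacle_dist_def)
  have "?E < ereal (e + \<epsilon>)" using e assms(2) by simp
  then obtain \<gamma> where \<gamma>: "\<gamma> \<in> admissible_curves Obs A" "\<gamma> 0 = x" "hitting_time k\<^sub>0 \<gamma> < ereal (e + \<epsilon>)"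
    unfolding INF_less_iff by blast
  then obtain t where t: "0 \<le> t" "\<gamma> t = k\<^sub>0" "t < e + \<epsilon>"
    unfolding hitting_time_def Inf_less_iff by auto
  have "joined S A x k\<^sub>0 t"
    unfolding joined_def
    using admissible_imp_unit_speed[OF \<gamma>(1) t(1) cont_A pos_def_A] \<gamma>(2) t by blast
  with t \<open>d x = e\<close> show ?thesis by (intro that[of t]) auto
qed

lemma obstacle_dist_joined:
  assumes "joined S A x y t" "joined S A y k\<^sub>0 T"
  shows "d x \<le> t + d y"
proof (rule field_le_epsilon)
  fix e :: real assume "e > 0"
  obtain T' where "joined S A y k\<^sub>0 T'" "T' \<le> d y + e"
    by (rule obstacle_dist_approx[OF assms(2) \<open>e > 0\<close>])
  with obstacle_dist_le[OF joined_trans[OF assms(1) this(1)]] show "d x \<le> t + d y + e" by simp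
qed

end

section \<open>The local retraction onto the closed complement of the obstacle\<close>

text \<open>A zero with nonzero derivative is isolated among all zeros, so some interval with
  rational endpoints contains it and no other such zero; there are countably many pairs of
  rationals.\<close>

lemma countable_simple_zeros:
  fixes h :: "real \<Rightarrow> real"
  shows "countable {t. h t = 0 \<and> (\<exists>D. D \<noteq> 0 \<and> (h has_real_derivative D) (at t))}" (is "countable ?E")
proof -
  have iso: "\<exists>q::rat \<times> rat. of_rat (fst q) < t \<and> t < of_rat (snd q) \<and>
      (\<forall>s\<in>?E. of_rat (fst q) < s \<and> s < of_rat (snd q) \<longrightarrow> s = t)" if "t \<in> ?E" for t
  proof -
    from that obtain D where D: "h t = 0" "D \<noteq> 0" "(h has_real_derivative D) (at t)" by blast
    have "((\<lambda>s. (h s - h t) / (s - t)) \<longlongrightarrow> D) (at t)"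
      using D(3) by (simp add: has_field_derivative_iff)
    from tendsto_imp_eventually_ne[OF this D(2)]
    have "eventually (\<lambda>s. h s \<noteq> 0) (at t)"
      by eventually_elim (use D(1) in auto)
    then obtain \<delta> where \<delta>: "\<delta> > 0" "\<forall>s. s \<noteq> t \<and> dist s t < \<delta> \<longrightarrow> h s \<noteq> 0"
      unfolding eventually_at by auto
    obtain q1 where q1: "t - \<delta> < of_rat q1" "of_rat q1 < t"
      using of_rat_dense[of "t - \<delta>" t] \<delta>(1) by auto
    obtain q2 where q2: "t < of_rat q2" "of_rat q2 < t + \<delta>"
      using of_rat_dense[of t "t + \<delta>"] \<delta>(1) by auto
    show ?thesis
    proof (intro exI[of _ "(q1, q2)"] conjI ballI impI)
      fix s assume "s \<in> ?E" "of_rat (fst (q1, q2)) < s \<and> s < of_rat (snd (q1, q2))"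
      then have "h s = 0" "dist s t < \<delta>" using q1 q2 by (auto simp: dist_real_def abs_less_iff)
      then show "s = t" using \<delta>(2) by blast
    qed (use q1 q2 in auto)
  qed
  then have "\<forall>t\<in>?E. \<exists>q::rat \<times> rat. of_rat (fst q) < t \<and> t < of_rat (snd q) \<and>
      (\<forall>s\<in>?E. of_rat (fst q) < s \<and> s < of_rat (snd q) \<longrightarrow> s = t)" by blast
  from bchoice[OF this] obtain f :: "real \<Rightarrow> rat \<times> rat" where
    f: "\<forall>t\<in>?E. of_rat (fst (f t)) < t \<and> t < of_rat (snd (f t)) \<and>
      (\<forall>s\<in>?E. of_rat (fst (f t)) < s \<and> s < of_rat (snd (f t)) \<longrightarrow> s = t)"
    by (rule exE)
  have "inj_on f ?E"
  proof (rule inj_onI)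
    fix s t assume st: "s \<in> ?E" "t \<in> ?E" "f s = f t"
    have "of_rat (fst (f t)) < s \<and> s < of_rat (snd (f t))"
      using bspec[OF f st(1)] st(3) by simp
    then show "s = t" using bspec[OF f st(2)] st(1) by blast
  qed
  then show ?thesis by (rule countableI')
qed

text \<open>The negative part has a corner only where \<open>h\<close> crosses 0 with nonzero slope:
  at a zero with slope 0, \<open>h\<close> is o(s - t), and its negative part is dominated by
  it.\<close>

lemma has_real_derivative_neg_part:
  fixes h :: "real \<Rightarrow> real"
  assumes h: "(h has_real_derivative D) (at t)" and 0: "h t = 0 \<Longrightarrow> D = 0"
  shows "((\<lambda>s. max 0 (- h s)) has_real_derivative (if h t < 0 then - D else 0)) (at t)"
proof -
  have "isCont h t" using h by (rule DERIV_isCont)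
  then have lim: "(h \<longlongrightarrow> h t) (nhds t)" by (simp add: continuous_at tendsto_at_iff_tendsto_nhds)
  consider "h t < 0" | "h t > 0" | "h t = 0" by linarith
  then show ?thesis
  proof cases
    case 1
    have "eventually (\<lambda>s. - h s = max 0 (- h s)) (nhds t)"
      using order_tendstoD(2)[OF lim 1] by eventually_elim auto
    from DERIV_cong_ev[OF refl this refl] DERIV_minus[OF h] 1 show ?thesis by simp
  next
    case 2
    have "eventually (\<lambda>s. 0 = max 0 (- h s)) (nhds t)"
      using order_tendstoD(1)[OF lim 2] by eventually_elim auto
    from DERIV_cong_ev[OF refl this refl, of 0] 2 show ?thesis by simp
  next
    case 3
    then have "((\<lambda>s. h s / (s - t)) \<longlongrightarrow> 0) (at t)"
      using h 0 by (simp add: has_field_derivative_iff)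
    then have "((\<lambda>s. max 0 (- h s) / (s - t)) \<longlongrightarrow> 0) (at t)"
      by (rule tendsto_0_le[where K=1]) (auto simp: divide_right_mono intro!: always_eventually)
    then show ?thesis using 3 by (simp add: has_field_derivative_iff)
  qed
qed

lemma sym_pos_defD:
  assumes "sym_pos_def M"
  shows "inner (M *v x) y = inner x (M *v y)" "0 \<le> inner (M *v v) v" "v \<noteq> 0 \<Longrightarrow> 0 < inner (M *v v) v"
    "det M \<noteq> 0"
proof -
  have "transpose M = M" and pd: "\<And>v. v \<noteq> 0 \<Longrightarrow> 0 < inner (M *v v) v"
    using assms unfolding sym_pos_def_def by auto
  then show "inner (M *v x) y = inner x (M *v y)"
    by (metis dot_lmul_matrix transpose_matrix_vector)
  show "v \<noteq> 0 \<Longrightarrow> 0 < inner (M *v v) v" by (rule pd)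
  show "0 \<le> inner (M *v v) v" using pd[of v] by (cases "v = 0") auto
  have "\<forall>x. M *v x = 0 \<longrightarrow> x = 0"
    using pd by (metis inner_zero_left less_irrefl)
  then show "det M \<noteq> 0"
    by (metis invertible_det_nz invertible_left_inverse matrix_left_invertible_ker)
qed

text \<open>\<nu> is the multiple of A^-1 G normalized so that, with \<open>G\<close> the gradient
  of g, a step of length parameter s along \<nu> raises g by s to first order. Cramer's rule
  expresses it through determinants in the entries of \<open>A\<close> and \<open>G\<close>, which
  makes it C^1.\<close>

lemma conormal_field:
  fixes A :: "real ^ 'n \<Rightarrow> real ^ 'n ^ 'n" and G :: "real ^ 'n \<Rightarrow> real ^ 'n"
  assumes A: "C1_on A V" and G: "C1_on G V" and pd: "\<And>y. sym_pos_def (A y)"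
    and G0: "\<And>y. y \<in> V \<Longrightarrow> G y \<noteq> 0"
  obtains \<nu> where "C1_on \<nu> V" "\<forall>y\<in>V. inner (G y) (\<nu> y) = 1"
    "\<forall>y\<in>V. \<exists>\<kappa>\<ge>0. A y *v \<nu> y = \<kappa> *\<^sub>R G y"
proof -
  \<comment> \<open>By Cramer's rule this is A^-1 G times the determinant of \<open>A\<close>; that
    factor cancels in the normalization.\<close>
  define N where "N y = (\<chi> k. det (\<chi> i j. if j = k then G y $ i else A y $ i $ j))" for y
  have "C1_on (\<lambda>y. A y $ i $ j) V" for i j
    by (rule C1_on_bounded_linear[OF A bounded_linear_compose[OF bounded_linear_vec_nth bounded_linear_vec_nth]])
  moreover have "C1_on (\<lambda>y. G y $ i) V" for i
    by (rule C1_on_bounded_linear[OF G bounded_linear_vec_nth])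
  ultimately have "C1_on (\<lambda>y. if j = k then G y $ i else A y $ i $ j) V" for i j k
    by (cases "j = k") simp_all
  then have N: "C1_on N V" unfolding N_def
    by (intro C1_on_vec_lambda C1_on_det) simp
  have key: "inner (N y) (G y) \<noteq> 0 \<and> (\<exists>\<kappa>\<ge>0. A y *v N y = (\<kappa> * inner (N y) (G y)) *\<^sub>R G y)" if "y \<in> V" for y
  proof -
    let ?D = "det (A y)"
    have D: "?D \<noteq> 0" using sym_pos_defD(4)[OF pd] .
    define x where "x = (\<chi> k. det (\<chi> i j. if j = k then G y $ i else A y $ i $ j) / ?D)"
    have Ax: "A y *v x = G y" using cramer[OF D] x_def by blast
    have Nx: "N y = ?D *\<^sub>R x" using D by (simp add: N_def x_def vec_eq_iff)
    have "x \<noteq> 0" using Ax G0[OF that] by auto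
    then have pos: "0 < inner x (G y)" using sym_pos_defD(3)[OF pd, of x y] Ax by (simp add: inner_commute)
    show ?thesis
    proof (intro conjI exI[of _ "1 / inner x (G y)"])
      show "inner (N y) (G y) \<noteq> 0" using Nx D pos by simp
      show "A y *v N y = (1 / inner x (G y) * inner (N y) (G y)) *\<^sub>R G y"
        using Nx Ax pos by (simp add: matrix_vector_mult_scaleR)
    qed (use pos in simp)
  qed
  have inn: "C1_on (\<lambda>y. inner (N y) (G y)) V"
    by (rule bounded_bilinear.C1_on_bilinear[OF bounded_bilinear_inner N G])
  show ?thesis
  proof (rule that[of "\<lambda>y. (1 / inner (N y) (G y)) *\<^sub>R N y"])
    show "C1_on (\<lambda>y. (1 / inner (N y) (G y)) *\<^sub>R N y) V"
      using key by (intro C1_on_scaleR C1_on_divide C1_on_const inn N) auto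
    show "\<forall>y\<in>V. inner (G y) ((1 / inner (N y) (G y)) *\<^sub>R N y) = 1"
      using key by (auto simp: inner_commute)
    show "\<forall>y\<in>V. \<exists>\<kappa>\<ge>0. A y *v (1 / inner (N y) (G y)) *\<^sub>R N y = \<kappa> *\<^sub>R G y"
    proof
      fix y assume "y \<in> V"
      from key[OF this] obtain \<kappa> where "inner (N y) (G y) \<noteq> 0" "\<kappa> \<ge> 0" "A y *v N y = (\<kappa> * inner (N y) (G y)) *\<^sub>R G y"
        by blast
      then show "\<exists>\<kappa>\<ge>0. A y *v (1 / inner (N y) (G y)) *\<^sub>R N y = \<kappa> *\<^sub>R G y"
        by (intro exI[of _ \<kappa>]) (simp add: matrix_vector_mult_scaleR)
    qed
  qed
qed

text \<open>\<nu> is M-orthogonal to the kernel of inner G, so the vector on the left is the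
  M-orthogonal projection of \<open>v\<close> onto this kernel. By Pythagoras the two sides differ
  by \<kappa> <G, v>^2.\<close>

lemma conormal_projection_le:
  fixes M :: "real ^ 'n ^ 'n"
  assumes M: "sym_pos_def M" and "inner G \<nu> = 1" "M *v \<nu> = \<kappa> *\<^sub>R G" "0 \<le> \<kappa>"
  shows "inner (M *v (v - inner G v *\<^sub>R \<nu>)) (v - inner G v *\<^sub>R \<nu>) \<le> inner (M *v v) v"
proof -
  let ?a = "inner G v"
  have "inner (M *v v) \<nu> = \<kappa> * ?a" using sym_pos_defD(1)[OF M, of v \<nu>] assms(3) by (simp add: inner_commute)
  then have "inner (M *v (v - ?a *\<^sub>R \<nu>)) (v - ?a *\<^sub>R \<nu>) = inner (M *v v) v - \<kappa> * ?a\<^sup>2"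
    using assms(2,3)
    by (simp add: matrix_vector_mult_diff_distrib matrix_vector_mult_scaleR inner_diff_left inner_diff_right
        power2_eq_square algebra_simps inner_commute)
  then show ?thesis using assms(4) by simp
qed

lemma quadratic_form_bound:
  obtains K where "0 < K" "\<forall>(M :: real ^ 'n ^ 'n) u v. \<bar>inner (M *v u) v\<bar> \<le> K * norm M * norm u * norm v"
proof -
  have "bilinear ((*v) :: real^'n^'n \<Rightarrow> real^'n \<Rightarrow> real^'n)"
    unfolding bilinear_def
    by (auto intro!: linearI simp: matrix_vector_mult_add_rdistrib matrix_vector_right_distrib
        matrix_vector_mult_scaleR scaleR_matrix_vector_assoc)
  then have "bounded_bilinear ((*v) :: real^'n^'n \<Rightarrow> real^'n \<Rightarrow> real^'n)"
    by (simp add: bilinear_conv_bounded_bilinear)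
  from bounded_bilinear.pos_bounded[OF this] obtain K where
    K: "0 < K" "\<And>(M :: real^'n^'n) (u :: real^'n). norm (M *v u) \<le> norm M * norm u * K" by blast
  show ?thesis
  proof (rule that[OF K(1)], intro allI)
    fix M :: "real^'n^'n" and u v :: "real^'n"
    have "\<bar>inner (M *v u) v\<bar> \<le> norm (M *v u) * norm v" by (rule Cauchy_Schwarz_ineq2)
    also have "\<dots> \<le> (norm M * norm u * K) * norm v" by (intro mult_right_mono K) simp
    finally show "\<bar>inner (M *v u) v\<bar> \<le> K * norm M * norm u * norm v" by (simp add: mult_ac)
  qed
qed

text \<open>Applied with M = A y, M' = A (\<Phi> y), \<open>a\<close> the projected velocity,
  \<open>n\<close> the depth inside the obstacle and x = norm v. Matrix and vector both change by
  O(n), hence so does the form, with a constant free of \<open>n\<close> and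
  \<open>x\<close>.\<close>

lemma quadratic_form_perturb:
  fixes M M' :: "real ^ 'n ^ 'n"
  assumes K: "0 < K" "\<forall>(M :: real ^ 'n ^ 'n) u v. \<bar>inner (M *v u) v\<bar> \<le> K * norm M * norm u * norm v"
    and M: "norm M \<le> B" "norm (M' - M) \<le> c1 * n" and a: "norm a \<le> c2 * x" and b: "norm b \<le> c3 * x"
    and n: "0 \<le> n" "n \<le> 1" and x: "0 \<le> x" and c: "0 \<le> c1" "0 \<le> c2" "0 \<le> c3"
  shows "inner (M' *v (a + n *\<^sub>R b)) (a + n *\<^sub>R b) \<le>
    inner (M *v a) a + n * (K * (c1 * (c2 + c3)\<^sup>2 + B * (2 * c2 * c3 + c3\<^sup>2))) * x\<^sup>2"
proof -
  let ?u = "a + n *\<^sub>R b"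
  have B: "0 \<le> B" using M(1) norm_ge_zero[of M] by linarith
  have "norm ?u \<le> norm a + n * norm b" using norm_triangle_ineq[of a "n *\<^sub>R b"] n by simp
  also have "n * norm b \<le> norm b" using n by (simp add: mult_left_le_one_le)
  finally have u: "norm ?u \<le> (c2 + c3) * x" using a b by (simp add: algebra_simps)
  have bd: "inner (L *v y) z \<le> K * (l * (p * x) * (q * x))"
    if "norm L \<le> l" "norm y \<le> p * x" "norm z \<le> q * x" "0 \<le> l" "0 \<le> p" "0 \<le> q"
    for L :: "real ^ 'n ^ 'n" and y z l p q
  proof -
    have "inner (L *v y) z \<le> K * norm L * norm y * norm z" using K(2) abs_le_D1 by blast
    also have "\<dots> = K * (norm L * norm y * norm z)" by simp
    also have "\<dots> \<le> K * (l * (p * x) * (q * x))"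
      using that K(1) x by (intro mult_left_mono mult_mono) auto
    finally show ?thesis .
  qed
  have 1: "inner ((M' - M) *v ?u) ?u \<le> K * (c1 * n * ((c2 + c3) * x) * ((c2 + c3) * x))"
    by (rule bd[OF M(2) u u]) (use n c in auto)
  have 2: "inner (M *v a) b \<le> K * (B * (c2 * x) * (c3 * x))" by (rule bd[OF M(1) a b]) (use c B in auto)
  have 3: "inner (M *v b) a \<le> K * (B * (c3 * x) * (c2 * x))" by (rule bd[OF M(1) b a]) (use c B in auto)
  have 4: "inner (M *v b) b \<le> K * (B * (c3 * x) * (c3 * x))" by (rule bd[OF M(1) b b]) (use c B in auto)
  have "n * inner (M *v b) b \<le> 1 * (K * (B * (c3 * x) * (c3 * x)))"
    using n K c B x by (intro order_trans[OF mult_left_mono[OF 4]] mult_right_mono) auto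
  with 2 3 have "inner (M *v a) b + inner (M *v b) a + n * inner (M *v b) b
      \<le> K * (B * (2 * c2 * c3 + c3\<^sup>2)) * x\<^sup>2"
    by (simp add: algebra_simps power2_eq_square)
  then have 5: "n * (inner (M *v a) b + inner (M *v b) a + n * inner (M *v b) b)
      \<le> n * (K * (B * (2 * c2 * c3 + c3\<^sup>2)) * x\<^sup>2)" using n by (intro mult_left_mono) auto
  have "inner (M' *v ?u) ?u = inner ((M' - M) *v ?u) ?u + inner (M *v ?u) ?u"
    by (simp add: matrix_vector_mult_diff_rdistrib inner_diff_left)
  also have "inner (M *v ?u) ?u = inner (M *v a) a + n * (inner (M *v a) b + inner (M *v b) a + n * inner (M *v b) b)"
    by (simp add: matrix_vector_right_distrib matrix_vector_mult_scaleR inner_add_left inner_add_right algebra_simps)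
  finally show ?thesis using 1 5 by (simp add: algebra_simps power2_eq_square)
qed

text \<open>The exceptional set \<open>E\<close> consists of the times at which \<open>w\<close> crosses the boundary transversally:
  there \<open>\<Phi> \<circ> w\<close> has a corner.\<close>

definition local_retraction ::
    "(real ^ 'n) set \<Rightarrow> (real ^ 'n \<Rightarrow> real ^ 'n ^ 'n) \<Rightarrow> (real ^ 'n) set \<Rightarrow> real \<Rightarrow> (real ^ 'n \<Rightarrow> real ^ 'n) \<Rightarrow> bool" where
  "local_retraction S A V C \<Phi> \<longleftrightarrow>
     (\<forall>y\<in>V. \<Phi> y \<in> S) \<and> (\<forall>y\<in>V \<inter> S. \<Phi> y = y) \<and> C-lipschitz_on V \<Phi> \<and>
     (\<forall>w :: real \<Rightarrow> real ^ 'n. \<exists>E. countable E \<and>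
        (\<forall>t v. t \<notin> E \<and> w t \<in> V \<and> (w has_vector_derivative v) (at t) \<longrightarrow>
          (\<exists>u. ((\<lambda>s. \<Phi> (w s)) has_vector_derivative u) (at t) \<and>
            (\<forall>s\<in>V \<inter> S. inner (A (\<Phi> (w t)) *v u) u
               \<le> inner (A (w t) *v v) v + C * norm (w t - s) * (norm v)\<^sup>2))))"

lemma local_retractionD:
  assumes "local_retraction S A V C \<Phi>"
  shows "y \<in> V \<Longrightarrow> \<Phi> y \<in> S" "y \<in> V \<Longrightarrow> y \<in> S \<Longrightarrow> \<Phi> y = y" "C-lipschitz_on V \<Phi>"
  using assms unfolding local_retraction_def by simp_all

lemma local_retraction_speedE:
  fixes w :: "real \<Rightarrow> real ^ 'n"
  assumes "local_retraction S A V C \<Phi>"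
  obtains E where "countable E"
    "\<forall>t v. t \<notin> E \<and> w t \<in> V \<and> (w has_vector_derivative v) (at t) \<longrightarrow>
          (\<exists>u. ((\<lambda>s. \<Phi> (w s)) has_vector_derivative u) (at t) \<and>
            (\<forall>s\<in>V \<inter> S. inner (A (\<Phi> (w t)) *v u) u
               \<le> inner (A (w t) *v v) v + C * norm (w t - s) * (norm v)\<^sup>2))"
  using assms[unfolded local_retraction_def, THEN conjunct2, THEN conjunct2, THEN conjunct2, THEN spec, of w]
  by (elim exE conjE) (rule that)

lemma local_retraction_id:
  assumes "open V" "V \<subseteq> S"
  shows "local_retraction S A V 1 (\<lambda>y. y)"
  unfolding local_retraction_def
  using assms by (auto intro!: exI[of _ "{}"] lipschitz_on_id)

text \<open>Writing \<open>m\<close> for the negative part of \<open>g\<close>, the retraction is \<open>\<Phi> = id + (m + k m\<^sup>2) \<nu>\<close>, where \<open>\<nu>\<close> is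
  the conormal field. The quadratic term compensates the curvature of the boundary, so that \<open>\<Phi>\<close> does
  not leave \<open>S\<close>. Inside the obstacle the derivative of \<open>\<Phi>\<close> is, up to \<open>O(m)\<close>, the \<open>A\<close>-orthogonal
  projection along \<open>\<nu>\<close>, hence does not increase the \<open>A\<close>-norm; and \<open>m = O(norm (w t - s))\<close> for
  \<open>s \<in> S\<close>.\<close>

lemma local_retraction_boundary:
  fixes A :: "real ^ 'n \<Rightarrow> real ^ 'n ^ 'n" and g :: "real ^ 'n \<Rightarrow> real"
  assumes V0: "open V0" "p \<in> V0" and g: "C2_on g V0" and gp: "g p = 0"
    and nz: "\<And>x. x \<in> V0 \<Longrightarrow> \<not> (g has_derivative (\<lambda>_. 0)) (at x)"
    and S: "\<And>x. x \<in> V0 \<Longrightarrow> x \<in> S \<longleftrightarrow> 0 \<le> g x"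
    and A: "C1_on A UNIV" and pd: "\<And>x. sym_pos_def (A x)"
  obtains R C \<Phi> where "0 < R" "0 < C" "local_retraction S A (ball p R) C \<Phi>"
proof -
  obtain g' where g'0: "\<forall>x\<in>V0. (g has_derivative blinfun_apply (g' x)) (at x)" and g'C1: "C1_on g' V0"
    using g unfolding C2_on_def by blast
  note g' = bspec[OF g'0]
  define G where "G y = (\<chi> i. blinfun_apply (g' y) (axis i 1))" for y
  have GC1: "C1_on G V0"
    unfolding G_def
    by (intro C1_on_vec_lambda C1_on_bounded_linear[OF g'C1] blinfun.bounded_linear_left)
  have G: "blinfun_apply (g' y) v = inner (G y) v" for y v
  proof -
    have "blinfun_apply (g' y) v = blinfun_apply (g' y) (\<Sum>i\<in>UNIV. (v $ i) *\<^sub>R axis i 1)"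
      using basis_expansion[of v] by (simp add: scalar_mult_eq_scaleR)
    also have "\<dots> = (\<Sum>i\<in>UNIV. v $ i * blinfun_apply (g' y) (axis i 1))"
      by (simp add: blinfun.sum_right blinfun.scaleR_right)
    also have "\<dots> = inner (G y) v" by (simp add: inner_vec_def G_def mult.commute)
    finally show ?thesis .
  qed
  have G0: "G y \<noteq> 0" if "y \<in> V0" for y
  proof
    assume "G y = 0"
    then have "blinfun_apply (g' y) = (\<lambda>_. 0)" using G by auto
    then show False using nz[OF that] g'[OF that] by simp
  qed
  obtain \<nu> where \<nu>C1: "C1_on \<nu> V0" and G\<nu>: "\<forall>y\<in>V0. inner (G y) (\<nu> y) = 1"
    and A\<nu>: "\<forall>y\<in>V0. \<exists>\<kappa>\<ge>0. A y *v \<nu> y = \<kappa> *\<^sub>R G y"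
    by (rule conormal_field[OF C1_on_subset[OF A] GC1 pd G0]) auto
  obtain rA BA A' where rA: "0 < rA" and A1: "BA-lipschitz_on (ball p rA) A" and A2: "\<And>x. x \<in> ball p rA \<Longrightarrow> norm (A x) \<le> BA"
    using C1_on_local_bound[OF A open_UNIV UNIV_I, of p] by metis
  obtain rG BG where rG: "0 < rG" and G1: "BG-lipschitz_on (ball p rG) G" and G2: "\<And>x. x \<in> ball p rG \<Longrightarrow> norm (G x) \<le> BG"
    using C1_on_local_bound[OF GC1 V0] by metis
  obtain r\<nu> B\<nu> \<nu>' where r\<nu>: "0 < r\<nu>" "ball p r\<nu> \<subseteq> V0" and \<nu>1: "B\<nu>-lipschitz_on (ball p r\<nu>) \<nu>"
    and \<nu>2: "\<forall>x\<in>ball p r\<nu>. (\<nu> has_derivative blinfun_apply (\<nu>' x)) (at x) \<and> norm (\<nu>' x) \<le> B\<nu> \<and> norm (\<nu> x) \<le> B\<nu>"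
    by (rule C1_on_local_bound[OF \<nu>C1 V0]) blast
  obtain rg Bg where rg: "0 < rg" and g1: "Bg-lipschitz_on (ball p rg) g"
    using C1_on_local_bound[OF C2_imp_C1[OF g] V0] by metis
  define R1 where "R1 = min (min rA rG) (min r\<nu> rg)"
  define B where "B = 1 + max (max BA BG) (max B\<nu> Bg)"
  have R1: "0 < R1" using rA rG r\<nu> rg by (simp add: R1_def)
  have sub: "ball p R1 \<subseteq> ball p rA" "ball p R1 \<subseteq> ball p rG" "ball p R1 \<subseteq> ball p r\<nu>" "ball p R1 \<subseteq> ball p rg"
    by (auto simp: R1_def)
  have BB: "BA \<le> B" "BG \<le> B" "B\<nu> \<le> B" "Bg \<le> B" by (auto simp: B_def)
  have B1: "1 \<le> B" using lipschitz_on_nonneg[OF A1] by (simp add: B_def)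
  note lip = lipschitz_on_mono[OF A1 sub(1) BB(1)] lipschitz_on_mono[OF G1 sub(2) BB(2)]
    lipschitz_on_mono[OF \<nu>1 sub(3) BB(3)] lipschitz_on_mono[OF g1 sub(4) BB(4)]
  have nA: "norm (A x) \<le> B" and nG: "norm (G x) \<le> B" and n\<nu>: "norm (\<nu> x) \<le> B"
    and d\<nu>: "(\<nu> has_derivative blinfun_apply (\<nu>' x)) (at x)" and n\<nu>': "norm (\<nu>' x) \<le> B" and xV0: "x \<in> V0"
    if "x \<in> ball p R1" for x
    using A2[of x] G2[of x] bspec[OF \<nu>2, of x] sub BB that r\<nu>(2) by force+
  \<comment> \<open>Chosen so that \<open>B ^ 3 * (2 * m y)\<^sup>2 = k * (m y)\<^sup>2\<close>: the
    quadratic term of the displacement pays exactly for the second order loss of \<open>g\<close>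
    along it.\<close>
  define k where "k = 4 * B ^ 3"
  have k: "4 \<le> k" using one_le_power[OF B1, of 3] by (simp add: k_def)
  \<comment> \<open>The first bound keeps the segment from \<open>y\<close> to \<Phi> y, of length
    at most 2 B^2 R, in the ball of radius \<open>R1\<close> where all bounds hold. The second gives
    k m \<le> 1, so that the displacement parameter is at most 2 m.\<close>
  define R where "R = min (R1 / (1 + 2 * B\<^sup>2)) (1 / (k * B))"
  have den: "0 < 1 + 2 * B\<^sup>2" using zero_le_power2[of B] by linarith
  have R: "0 < R" "(1 + 2 * B\<^sup>2) * R \<le> R1" "k * (B * R) \<le> 1"
  proof -
    show "0 < R" using R1 den k B1 by (simp add: R_def)
    have "R \<le> R1 / (1 + 2 * B\<^sup>2)" by (simp add: R_def)
    then show "(1 + 2 * B\<^sup>2) * R \<le> R1" using den by (simp add: pos_le_divide_eq mult.commute)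
    have "R \<le> 1 / (k * B)" by (simp add: R_def)
    then show "k * (B * R) \<le> 1" using k B1 by (simp add: pos_le_divide_eq mult_ac)
  qed
  have "R * 1 \<le> R * (1 + 2 * B\<^sup>2)" using R(1) by (intro mult_left_mono) auto
  then have RR: "R \<le> R1" using R(2) by (simp add: mult.commute)
  have sub': "y \<in> ball p R1" if "y \<in> ball p R" for y using that RR by auto
  have p: "p \<in> ball p R1" using R1 by simp
  define m where "m y = max 0 (- g y)" for y
  define \<Phi> where "\<Phi> y = y + (m y * (1 + k * m y)) *\<^sub>R \<nu> y" for y
  have m0: "0 \<le> m y" for y by (simp add: m_def)
  have mlip: "\<bar>m x - m y\<bar> \<le> B * norm (x - y)" if "x \<in> ball p R1" "y \<in> ball p R1" for x y
  proof -
    have "\<bar>m x - m y\<bar> \<le> \<bar>g x - g y\<bar>" by (auto simp: m_def)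
    also have "\<dots> \<le> B * norm (x - y)" using lipschitz_onD[OF lip(4) that] by (simp add: dist_norm)
    finally show ?thesis .
  qed
  have mB: "m y \<le> B * R" if "y \<in> ball p R" for y
  proof -
    have "m y \<le> B * norm (y - p)" using mlip[OF sub'[OF that] p] gp by (simp add: m_def)
    also have "\<dots> \<le> B * R" using that B1 by (intro mult_left_mono) (auto simp: dist_norm norm_minus_commute)
    finally show ?thesis .
  qed
  have km: "k * m y \<le> 1" if "y \<in> ball p R" for y
    using mult_left_mono[OF mB[OF that], of k] k R(3) by linarith
  have m1: "m y \<le> 1" if "y \<in> ball p R" for y
    using km[OF that] mult_right_mono[of 1 k "m y"] k m0[of y] by linarith
  define s where "s y = m y * (1 + k * m y)" for y
  have s: "0 \<le> s y" "s y \<le> 2 * m y" if "y \<in> ball p R" for y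
    using m0[of y] km[OF that] k mult_left_mono[of "1 + k * m y" 2 "m y"] by (auto simp: s_def)
  have \<Phi>s: "\<Phi> y = y + s y *\<^sub>R \<nu> y" for y by (simp add: \<Phi>_def s_def)
  have gS: "0 \<le> g y" if "y \<in> ball p R" "y \<in> S" for y using S[OF xV0[OF sub'[OF that(1)]]] that(2) by simp
  have fixS: "\<Phi> y = y" if "y \<in> ball p R" "0 \<le> g y" for y using that(2) by (simp add: \<Phi>_def m_def)
  have inS: "\<Phi> y \<in> S" if y: "y \<in> ball p R" for y
  proof (cases "0 \<le> g y")
    case True
    then show ?thesis using fixS[OF y] S[OF xV0[OF sub'[OF y]]] by simp
  next
    case False
    define e where "e = s y *\<^sub>R \<nu> y"
    have sn: "norm e \<le> 2 * B * R * B"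
    proof -
      have "norm e = s y * norm (\<nu> y)" using s(1)[OF y] by (simp add: e_def)
      also have "\<dots> \<le> (2 * (B * R)) * B"
        using s[OF y] mB[OF y] n\<nu>[OF sub'[OF y]] by (intro mult_mono) auto
      finally show ?thesis by (simp add: mult_ac)
    qed
    have mem: "y + x *\<^sub>R e \<in> ball p R1" if "x \<in> {0..1}" for x
    proof -
      have "norm (y + x *\<^sub>R e - p) \<le> norm (y - p) + \<bar>x\<bar> * norm e"
        using norm_triangle_ineq[of "y - p" "x *\<^sub>R e"] by (simp add: algebra_simps)
      also have "\<bar>x\<bar> * norm e \<le> 1 * norm e"
        using that by (intro mult_right_mono) auto
      also have "norm (y - p) + 1 * norm e < R + 2 * B * R * B"
        using sn y by (intro add_less_le_mono) (auto simp: dist_norm norm_minus_commute)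
      also have "\<dots> = (1 + 2 * B\<^sup>2) * R" by (simp add: power2_eq_square algebra_simps)
      also have "\<dots> \<le> R1" by (rule R(2))
      finally show ?thesis by (simp add: dist_norm norm_minus_commute)
    qed
    have der: "((\<lambda>x. g (y + x *\<^sub>R e)) has_derivative
        (\<lambda>h. h * inner (G (y + x *\<^sub>R e)) e)) (at x within {0..1})"
      if "x \<in> {0..1}" for x
    proof -
      have "((\<lambda>x. y + x *\<^sub>R e) has_derivative (\<lambda>h. h *\<^sub>R e)) (at x within {0..1})"
        by (auto intro!: derivative_eq_intros)
      from has_derivative_compose[OF this g'[OF xV0[OF mem[OF that]]]]
      show ?thesis by (simp add: G)
    qed
    \<comment> \<open>Mean value theorem on the segment from \<open>y\<close> to \<Phi> y. The
      gradient there differs from \<open>G y\<close> by at most B^2 s, and <G y, \<nu> y> = 1, so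
      \<open>g\<close> gains at least s - B^3 s^2.\<close>
    obtain x where x: "x \<in> {0..1}" and eq: "g (y + 1 *\<^sub>R e) - g (y + 0 *\<^sub>R e)
        = (1 - 0) * inner (G (y + x *\<^sub>R e)) e"
      using mvt_very_simple[of 0 1 "\<lambda>x. g (y + x *\<^sub>R e)", OF _ der] by auto
    let ?z = "y + x *\<^sub>R e"
    have "norm (G ?z - G y) \<le> B * norm (x *\<^sub>R e)"
      using lipschitz_onD[OF lip(2) mem[OF x] sub'[OF y]] by (simp add: dist_norm)
    also have "norm (x *\<^sub>R e) \<le> s y * B"
    proof -
      have "norm (x *\<^sub>R e) = \<bar>x\<bar> * (s y * norm (\<nu> y))" using s(1)[OF y] by (simp add: e_def abs_mult)
      also have "\<dots> \<le> 1 * (s y * B)"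
        using x s(1)[OF y] n\<nu>[OF sub'[OF y]] B1 by (intro mult_mono) auto
      finally show ?thesis by simp
    qed
    finally have Gd: "norm (G ?z - G y) \<le> B * (s y * B)" using B1 by simp
    have "\<bar>inner (G ?z - G y) (\<nu> y)\<bar> \<le> norm (G ?z - G y) * norm (\<nu> y)" by (rule Cauchy_Schwarz_ineq2)
    also have "\<dots> \<le> B * (s y * B) * B" using Gd n\<nu>[OF sub'[OF y]] B1 s(1)[OF y] by (intro mult_mono) auto
    finally have "1 - B ^ 3 * s y \<le> inner (G ?z) (\<nu> y)"
      using bspec[OF G\<nu> xV0[OF sub'[OF y]]] by (simp add: inner_diff_left power3_eq_cube algebra_simps)
    then have "s y * (1 - B ^ 3 * s y) \<le> s y * inner (G ?z) (\<nu> y)" using s(1)[OF y] by (intro mult_left_mono)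
    then have ge: "g y + s y - B ^ 3 * (s y)\<^sup>2 \<le> g (\<Phi> y)"
      using eq by (simp add: \<Phi>s e_def[symmetric])
        (simp add: e_def power2_eq_square algebra_simps)
    \<comment> \<open>The loss B^3 s^2 is at most s - m, whence g (\<Phi> y) \<ge> g y + m y =
      0.\<close>
    have "(s y)\<^sup>2 \<le> (2 * m y)\<^sup>2" using s[OF y] by (intro power_mono) auto
    then have "B ^ 3 * (s y)\<^sup>2 \<le> B ^ 3 * (2 * m y)\<^sup>2" using B1 by (intro mult_left_mono) auto
    also have "\<dots> = k * (m y)\<^sup>2" by (simp add: k_def power2_eq_square)
    also have "\<dots> = s y - m y" by (simp add: s_def power2_eq_square algebra_simps)
    finally have "0 \<le> g (\<Phi> y)" using ge False by (simp add: m_def)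
    moreover have "\<Phi> y \<in> V0" using mem[of 1] xV0 by (simp add: \<Phi>s e_def)
    ultimately show ?thesis using S by blast
  qed
  have slip: "\<bar>s x - s y\<bar> \<le> 3 * B * norm (x - y)" if "x \<in> ball p R" "y \<in> ball p R" for x y
  proof -
    have "s x - s y = (m x - m y) * (1 + k * m x + k * m y)" by (simp add: s_def algebra_simps)
    then have "\<bar>s x - s y\<bar> = \<bar>m x - m y\<bar> * (1 + k * m x + k * m y)"
      using m0 k by (simp add: abs_mult)
    also have "\<dots> \<le> (B * norm (x - y)) * 3"
      using mlip[OF sub'[OF that(1)] sub'[OF that(2)]] km[OF that(1)] km[OF that(2)] m0 k B1
      by (intro mult_mono) auto
    finally show ?thesis by (simp add: mult_ac)
  qed
  define L where "L = 1 + 3 * B * B + 2 * B"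
  have \<Phi>lip: "L-lipschitz_on (ball p R) \<Phi>"
  proof (rule lipschitz_onI)
    fix x y assume xy: "x \<in> ball p R" "y \<in> ball p R"
    have "\<Phi> x - \<Phi> y = (x - y) + (s x - s y) *\<^sub>R \<nu> x + s y *\<^sub>R (\<nu> x - \<nu> y)"
      by (simp add: \<Phi>s algebra_simps)
    then have "norm (\<Phi> x - \<Phi> y) \<le> norm (x - y) + norm ((s x - s y) *\<^sub>R \<nu> x) + norm (s y *\<^sub>R (\<nu> x - \<nu> y))"
      using norm_triangle_ineq[of "(x - y) + (s x - s y) *\<^sub>R \<nu> x" "s y *\<^sub>R (\<nu> x - \<nu> y)"]
        norm_triangle_ineq[of "x - y" "(s x - s y) *\<^sub>R \<nu> x"] by simp
    also have "norm ((s x - s y) *\<^sub>R \<nu> x) \<le> (3 * B * norm (x - y)) * B"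
      using slip[OF xy] n\<nu>[OF sub'[OF xy(1)]] B1 by (auto intro!: mult_mono)
    also have "norm (s y *\<^sub>R (\<nu> x - \<nu> y)) \<le> 2 * (B * norm (x - y))"
    proof -
      have "norm (s y *\<^sub>R (\<nu> x - \<nu> y)) = s y * norm (\<nu> x - \<nu> y)" using s(1)[OF xy(2)] by simp
      also have "\<dots> \<le> 2 * (B * norm (x - y))"
        using s[OF xy(2)] m1[OF xy(2)] lipschitz_onD[OF lip(3) sub'[OF xy(1)] sub'[OF xy(2)]]
        by (intro mult_mono) (auto simp: dist_norm)
      finally show ?thesis .
    qed
    finally show "dist (\<Phi> x) (\<Phi> y) \<le> L * dist x y"
      by (simp add: dist_norm L_def algebra_simps)
  qed (use B1 in \<open>simp add: L_def\<close>)
  obtain K where K: "0 < K" "\<forall>(M :: real ^ 'n ^ 'n) u v. \<bar>inner (M *v u) v\<bar> \<le> K * norm M * norm u * norm v"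
    by (rule quadratic_form_bound)
  \<comment> \<open>\<open>c1\<close> bounds the change of \<open>A\<close> from \<open>y\<close> to
    \<Phi> y per unit of depth; \<open>c2\<close> and \<open>c3\<close> bound, per unit of norm v,
    the projected velocity and the remainder \<open>b\<close> defined below.\<close>
  define c1 where "c1 = 2 * B * B"
  define c2 where "c2 = 1 + B * B"
  define c3 where "c3 = 2 * k * B * B + 2 * B"
  define C' where "C' = K * (c1 * (c2 + c3)\<^sup>2 + B * (2 * c2 * c3 + c3\<^sup>2))"
  have c: "0 \<le> c1" "0 \<le> c2" "0 \<le> c3" using B1 k by (auto simp: c1_def c2_def c3_def)
  have C'0: "0 \<le> C'" unfolding C'_def using c K B1 by (intro mult_nonneg_nonneg add_nonneg_nonneg) auto
  define C where "C = L + C' * B"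
  have L1: "1 \<le> L" using B1 by (simp add: L_def)
  have CL: "L \<le> C" "C' * B \<le> C" using C'0 B1 L1 by (auto simp: C_def)
  have speed: "\<exists>E. countable E \<and>
        (\<forall>t v. t \<notin> E \<and> w t \<in> ball p R \<and> (w has_vector_derivative v) (at t) \<longrightarrow>
          (\<exists>u. ((\<lambda>s. \<Phi> (w s)) has_vector_derivative u) (at t) \<and>
            (\<forall>s\<in>ball p R \<inter> S. inner (A (\<Phi> (w t)) *v u) u
               \<le> inner (A (w t) *v v) v + C * norm (w t - s) * (norm v)\<^sup>2)))" for w
  proof (rule exI[of _ "{t. g (w t) = 0 \<and> (\<exists>D. D \<noteq> 0 \<and> ((\<lambda>s. g (w s)) has_real_derivative D) (at t))}"],
      intro conjI allI impI)
    let ?E = "{t. g (w t) = 0 \<and> (\<exists>D. D \<noteq> 0 \<and> ((\<lambda>s. g (w s)) has_real_derivative D) (at t))}"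
    show "countable ?E" by (rule countable_simple_zeros)
    fix t v assume "t \<notin> ?E \<and> w t \<in> ball p R \<and> (w has_vector_derivative v) (at t)"
    then have E: "t \<notin> ?E" and wt: "w t \<in> ball p R" and w: "(w has_vector_derivative v) (at t)" by auto
    define y where "y = w t"
    have y: "y \<in> ball p R" "y \<in> ball p R1" "y \<in> V0" using wt sub' xV0 by (auto simp: y_def)
    define D where "D = inner (G y) v"
    have chain: "((\<lambda>s. f (w s)) has_vector_derivative f' v) (at t)"
      if "(f has_derivative f') (at y)" for f :: "real^'n \<Rightarrow> 'z::real_normed_vector" and f'
      using vector_derivative_diff_chain_within[OF w, of f f'] that
      by (simp add: y_def comp_def has_derivative_at_withinI)
    have dg: "((\<lambda>s. g (w s)) has_real_derivative D) (at t)"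
      using chain[OF g'[OF y(3)]] by (simp add: D_def G has_real_derivative_iff_has_vector_derivative)
    \<comment> \<open>Outside the exceptional set a zero of g along \<open>w\<close> has slope 0, as
      the lemma on the negative part requires.\<close>
    have dm: "((\<lambda>s. m (w s)) has_real_derivative (if g y < 0 then - D else 0)) (at t)"
      unfolding m_def y_def
      by (rule has_real_derivative_neg_part[OF dg]) (use E dg in blast)
    define D' where "D' = (if g y < 0 then - D else 0)"
    define u where "u = v + (s y *\<^sub>R blinfun_apply (\<nu>' y) v + (D' * (1 + 2 * k * m y)) *\<^sub>R \<nu> y)"
    have "((\<lambda>s. m (w s) * (1 + k * m (w s))) has_real_derivative D' * (1 + 2 * k * m y)) (at t)"
      by (rule derivative_eq_intros dm[folded D'_def] refl | simp add: y_def algebra_simps)+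
    then have ds: "((\<lambda>t. s (w t)) has_vector_derivative D' * (1 + 2 * k * m y)) (at t)"
      by (simp add: s_def has_real_derivative_iff_has_vector_derivative)
    have "((\<lambda>t. s (w t) *\<^sub>R \<nu> (w t)) has_vector_derivative
        (s y *\<^sub>R blinfun_apply (\<nu>' y) v + (D' * (1 + 2 * k * m y)) *\<^sub>R \<nu> y)) (at t)"
      using bounded_bilinear.has_vector_derivative[OF bounded_bilinear_scaleR ds chain[OF d\<nu>[OF y(2)]]]
      by (simp add: y_def)
    from has_vector_derivative_add[OF w this]
    have du: "((\<lambda>s. \<Phi> (w s)) has_vector_derivative u) (at t)"
      by (simp add: \<Phi>s u_def)
    show "\<exists>u. ((\<lambda>s. \<Phi> (w s)) has_vector_derivative u) (at t) \<and>
            (\<forall>s\<in>ball p R \<inter> S. inner (A (\<Phi> (w t)) *v u) u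
               \<le> inner (A (w t) *v v) v + C * norm (w t - s) * (norm v)\<^sup>2)"
    proof (intro exI[of _ u] conjI du ballI)
      fix z assume z: "z \<in> ball p R \<inter> S"
      show "inner (A (\<Phi> (w t)) *v u) u \<le> inner (A (w t) *v v) v + C * norm (w t - z) * (norm v)\<^sup>2"
      proof (cases "g y < 0")
        case False
        then have "m y = 0" "s y = 0" "D' = 0" by (auto simp: m_def s_def D'_def)
        then have "u = v" "\<Phi> (w t) = w t" by (auto simp: u_def \<Phi>_def y_def)
        then show ?thesis using CL L1 by simp
      next
        case True
        \<comment> \<open>\<open>a\<close> is the projected velocity, the value of \<open>u\<close>
          in the limit of depth 0. All other terms of \<open>u\<close> carry a factor
          \<open>m y\<close> and are collected in \<open>b\<close>.\<close>
        define a where "a = v - D *\<^sub>R \<nu> y"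
        define b where "b = (1 + k * m y) *\<^sub>R blinfun_apply (\<nu>' y) v - (2 * k * D) *\<^sub>R \<nu> y"
        have uab: "u = a + m y *\<^sub>R b"
          using True by (simp add: u_def a_def b_def D'_def s_def algebra_simps)
        have nD: "\<bar>D\<bar> \<le> B * norm v"
          using Cauchy_Schwarz_ineq2[of "G y" v] mult_right_mono[OF nG[OF y(2)], of "norm v"] by (simp add: D_def)
        have nDn: "\<bar>D\<bar> * norm (\<nu> y) \<le> B * norm v * B"
          using nD n\<nu>[OF y(2)] B1 by (intro mult_mono) auto
        have na: "norm a \<le> c2 * norm v"
          using norm_triangle_ineq4[of v "D *\<^sub>R \<nu> y"] nDn by (simp add: a_def c2_def algebra_simps)
        have n1: "norm (blinfun_apply (\<nu>' y) v) \<le> B * norm v"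
          using norm_blinfun[of "\<nu>' y" v] mult_right_mono[OF n\<nu>'[OF y(2)], of "norm v"] by simp
        have n2: "(1 + k * m y) * norm (blinfun_apply (\<nu>' y) v) \<le> 2 * (B * norm v)"
          using n1 km[OF y(1)] by (intro mult_mono) auto
        have "norm b \<le> norm ((1 + k * m y) *\<^sub>R blinfun_apply (\<nu>' y) v) + norm ((2 * k * D) *\<^sub>R \<nu> y)"
          unfolding b_def by (rule norm_triangle_ineq4)
        also have "\<dots> = (1 + k * m y) * norm (blinfun_apply (\<nu>' y) v) + 2 * k * (\<bar>D\<bar> * norm (\<nu> y))"
          using k m0[of y] by (simp add: abs_mult)
        also have "\<dots> \<le> 2 * (B * norm v) + 2 * k * (B * norm v * B)"
          using n2 nDn k by (intro add_mono mult_left_mono) auto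
        finally have nb: "norm b \<le> c3 * norm v" by (simp add: c3_def algebra_simps)
        have "norm (\<Phi> y - y) = s y * norm (\<nu> y)" using s(1)[OF y(1)] by (simp add: \<Phi>_def s_def)
        also have "\<dots> \<le> (2 * m y) * B" using s[OF y(1)] n\<nu>[OF y(2)] by (intro mult_mono) auto
        finally have n\<Phi>: "norm (\<Phi> y - y) \<le> 2 * m y * B" .
        have "\<Phi> y \<in> ball p R1"
        proof -
          have "norm (\<Phi> y - p) \<le> norm (y - p) + norm (\<Phi> y - y)"
            using norm_triangle_ineq[of "y - p" "\<Phi> y - y"] by simp
          also have "\<dots> < R + 2 * (B * R) * B"
          proof (rule add_less_le_mono)
            show "norm (y - p) < R" using y(1) by (simp add: dist_norm norm_minus_commute)
            have "2 * m y * B \<le> 2 * (B * R) * B"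
              using mB[OF y(1)] B1 by (intro mult_right_mono) auto
            with n\<Phi> show "norm (\<Phi> y - y) \<le> 2 * (B * R) * B" by linarith
          qed
          also have "\<dots> = (1 + 2 * B\<^sup>2) * R" by (simp add: power2_eq_square algebra_simps)
          also have "\<dots> \<le> R1" by (rule R(2))
          finally show ?thesis by (simp add: dist_norm norm_minus_commute)
        qed
        then have "norm (A (\<Phi> y) - A y) \<le> B * norm (\<Phi> y - y)"
          using lipschitz_onD[OF lip(1) _ y(2)] by (simp add: dist_norm)
        also have "\<dots> \<le> B * (2 * m y * B)" using n\<Phi> B1 by (intro mult_left_mono) auto
        finally have nA': "norm (A (\<Phi> y) - A y) \<le> c1 * m y" by (simp add: c1_def mult_ac)
        have "inner (A (\<Phi> y) *v u) u \<le> inner (A y *v a) a + m y * C' * (norm v)\<^sup>2"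
          unfolding uab C'_def
          by (rule quadratic_form_perturb[OF K nA[OF y(2)] nA' na nb m0 m1[OF y(1)] norm_ge_zero c])
        also have "inner (A y *v a) a \<le> inner (A y *v v) v"
        proof -
          obtain \<kappa> where "\<kappa> \<ge> 0" "A y *v \<nu> y = \<kappa> *\<^sub>R G y" using bspec[OF A\<nu> y(3)] by blast
          then show ?thesis unfolding a_def D_def
            using bspec[OF G\<nu> y(3)] by (intro conormal_projection_le pd)
        qed
        also have "m y * C' * (norm v)\<^sup>2 \<le> C * norm (w t - z) * (norm v)\<^sup>2"
        proof (rule mult_right_mono)
          have "0 \<le> g z" using gS z by blast
          then have "m z = 0" by (simp add: m_def)
          then have "m y \<le> B * norm (y - z)" using mlip[OF y(2) sub'[of z]] z m0[of y] by simp
          then have "m y * C' \<le> B * norm (y - z) * C'" using C'0 by (intro mult_right_mono)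
          also have "\<dots> = (C' * B) * norm (y - z)" by simp
          also have "\<dots> \<le> C * norm (y - z)" using CL by (intro mult_right_mono) auto
          finally show "m y * C' \<le> C * norm (w t - z)" by (simp add: y_def)
        qed simp
        finally show ?thesis by (simp add: y_def)
      qed
    qed
  qed
  show ?thesis
  proof (rule that[of R C \<Phi>])
    show "0 < R" by (rule R(1))
    show "0 < C" using CL L1 by linarith
    show "local_retraction S A (ball p R) C \<Phi>"
      unfolding local_retraction_def
      using inS fixS gS speed lipschitz_on_mono[OF \<Phi>lip order_refl CL(1)] by blast
  qed
qed

lemma countable_imp_negligible:
  fixes E :: "'a::euclidean_space set"
  assumes "countable E"
  shows "negligible E"
  using null_sets_completionI[OF countable_imp_null_set_lborel[OF assms]]
  by (simp add: negligible_iff_null_sets)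

text \<open>Off the obstacle the identity serves. At a boundary point it remains to identify closure
  (- Obs) locally with {g \<ge> 0}, where the zeros of g are the delicate points.\<close>

lemma local_retraction_exists:
  fixes A :: "real ^ 'n \<Rightarrow> real ^ 'n ^ 'n"
  assumes U: "open U" "C2_boundary U" and Obs: "Obs = closure U"
    and A: "C1_on A UNIV" and pd: "\<And>x. sym_pos_def (A x)" and p: "p \<in> closure (- Obs)"
  obtains R C \<Phi> where "0 < R" "0 < C" "local_retraction (closure (- Obs)) A (ball p R) C \<Phi>"
proof (cases "p \<in> - Obs")
  case True
  have "open (- Obs)" using Obs by auto
  then obtain R where "R > 0" "ball p R \<subseteq> - Obs" using True openE by blast
  then show ?thesis
    using local_retraction_id[of "ball p R" "closure (- Obs)" A] closure_subset[of "- Obs"]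
    by (intro that[of R 1 "\<lambda>y. y"]) auto
next
  case False
  have "U \<inter> - Obs = {}" using closure_subset[of U] Obs by auto
  then have notU: "x \<notin> U" if "x \<in> closure (- Obs)" for x
    using open_Int_closure_eq_empty[OF U(1), of "- Obs"] that by auto
  have fr: "frontier U = closure U - U" using U(1) by (simp add: frontier_def interior_open)
  have "p \<in> frontier U" using False Obs notU[OF p] fr by auto
  then obtain V and g :: "real ^ 'n \<Rightarrow> real" where V: "open V" "p \<in> V" and g: "C2_on g V"
    and nz: "\<forall>x\<in>V. \<not> (g has_derivative (\<lambda>_. 0)) (at x)"
    and neg: "U \<inter> V = {x \<in> V. g x < 0}" and zero: "frontier U \<inter> V = {x \<in> V. g x = 0}"
    using U(2)[unfolded C2_boundary_def] by - (drule (1) bspec, elim exE conjE, rule that)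
  have negI: "x \<in> U \<longleftrightarrow> g x < 0" if "x \<in> V" for x using neg that by blast
  have zeroI: "x \<in> frontier U \<longleftrightarrow> g x = 0" if "x \<in> V" for x using zero that by blast
  have pos: "x \<in> - Obs" if "x \<in> V" "0 < g x" for x
  proof -
    have "x \<notin> U" "x \<notin> frontier U" using that negI[of x] zeroI[of x] by simp_all
    then show ?thesis using fr Obs by auto
  qed
  have S: "x \<in> closure (- Obs) \<longleftrightarrow> 0 \<le> g x" if x: "x \<in> V" for x
  proof
    assume "x \<in> closure (- Obs)"
    then have "x \<notin> U" by (rule notU)
    then show "0 \<le> g x" using negI[OF x] by simp
  next
    assume gx: "0 \<le> g x"
    show "x \<in> closure (- Obs)"
    proof (rule ccontr)
      assume n: "x \<notin> closure (- Obs)"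
      then have "x \<notin> - Obs" using closure_subset[of "- Obs"] by auto
      then have g0: "g x = 0" using pos[OF x] gx by (cases "g x = 0") auto
      have op: "open (V \<inter> - closure (- Obs))" using V(1) by auto
      obtain g' where "\<forall>x\<in>V. (g has_derivative blinfun_apply (g' x)) (at x)"
        using g unfolding C2_on_def by blast
      then have d: "(g has_derivative blinfun_apply (g' x)) (at x)" using x by blast
      have le: "g y \<le> g x" if "y \<in> V \<inter> - closure (- Obs)" for y
        using pos[of y] g0 subsetD[OF closure_subset[of "- Obs"], of y] that by (cases "0 < g y") auto
      \<comment> \<open>Near a zero \<open>x\<close> of \<open>g\<close> outside closure (- Obs)
        there are no points with \<open>g > 0\<close>; so \<open>x\<close> is a local maximum and
        hence critical.\<close>
      have "blinfun_apply (g' x) = (\<lambda>v. 0)"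
      proof (rule differential_zero_maxmin)
        show "x \<in> V \<inter> - closure (- Obs)" using x n by simp
      qed (use op d le in auto)
      with d have "(g has_derivative (\<lambda>v. 0)) (at x)" by simp
      with nz x show False by blast
    qed
  qed
  have "g p = 0" using \<open>p \<in> frontier U\<close> zero V(2) by blast
  show ?thesis
  proof (rule local_retraction_boundary[OF V g \<open>g p = 0\<close>])
    show "\<not> (g has_derivative (\<lambda>_. 0)) (at x)" if "x \<in> V" for x using nz that by blast
  qed (fact S A pd that)+
qed

section \<open>Short-time confinement, finiteness and local Lipschitz continuity\<close>

text \<open>First exit argument: coercivity is known only in the ball, but before the first exit
  time \<tau> it bounds the speed by \<open>M\<close>, so the curve has moved at most M \<tau> \<le>
  M t < R and cannot be at distance \<open>R\<close>.\<close>

lemma unit_speed_curve_stays: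
  fixes A :: "real ^ 'n \<Rightarrow> real ^ 'n ^ 'n"
  assumes u: "unit_speed_curve S A T \<gamma>" and M: "0 < M" and R: "0 < R" and t: "0 \<le> t" "t \<le> T" "M * t < R"
    and coer: "\<And>x v. x \<in> ball (\<gamma> 0) R \<Longrightarrow> (norm v)\<^sup>2 \<le> M\<^sup>2 * inner (A x *v v) v"
  shows "M-lipschitz_on {0..t} \<gamma>" "\<And>s. s \<in> {0..t} \<Longrightarrow> \<gamma> s \<in> ball (\<gamma> 0) R"
proof -
  obtain L where L: "L-lipschitz_on {0..T} \<gamma>" using u unfolding unit_speed_curve_def by blast
  have cont: "continuous_on {0..t} \<gamma>"
    using lipschitz_on_continuous_on[OF L] continuous_on_subset t by fastforce
  define X where "X = {s \<in> {0..t}. R \<le> dist (\<gamma> 0) (\<gamma> s)}"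
  have "X = {}"
  proof (rule ccontr)
    assume ne: "X \<noteq> {}"
    have "closed X"
      unfolding X_def by (intro continuous_on_closed_Collect_le continuous_intros cont)
    moreover have "bounded X" by (rule bounded_subset[of "{0..t}"]) (auto simp: X_def)
    ultimately have "compact X" by (simp add: compact_eq_bounded_closed)
    from compact_attains_inf[OF this ne] obtain \<tau> where \<tau>: "\<tau> \<in> X" "\<forall>s\<in>X. \<tau> \<le> s" by blast
    have \<tau>t: "0 \<le> \<tau>" "\<tau> \<le> t" "R \<le> dist (\<gamma> 0) (\<gamma> \<tau>)" using \<tau>(1) by (auto simp: X_def)
    have "M-lipschitz_on {0..\<tau>} \<gamma>"
    proof (rule unit_speed_curve_lipschitz[OF u])
      fix s v assume s: "0 < s" "s < \<tau>"
      then have "s \<notin> X" using \<tau>(2) by force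
      then have "\<gamma> s \<in> ball (\<gamma> 0) R" using s \<tau>t by (auto simp: X_def)
      then show "(norm v)\<^sup>2 \<le> M\<^sup>2 * inner (A (\<gamma> s) *v v) v" by (rule coer)
    qed (use M \<tau>t t in auto)
    then have "dist (\<gamma> 0) (\<gamma> \<tau>) \<le> M * dist 0 \<tau>" using \<tau>t by (intro lipschitz_onD) auto
    also have "\<dots> \<le> M * t" using \<tau>t M by (simp add: dist_real_def)
    finally show False using \<tau>t t by simp
  qed
  then show st: "\<gamma> s \<in> ball (\<gamma> 0) R" if "s \<in> {0..t}" for s using that by (force simp: X_def)
  show "M-lipschitz_on {0..t} \<gamma>"
    using M t coer st by (intro unit_speed_curve_lipschitz[OF u]) auto
qed

lemma joined_refl: "x \<in> S \<Longrightarrow> joined S A x x 0"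
  unfolding joined_def unit_speed_curve_def
  by (intro conjI exI[of _ "\<lambda>_. x"] exI[of _ 0] exI[of _ "{}"]) (auto intro: lipschitz_on_constant)

text \<open>The smoothness of the boundary acts through \<open>retraction\<close>; its defining
  functions do not appear in what follows.\<close>

locale regular_obstacle_problem = obstacle_problem Obs A k\<^sub>0
  for Obs :: "(real ^ 'n) set" and A :: "real ^ 'n \<Rightarrow> real ^ 'n ^ 'n" and k\<^sub>0 :: "real ^ 'n" +
  assumes C1_A: "C1_on A UNIV" and k\<^sub>0: "k\<^sub>0 \<in> closure (- Obs)" and conn: "connected (- Obs)"
    and retraction: "\<And>p. p \<in> closure (- Obs) \<Longrightarrow>
      \<exists>R>0. \<exists>C>0. \<exists>\<Phi>. local_retraction (closure (- Obs)) A (ball p R) C \<Phi>"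
begin

text \<open>The retraction pushes the straight segment from x to y into \<open>S\<close> and keeps
  its speed comparable with norm (x - y); a linear clock then suffices.\<close>

lemma local_joined:
  assumes "p \<in> S"
  obtains R C where "0 < R" "0 < C"
    "\<forall>x\<in>ball p R \<inter> S. \<forall>y\<in>ball p R \<inter> S. joined S A x y (C * norm (x - y))"
proof -
  obtain R0 C0 \<Phi> where R0: "0 < R0" "0 < C0" and ret: "local_retraction S A (ball p R0) C0 \<Phi>"
    using retraction[OF assms] by blast
  obtain R1 B where R1: "0 < R1" and B: "0 < B" "\<And>x. x \<in> ball p R1 \<Longrightarrow> norm (A x) \<le> B"
    using C1_on_local_bound[OF C1_A open_UNIV UNIV_I, of p] by metis
  obtain K where K: "0 < K" "\<forall>(M :: real ^ 'n ^ 'n) u v. \<bar>inner (M *v u) v\<bar> \<le> K * norm M * norm u * norm v"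
    by (rule quadratic_form_bound)
  define R where "R = min R0 R1"
  have R: "0 < R" "R \<le> R0" "R \<le> R1" using R0 R1 by (auto simp: R_def)
  \<comment> \<open>Under the root, \<open>K * B\<close> bounds the form \<open>A\<close> and
    \<open>C0 * (2 * R)\<close> the excess due to the retraction, two points of the ball being at
    most 2 R apart.\<close>
  define c where "c = sqrt (K * B + C0 * (2 * R))"
  have c: "0 < c" "c\<^sup>2 = K * B + C0 * (2 * R)"
    using K B R0 R by (auto simp: c_def intro!: add_pos_pos add_nonneg_nonneg)
  have "joined S A x y (c * norm (x - y))" if xy: "x \<in> ball p R \<inter> S" "y \<in> ball p R \<inter> S" for x y
  proof (cases "x = y")
    case True
    then show ?thesis using xy by (auto intro: joined_refl)
  next
    case False
    define w where "w t = x + t *\<^sub>R (y - x)" for t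
    have wR: "w t \<in> ball p R" if "t \<in> {0..1}" for t
    proof -
      have "w t = (1 - t) *\<^sub>R x + t *\<^sub>R y" by (simp add: w_def algebra_simps)
      then show ?thesis using convexD[OF convex_ball, of x p R y "1 - t" t] xy that by auto
    qed
    have wd: "(w has_vector_derivative (y - x)) (at t)" for t
      unfolding w_def by (auto intro!: derivative_eq_intros)
    note \<Phi>S = local_retractionD(1)[OF ret] and \<Phi>id = local_retractionD(2)[OF ret]
      and \<Phi>lip = local_retractionD(3)[OF ret]
    obtain E where E: "countable E" and E2: "\<forall>t v. t \<notin> E \<and> w t \<in> ball p R0 \<and> (w has_vector_derivative v) (at t) \<longrightarrow>
          (\<exists>u. ((\<lambda>s. \<Phi> (w s)) has_vector_derivative u) (at t) \<and>
            (\<forall>s\<in>ball p R0 \<inter> S. inner (A (\<Phi> (w t)) *v u) u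
               \<le> inner (A (w t) *v v) v + C0 * norm (w t - s) * (norm v)\<^sup>2))"
      by (rule local_retraction_speedE[OF ret])
    let ?l = "norm (x - y)"
    have "joined S A (\<Phi> (w 0)) (\<Phi> (w 1)) (c * ?l * 1)"
    proof (rule joined_reparametrize[where \<sigma> = "\<lambda>t. c * ?l * t" and \<eta> = "\<lambda>t. \<Phi> (w t)" and r = 1])
      have lw: "?l-lipschitz_on {0..1} w"
      proof (rule lipschitz_onI)
        fix a b :: real
        have "w a - w b = (a - b) *\<^sub>R (y - x)" by (simp add: w_def algebra_simps)
        then show "dist (w a) (w b) \<le> ?l * dist a b"
          by (simp add: dist_norm norm_minus_commute mult.commute)
      qed simp
      have "w ` {0..1} \<subseteq> ball p R0" using wR R(2) by fastforce
      from lipschitz_on_compose2[OF lw lipschitz_on_subset[OF \<Phi>lip this]]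
      show "(C0 * ?l)-lipschitz_on {0..1} (\<lambda>t. \<Phi> (w t))" .
      show "\<Phi> (w t) \<in> S" if "t \<in> {0..1}" for t using wR[OF that] R by (intro \<Phi>S) auto
      show "(c * ?l)-lipschitz_on {0..1} (\<lambda>t. c * ?l * t)"
        using c by (intro lipschitz_onI) (auto simp: dist_real_def abs_mult right_diff_distrib[symmetric])
      show "0 < c * ?l" using c False by simp
      show "c * ?l * (t - s) \<le> c * ?l * t - c * ?l * s" for s t by (simp add: algebra_simps)
      show "negligible E" by (rule countable_imp_negligible[OF E])
      fix t :: real assume t: "t \<in> {0<..<1} - E"
      then have wt: "w t \<in> ball p R" by (intro wR) auto
      have "t \<notin> E \<and> w t \<in> ball p R0 \<and> (w has_vector_derivative (y - x)) (at t)" using t wt wd R by auto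
      with E2 obtain u where u: "((\<lambda>s. \<Phi> (w s)) has_vector_derivative u) (at t)"
        and "\<forall>s\<in>ball p R0 \<inter> S. inner (A (\<Phi> (w t)) *v u) u
               \<le> inner (A (w t) *v (y - x)) (y - x) + C0 * norm (w t - s) * (norm (y - x))\<^sup>2"
        by blast
      then have "inner (A (\<Phi> (w t)) *v u) u
               \<le> inner (A (w t) *v (y - x)) (y - x) + C0 * norm (w t - x) * (norm (y - x))\<^sup>2"
        using xy R by auto
      also have "inner (A (w t) *v (y - x)) (y - x) \<le> K * norm (A (w t)) * norm (y - x) * norm (y - x)"
        using K(2) abs_le_D1 by blast
      also have "\<dots> \<le> K * B * norm (y - x) * norm (y - x)"
        using K B wt R by (intro mult_right_mono mult_left_mono) auto
      also have "C0 * norm (w t - x) * (norm (y - x))\<^sup>2 \<le> C0 * (2 * R) * (norm (y - x))\<^sup>2"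
      proof -
        have "norm (w t - x) \<le> norm (w t - p) + norm (x - p)" using norm_triangle_ineq4[of "w t - p" "x - p"] by simp
        also have "\<dots> \<le> 2 * R" using wt xy by (auto simp: dist_norm norm_minus_commute)
        finally show ?thesis using R0 by (intro mult_right_mono mult_left_mono) auto
      qed
      finally have "inner (A (\<Phi> (w t)) *v u) u \<le> (c * ?l)\<^sup>2"
        unfolding power_mult_distrib c(2) norm_minus_commute[of x y]
        by (simp add: power2_eq_square algebra_simps)
      moreover have "((\<lambda>t. c * ?l * t) has_real_derivative c * ?l) (at t)"
        by (auto intro!: derivative_eq_intros)
      ultimately show "\<exists>v q. ((\<lambda>t. \<Phi> (w t)) has_vector_derivative v) (at t) \<and>
        ((\<lambda>t. c * ?l * t) has_real_derivative q) (at t) \<and> 0 < q \<and> inner (A (\<Phi> (w t)) *v v) v \<le> q\<^sup>2"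
        using u c False by (intro exI[of _ u] exI[of _ "c * ?l"]) auto
    qed auto
    moreover have "\<Phi> (w 0) = x" "\<Phi> (w 1) = y" using xy R by (auto simp: w_def intro!: \<Phi>id)
    ultimately show ?thesis by simp
  qed
  then show ?thesis by (intro that[OF R(1) c(1)]) blast
qed

text \<open>Every point of \<open>S\<close> has a relatively open neighbourhood whose points are
  mutually joined, and a transitive relation of this kind relates all points of a connected set. So
  the distance is finite on \<open>S\<close>.\<close>

lemma joined_to_target:
  assumes "x \<in> S"
  obtains T where "joined S A x k\<^sub>0 T"
proof -
  have "connected S" using conn by (rule connected_imp_connected_closure)
  have "\<exists>T. joined S A x k\<^sub>0 T"
  proof (rule connected_equivalence_relation_gen[OF \<open>connected S\<close> assms k\<^sub>0, where P = "\<lambda>_. True"])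
    show "\<exists>T. joined S A a c T" if "\<exists>T. joined S A a b T" "\<exists>T. joined S A b c T" for a b c
      using that joined_trans by blast
    fix a assume "a \<in> S"
    then obtain R C where "0 < R" "\<forall>x\<in>ball a R \<inter> S. \<forall>y\<in>ball a R \<inter> S. joined S A x y (C * norm (x - y))"
      by (rule local_joined)
    with \<open>a \<in> S\<close> show "\<exists>T. openin (top_of_set S) T \<and> a \<in> T \<and>
        (\<forall>x\<in>T. \<forall>y\<in>T. True \<and> True \<longrightarrow> (\<exists>T. joined S A x y T))"
      by (intro exI[of _ "S \<inter> ball a R"]) (auto intro: openin_open_Int)
  qed auto
  then show ?thesis using that by blast
qed

lemma obstacle_dist_local_lipschitz:
  assumes "p \<in> S"
  obtains R C where "0 < R" "0 < C" "C-lipschitz_on (ball p R \<inter> S) d"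
proof -
  obtain R C where RC: "0 < R" "0 < C" "\<forall>x\<in>ball p R \<inter> S. \<forall>y\<in>ball p R \<inter> S. joined S A x y (C * norm (x - y))"
    by (rule local_joined[OF assms])
  have le: "d x \<le> C * norm (x - y) + d y" if x: "x \<in> ball p R \<inter> S" and y: "y \<in> ball p R \<inter> S" for x y
  proof -
    obtain T where "joined S A y k\<^sub>0 T" by (rule joined_to_target[of y]) (use y in auto)
    with RC(3) x y show ?thesis by (intro obstacle_dist_joined) auto
  qed
  have "C-lipschitz_on (ball p R \<inter> S) d"
  proof (rule lipschitz_onI)
    fix x y assume "x \<in> ball p R \<inter> S" "y \<in> ball p R \<inter> S"
    then show "dist (d x) (d y) \<le> C * dist x y"
      using le[of x y] le[of y x] by (auto simp: dist_real_def dist_norm norm_minus_commute abs_le_iff)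
  qed (use RC in simp)
  with RC that show ?thesis by blast
qed

end

section \<open>The one-sided estimate and local semiconcavity\<close>

lemma powr_three_halves: "0 < D \<Longrightarrow> D powr (1 + 1 / 2) = sqrt D * D" for D :: real
  unfolding powr_add powr_half_sqrt by (simp add: powr_half_sqrt)

context regular_obstacle_problem
begin

text \<open>The vector \<open>q\<close> depends on the near-optimal curve \<open>\<gamma>\<close> from \<open>z\<close>, but not on \<open>x\<close>: this is what makes
  the first order terms cancel in a convex combination.\<close>

lemma obstacle_dist_upper:
  assumes pS: "p \<in> S" and pk: "p \<noteq> k\<^sub>0"
  obtains \<delta> C where "0 < \<delta>" "0 < C"
    "\<forall>z\<in>ball p \<delta> \<inter> S. \<forall>r \<epsilon>. 0 < r \<and> r < \<delta> \<and> 0 < \<epsilon> \<longrightarrow> (\<exists>q. \<forall>x\<in>ball p \<delta> \<inter> S. norm (x - z) \<le> \<delta> * r \<longrightarrow>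
       d x \<le> d z + inner q (x - z) + C * (r * norm (x - z) + (norm (x - z))\<^sup>2 / r) + \<epsilon>)"
proof -
  obtain R0 C0 \<Phi> where R0: "0 < R0" "0 < C0" and ret: "local_retraction S A (ball p R0) C0 \<Phi>"
    using retraction[OF pS] by blast
  note \<Phi>S = local_retractionD(1)[OF ret] and \<Phi>id = local_retractionD(2)[OF ret]
    and \<Phi>lip = local_retractionD(3)[OF ret]
  obtain R1 B where R1: "0 < R1" and B: "0 < B" and AB: "\<And>x. x \<in> ball p R1 \<Longrightarrow> norm (A x) \<le> B"
    and Alip: "B-lipschitz_on (ball p R1) A"
    using C1_on_local_bound[OF C1_A open_UNIV UNIV_I, of p] by metis
  obtain K where K: "0 < K" "\<forall>(M :: real ^ 'n ^ 'n) u v. \<bar>inner (M *v u) v\<bar> \<le> K * norm M * norm u * norm v"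
    by (rule quadratic_form_bound)
  have Kb: "\<bar>inner (M *v u) v\<bar> \<le> K * a * b * c" if "norm M \<le> a" "norm u \<le> b" "norm v \<le> c"
    for M :: "real^'n^'n" and u v a b c
  proof -
    have nn: "0 \<le> a" "0 \<le> b" "0 \<le> c"
      using that norm_ge_zero[of M] norm_ge_zero[of u] norm_ge_zero[of v] by linarith+
    have "\<bar>inner (M *v u) v\<bar> \<le> K * norm M * norm u * norm v" using K(2) by blast
    also have "\<dots> \<le> K * a * b * c"
      using that K(1) nn by (intro mult_mono mult_nonneg_nonneg order_refl) auto
    finally show ?thesis .
  qed
  obtain M where M: "0 < M" and coer: "\<forall>x\<in>cball p 1. \<forall>v. (norm v)\<^sup>2 \<le> M\<^sup>2 * inner (A x *v v) v"
    by (rule locally_coercive[OF compact_cball continuous_on_subset[OF cont_A subset_UNIV] pos_def_A])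
  \<comment> \<open>All curves stay within 3 R of \<open>p\<close>: \<open>z\<close> is within R / 2
    of \<open>p\<close>, \<gamma> within \<open>R\<close> of \<open>z\<close>, and the translated
    curve within \<open>R\<close> of \<gamma>. The distance to \<open>k\<^sub>0\<close> keeps
    \<gamma> from arriving before time \<open>r\<close>.\<close>
  define R where "R = min (min R0 R1) (min 1 (dist p k\<^sub>0)) / 3"
  have R: "0 < R" "3 * R \<le> R0" "3 * R \<le> R1" "3 * R \<le> 1" "3 * R \<le> dist p k\<^sub>0"
    using R0 R1 pk by (auto simp: R_def)
  \<comment> \<open>The bound R / (2 M) confines \<gamma> up to time \<open>r\<close>. The last
    bound makes the first order term <A(z) \<gamma>', h> at most 1/2 in absolute value, which keeps
    the new clock strictly increasing.\<close>
  define \<delta> where "\<delta> = min (min (R / 2) (R / (2 * M))) (min 1 (1 / (2 * K * B * M)))"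
  have \<delta>: "0 < \<delta>" "\<delta> \<le> R / 2" "\<delta> \<le> R / (2 * M)" "\<delta> \<le> 1" "\<delta> \<le> 1 / (2 * K * B * M)"
    using R(1) M K B by (auto simp: \<delta>_def)
  have \<delta>': "M * \<delta> < R" "K * B * M * \<delta> \<le> 1 / 2"
  proof -
    have "M * \<delta> \<le> R / 2" using \<delta>(3) M by (simp add: field_simps)
    then show "M * \<delta> < R" using R(1) by linarith
    show "K * B * M * \<delta> \<le> 1 / 2" using \<delta>(5) M K B by (simp add: field_simps)
  qed
  \<comment> \<open>In this order: retraction and replacement of A (w t) by A (\<gamma> t), freezing
    of \<open>A\<close> at \<open>z\<close>, and the term quadratic in \<open>h\<close>.\<close>
  define C where "C = (C0 + K * B) * (M + 1)\<^sup>2 + 2 * K * B * M * M + K * B"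
  have C: "0 < C" unfolding C_def using R0 K B M
    by (intro add_pos_pos mult_pos_pos zero_less_power) auto
  have main: "\<exists>q. \<forall>x\<in>ball p \<delta> \<inter> S. norm (x - z) \<le> \<delta> * r \<longrightarrow>
       d x \<le> d z + inner q (x - z) + C * (r * norm (x - z) + (norm (x - z))\<^sup>2 / r) + \<epsilon>"
    if z: "z \<in> ball p \<delta> \<inter> S" and r: "0 < r" "r < \<delta>" and \<epsilon>: "0 < \<epsilon>" for z r \<epsilon>
  proof -
    have zp: "norm (z - p) < R / 2" using z \<delta> by (auto simp: dist_norm norm_minus_commute)
    obtain T0 where T0: "joined S A z k\<^sub>0 T0" by (rule joined_to_target[of z]) (use z in auto)
    obtain T where "joined S A z k\<^sub>0 T" and Tle: "T \<le> d z + \<epsilon>"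
      by (rule obstacle_dist_approx[OF T0 \<epsilon>])
    then obtain \<gamma> where T: "0 \<le> T" and u: "unit_speed_curve S A T \<gamma>" and \<gamma>0: "\<gamma> 0 = z" and \<gamma>T: "\<gamma> T = k\<^sub>0"
      unfolding joined_def by blast
    have coer': "(norm v)\<^sup>2 \<le> M\<^sup>2 * inner (A x *v v) v" if "x \<in> ball (\<gamma> 0) R" for x v
    proof -
      have "norm (x - p) \<le> norm (x - z) + norm (z - p)" using norm_triangle_ineq[of "x - z" "z - p"] by simp
      also have "\<dots> \<le> 1" using that zp R \<gamma>0 by (auto simp: dist_norm norm_minus_commute)
      finally show ?thesis using coer by (simp add: dist_norm norm_minus_commute)
    qed
    \<comment> \<open>Otherwise \<gamma> would reach \<open>k\<^sub>0\<close> after moving less than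
      \<open>R\<close>, although \<open>k\<^sub>0\<close> is farther than that from
      \<open>z\<close>.\<close>
    have rT: "r \<le> T"
    proof (rule ccontr)
      assume "\<not> r \<le> T"
      then have "M * T \<le> M * \<delta>" using r M by (intro mult_left_mono) auto
      then have "M * T < R" using \<delta>' by linarith
      from unit_speed_curve_stays(2)[OF u M R(1) T order_refl this coer', of T] T
      have "norm (k\<^sub>0 - z) < R" using \<gamma>0 \<gamma>T by (simp add: dist_norm norm_minus_commute)
      moreover have "dist p k\<^sub>0 \<le> norm (k\<^sub>0 - z) + norm (z - p)"
        using norm_triangle_ineq[of "k\<^sub>0 - z" "z - p"] by (simp add: dist_norm norm_minus_commute)
      ultimately show False using zp R by linarith
    qed
    have "M * r \<le> M * \<delta>" using r M by (intro mult_left_mono) auto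
    then have Mr: "M * r < R" using \<delta>' by linarith
    have \<gamma>lip: "M-lipschitz_on {0..r} \<gamma>"
      using unit_speed_curve_stays(1)[OF u M R(1) _ rT Mr coer'] r by simp
    have \<gamma>near: "\<gamma> t \<in> ball z R" if "t \<in> {0..r}" for t
      using unit_speed_curve_stays(2)[OF u M R(1) _ rT Mr coer' that] r \<gamma>0 by simp
    obtain L N where \<gamma>S: "\<forall>t\<in>{0..T}. \<gamma> t \<in> S" and "L-lipschitz_on {0..T} \<gamma>" and N: "negligible N"
      and \<gamma>d: "\<forall>t\<in>{0<..<T} - N. \<exists>v. (\<gamma> has_vector_derivative v) (at t) \<and> inner (A (\<gamma> t) *v v) v \<le> 1"
      by (rule unit_speed_curveE[OF u])
    \<comment> \<open>The mean of - A(z) \<gamma>' over [0, r].\<close>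
    define q where "q = (- 1 / r) *\<^sub>R (A z *v (\<gamma> r - z))"
    show ?thesis
    proof (intro exI[of _ q] ballI impI)
      fix x assume x: "x \<in> ball p \<delta> \<inter> S" and xz: "norm (x - z) \<le> \<delta> * r"
      define \<rho> where "\<rho> = norm (x - z)"
      define h where "h = (1 / r) *\<^sub>R (x - z)"
      have nh: "norm h = \<rho> / r" using r by (simp add: h_def \<rho>_def)
      have h\<delta>: "norm h \<le> \<delta>" using xz r by (simp add: nh \<rho>_def pos_divide_le_eq)
      have \<rho>0: "0 \<le> \<rho>" by (simp add: \<rho>_def)
      have \<rho>R: "\<rho> < R"
      proof -
        have "\<rho> \<le> norm (x - p) + norm (z - p)"
          using norm_triangle_ineq4[of "x - p" "z - p"] by (simp add: \<rho>_def)
        also have "\<dots> < R / 2 + R / 2"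
          using zp x \<delta> by (intro add_strict_mono) (auto simp: dist_norm norm_minus_commute)
        finally show ?thesis by simp
      qed
      \<comment> \<open>Absorbs every error in the squared speed; over a time \<open>r\<close> it
        adds up to the error term of the claim.\<close>
      define e where "e = C * (\<rho> + (norm h)\<^sup>2)"
      have e0: "0 \<le> e" using C \<rho>0 by (simp add: e_def)
      define w where "w t = \<gamma> t + (x - z) - t *\<^sub>R h" for t
      have wg: "norm (w t - \<gamma> t) \<le> \<rho>" if "t \<in> {0..r}" for t
      proof -
        have "w t - \<gamma> t = (1 - t / r) *\<^sub>R (x - z)" by (simp add: w_def h_def algebra_simps)
        then have "norm (w t - \<gamma> t) = (1 - t / r) * \<rho>" using that r by (simp add: \<rho>_def)
        also have "\<dots> \<le> 1 * \<rho>" using that r \<rho>0 by (intro mult_right_mono) auto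
        finally show ?thesis by simp
      qed
      have \<gamma>p: "norm (\<gamma> t - p) < 2 * R" if "t \<in> {0..r}" for t
      proof -
        have "norm (\<gamma> t - p) \<le> norm (\<gamma> t - z) + norm (z - p)" using norm_triangle_ineq[of "\<gamma> t - z" "z - p"] by simp
        then show ?thesis using \<gamma>near[OF that] zp R(1) by (simp add: dist_norm norm_minus_commute)
      qed
      have wp: "w t \<in> ball p (3 * R)" if "t \<in> {0..r}" for t
      proof -
        have "norm (w t - p) \<le> norm (w t - \<gamma> t) + norm (\<gamma> t - p)" using norm_triangle_ineq[of "w t - \<gamma> t" "\<gamma> t - p"] by simp
        then have "norm (w t - p) < 3 * R" using wg[OF that] \<gamma>p[OF that] \<rho>R by linarith
        then show ?thesis by (simp add: dist_norm norm_minus_commute)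
      qed
      have inR: "y \<in> ball p R0" "y \<in> ball p R1" if "norm (y - p) < 3 * R" for y
        using that R by (auto simp: dist_norm norm_minus_commute)
      have wR: "w t \<in> ball p R0" "w t \<in> ball p R1" if "t \<in> {0..r}" for t
        using wp[OF that] R by auto
      have \<gamma>R: "\<gamma> t \<in> ball p R0" "\<gamma> t \<in> ball p R1" if "t \<in> {0..r}" for t
        using \<gamma>p[OF that] inR[of "\<gamma> t"] R(1) by auto
      have zR: "z \<in> ball p R1" using zp inR[of z] R(1) by auto
      \<comment> \<open>The clock. Its slope is 1 + e - \<beta> with \<beta> = <A(z) \<gamma>', h>,
        and the square of this dominates the bound 1 - 2 \<beta> + e for the squared speed.\<close>
      define \<sigma> where "\<sigma> t = t * (1 + e) - inner (A z *v (\<gamma> t - z)) h" for t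
      have lin: "\<bar>inner (A z *v v) h\<bar> \<le> l / 2" if "norm v \<le> M * l" "0 \<le> l" for v l
      proof -
        have "\<bar>inner (A z *v v) h\<bar> \<le> K * B * (M * l) * \<delta>" by (rule Kb[OF AB[OF zR] that(1) h\<delta>])
        also have "\<dots> = (K * B * M * \<delta>) * l" by simp
        also have "\<dots> \<le> 1 / 2 * l" using \<delta>'(2) that by (intro mult_right_mono)
        finally show ?thesis by simp
      qed
      have \<sigma>diff: "\<bar>inner (A z *v (\<gamma> t - \<gamma> s)) h\<bar> \<le> (t - s) / 2" if "0 \<le> s" "s \<le> t" "t \<le> r" for s t
        using lipschitz_onD[OF \<gamma>lip, of t s] that by (intro lin) (auto simp: dist_norm dist_real_def)
      have \<sigma>eq: "\<sigma> t - \<sigma> s = (t - s) + (t - s) * e - inner (A z *v (\<gamma> t - \<gamma> s)) h" for s t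
        by (simp add: \<sigma>_def matrix_vector_mult_diff_distrib inner_diff_left algebra_simps)
      \<comment> \<open>For increments of \<sigma>: \<open>l\<close> is the elapsed time, m = l e,
        and \<open>i\<close> the inner product.\<close>
      have aux: "\<bar>s\<bar> \<le> 2 * l + m" "1 / 2 * l \<le> s"
        if "s = l + m - i" "\<bar>i\<bar> \<le> l / 2" "0 \<le> m" "0 \<le> l" for s l m i :: real
        using that by linarith+
      obtain E where E: "countable E" and E2: "\<forall>t v. t \<notin> E \<and> w t \<in> ball p R0 \<and> (w has_vector_derivative v) (at t) \<longrightarrow>
          (\<exists>u. ((\<lambda>s. \<Phi> (w s)) has_vector_derivative u) (at t) \<and>
            (\<forall>s\<in>ball p R0 \<inter> S. inner (A (\<Phi> (w t)) *v u) u
               \<le> inner (A (w t) *v v) v + C0 * norm (w t - s) * (norm v)\<^sup>2))"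
        by (rule local_retraction_speedE[OF ret])
      have "joined S A (\<Phi> (w 0)) (\<Phi> (w r)) (\<sigma> r)"
      proof (rule joined_reparametrize[where \<eta> = "\<lambda>t. \<Phi> (w t)" and c = "1 / 2"])
        show "0 \<le> r" using r by simp
        have lw: "(M + norm h)-lipschitz_on {0..r} w"
        proof (rule lipschitz_onI)
          fix a b assume ab: "a \<in> {0..r}" "b \<in> {0..r}"
          have "w a - w b = (\<gamma> a - \<gamma> b) - (a - b) *\<^sub>R h" by (simp add: w_def algebra_simps)
          then have "norm (w a - w b) \<le> norm (\<gamma> a - \<gamma> b) + \<bar>a - b\<bar> * norm h"
            using norm_triangle_ineq4[of "\<gamma> a - \<gamma> b" "(a - b) *\<^sub>R h"] by simp
          then show "dist (w a) (w b) \<le> (M + norm h) * dist a b"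
            using lipschitz_onD[OF \<gamma>lip ab] by (simp add: dist_norm dist_real_def algebra_simps)
        qed (use M in simp)
        have "w ` {0..r} \<subseteq> ball p R0" using wR by blast
        from lipschitz_on_compose2[OF lw lipschitz_on_subset[OF \<Phi>lip this]]
        show "(C0 * (M + norm h))-lipschitz_on {0..r} (\<lambda>t. \<Phi> (w t))" .
        show "\<Phi> (w t) \<in> S" if "t \<in> {0..r}" for t using wR[OF that] by (intro \<Phi>S)
        show "(2 + e)-lipschitz_on {0..r} \<sigma>"
        proof (rule lipschitz_on_leI)
          fix a b assume ab: "a \<in> {0..r}" "b \<in> {0..r}" "a \<le> b"
          have "0 \<le> (b - a) * e" using ab e0 by simp
          moreover have "\<bar>inner (A z *v (\<gamma> b - \<gamma> a)) h\<bar> \<le> (b - a) / 2"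
            using ab by (intro \<sigma>diff) auto
          ultimately have "\<bar>\<sigma> b - \<sigma> a\<bar> \<le> 2 * (b - a) + (b - a) * e"
            using ab(3) by (intro aux(1)[OF \<sigma>eq]) auto
          also have "\<dots> = (2 + e) * (b - a)" by (simp add: algebra_simps)
          finally have "\<bar>\<sigma> b - \<sigma> a\<bar> \<le> (2 + e) * (b - a)" .
          then show "dist (\<sigma> a) (\<sigma> b) \<le> (2 + e) * dist a b"
            using ab by (simp add: dist_real_def abs_minus_commute)
        qed (use e0 in simp)
        show "\<sigma> 0 = 0" by (simp add: \<sigma>_def \<gamma>0)
        show "1 / 2 * (t - s) \<le> \<sigma> t - \<sigma> s" if "0 \<le> s" "s \<le> t" "t \<le> r" for s t
        proof -
          have "0 \<le> (t - s) * e" using that e0 by simp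
          then show ?thesis using that by (intro aux(2)[OF \<sigma>eq \<sigma>diff[OF that]]) auto
        qed
        show "negligible (N \<union> E)" by (intro negligible_Un N countable_imp_negligible[OF E])
        fix t assume t: "t \<in> {0<..<r} - (N \<union> E)"
        then have tr: "t \<in> {0..r}" "t \<in> {0<..<T} - N" using rT by auto
        from bspec[OF \<gamma>d tr(2)] obtain v where v: "(\<gamma> has_vector_derivative v) (at t)"
          and v1: "inner (A (\<gamma> t) *v v) v \<le> 1" by blast
        have "(norm v)\<^sup>2 \<le> M\<^sup>2 * inner (A (\<gamma> t) *v v) v" using \<gamma>near[OF tr(1)] \<gamma>0 by (intro coer') simp
        also have "\<dots> \<le> M\<^sup>2 * 1" by (rule mult_left_mono[OF v1]) simp
        finally have nv: "norm v \<le> M" using M by (simp add: power2_le_iff_abs_le)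
        have wd: "(w has_vector_derivative (v - h)) (at t)"
          unfolding w_def by (auto intro!: derivative_eq_intros v)
        have "t \<notin> E \<and> w t \<in> ball p R0 \<and> (w has_vector_derivative (v - h)) (at t)" using t wR(1)[OF tr(1)] wd by auto
        with E2 obtain u where u: "((\<lambda>s. \<Phi> (w s)) has_vector_derivative u) (at t)"
          and "\<forall>s\<in>ball p R0 \<inter> S. inner (A (\<Phi> (w t)) *v u) u
               \<le> inner (A (w t) *v (v - h)) (v - h) + C0 * norm (w t - s) * (norm (v - h))\<^sup>2"
          by blast
        \<comment> \<open>The comparison point in \<open>S\<close> is \<gamma> t itself.\<close>
        then have le0: "inner (A (\<Phi> (w t)) *v u) u
               \<le> inner (A (w t) *v (v - h)) (v - h) + C0 * norm (w t - \<gamma> t) * (norm (v - h))\<^sup>2"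
          using \<gamma>R(1)[OF tr(1)] \<gamma>S tr(2) by auto
        have nvh: "norm (v - h) \<le> M + 1" using norm_triangle_ineq4[of v h] nv h\<delta> \<delta> by linarith
        then have nvh2: "(norm (v - h))\<^sup>2 \<le> (M + 1)\<^sup>2" by (intro power_mono) auto
        have le1: "C0 * norm (w t - \<gamma> t) * (norm (v - h))\<^sup>2 \<le> C0 * \<rho> * (M + 1)\<^sup>2"
          using R0 wg[OF tr(1)] nvh2 \<rho>0 by (intro mult_mono) auto
        have "norm (A (w t) - A (\<gamma> t)) \<le> B * norm (w t - \<gamma> t)"
          using lipschitz_onD[OF Alip wR(2)[OF tr(1)] \<gamma>R(2)[OF tr(1)]] by (simp add: dist_norm)
        also have "\<dots> \<le> B * \<rho>" using wg[OF tr(1)] B by (intro mult_left_mono) auto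
        finally have "\<bar>inner ((A (w t) - A (\<gamma> t)) *v (v - h)) (v - h)\<bar> \<le> K * (B * \<rho>) * (M + 1) * (M + 1)"
          using nvh by (intro Kb)
        then have le2: "inner (A (w t) *v (v - h)) (v - h) \<le> inner (A (\<gamma> t) *v (v - h)) (v - h) + K * B * \<rho> * (M + 1)\<^sup>2"
          by (simp add: matrix_vector_mult_diff_rdistrib inner_diff_left power2_eq_square mult_ac)
        have eqq: "inner (A (\<gamma> t) *v (v - h)) (v - h)
            = inner (A (\<gamma> t) *v v) v - 2 * inner (A (\<gamma> t) *v v) h + inner (A (\<gamma> t) *v h) h"
          using sym_pos_defD(1)[OF pos_def_A, of "\<gamma> t" h v]
          by (simp add: matrix_vector_mult_diff_distrib inner_diff_left inner_diff_right inner_commute)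
        have le3: "inner (A (\<gamma> t) *v h) h \<le> K * B * (norm h)\<^sup>2"
          using Kb[OF AB[OF \<gamma>R(2)[OF tr(1)]] order_refl order_refl, of h h]
          by (simp add: power2_eq_square mult_ac)
        \<comment> \<open>\<gamma> t is within M r of \<open>z\<close> and norm h = \<rho> / r. The
          factors r cancel, so freezing \<open>A\<close> costs only O(\<rho>).\<close>
        have le4: "- (2 * inner (A (\<gamma> t) *v v) h) \<le> - (2 * inner (A z *v v) h) + 2 * K * B * M * M * \<rho>"
        proof -
          have "norm (A (\<gamma> t) - A z) \<le> B * norm (\<gamma> t - z)"
            using lipschitz_onD[OF Alip \<gamma>R(2)[OF tr(1)] zR] by (simp add: dist_norm)
          also have "norm (\<gamma> t - z) \<le> M * r"
          proof -
            have "norm (\<gamma> t - z) \<le> M * t"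
              using lipschitz_onD[OF \<gamma>lip tr(1), of 0] tr r \<gamma>0 by (simp add: dist_norm dist_real_def)
            also have "\<dots> \<le> M * r" using tr M by (intro mult_left_mono) auto
            finally show ?thesis .
          qed
          finally have "norm (A (\<gamma> t) - A z) \<le> B * (M * r)" using B by simp
          from Kb[OF this nv, of h "\<rho> / r"] have "\<bar>inner ((A (\<gamma> t) - A z) *v v) h\<bar> \<le> K * (B * (M * r)) * M * (\<rho> / r)"
            by (simp add: nh)
          also have "\<dots> = K * B * M * M * \<rho>" using r by simp
          finally show ?thesis by (simp add: matrix_vector_mult_diff_rdistrib inner_diff_left abs_le_iff)
        qed
        define \<beta> where "\<beta> = inner (A z *v v) h"
        have "\<bar>\<beta>\<bar> \<le> 1 / 2" unfolding \<beta>_def using nv by (intro lin) auto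
        then have \<beta>: "\<beta> \<le> 1 / 2" by linarith
        have "0 \<le> K * B * \<rho>" "0 \<le> (C0 + K * B) * (M + 1)\<^sup>2 * (norm h)\<^sup>2" "0 \<le> 2 * K * B * M * M * (norm h)\<^sup>2"
          using K B R0 M \<rho>0 by auto
        then have "inner (A (\<Phi> (w t)) *v u) u \<le> 1 - 2 * \<beta> + e"
          using le0 le1 le2 eqq le3 le4 v1 unfolding e_def C_def \<beta>_def[symmetric]
          by (simp add: algebra_simps)
        also have "\<dots> \<le> (1 + e - \<beta>)\<^sup>2"
        proof -
          have "(1 + e - \<beta>)\<^sup>2 = 1 - 2 * \<beta> + e + (e * (1 - 2 * \<beta>) + \<beta>\<^sup>2 + e\<^sup>2)"
            by (simp add: power2_eq_square algebra_simps)
          moreover have "0 \<le> e * (1 - 2 * \<beta>)" using e0 \<beta> by (intro mult_nonneg_nonneg) auto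
          ultimately show ?thesis using zero_le_power2[of \<beta>] zero_le_power2[of e] by linarith
        qed
        finally have fin: "inner (A (\<Phi> (w t)) *v u) u \<le> (1 + e - \<beta>)\<^sup>2" .
        have "(\<sigma> has_vector_derivative (1 * (1 + e) - inner (A z *v v) h)) (at t)"
        proof -
          have "bounded_linear (\<lambda>y. inner (A z *v y) h)"
            by (rule bounded_linear_compose[OF bounded_linear_inner_left matrix_vector_mul_bounded_linear])
          from bounded_linear.has_vector_derivative[OF this has_vector_derivative_diff[OF v has_vector_derivative_const[of z]]]
          have "((\<lambda>t. inner (A z *v (\<gamma> t - z)) h) has_vector_derivative inner (A z *v v) h) (at t)" by simp
          moreover have "((\<lambda>t. t * (1 + e)) has_vector_derivative 1 * (1 + e)) (at t)"
            unfolding has_real_derivative_iff_has_vector_derivative[symmetric]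
            by (auto intro!: derivative_eq_intros)
          ultimately show ?thesis unfolding \<sigma>_def by (intro has_vector_derivative_diff)
        qed
        then have "(\<sigma> has_real_derivative (1 + e - \<beta>)) (at t)"
          by (simp add: has_real_derivative_iff_has_vector_derivative \<beta>_def)
        with u fin \<beta> e0 show "\<exists>v q. ((\<lambda>t. \<Phi> (w t)) has_vector_derivative v) (at t) \<and>
          (\<sigma> has_real_derivative q) (at t) \<and> 0 < q \<and> inner (A (\<Phi> (w t)) *v v) v \<le> q\<^sup>2"
          by (intro exI[of _ u] exI[of _ "1 + e - \<beta>"]) auto
      qed simp
      moreover have "\<Phi> (w 0) = x" using x wR(1)[of 0] r by (simp add: w_def \<gamma>0 \<Phi>id)
      moreover have "w r = \<gamma> r" using r by (simp add: w_def h_def)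
      then have "\<Phi> (w r) = \<gamma> r" using wR(1)[of r] r \<gamma>S rT by (simp add: \<Phi>id)
      ultimately have "joined S A x (\<gamma> r) (\<sigma> r)" by simp
      moreover have "joined S A (\<gamma> r) k\<^sub>0 (T - r)"
        using joined_suffix[OF u _ rT] r \<gamma>T by simp
      ultimately have "d x \<le> \<sigma> r + (T - r)" by (intro obstacle_dist_le joined_trans)
      also have "\<dots> \<le> d z + \<epsilon> + (\<sigma> r - r)" using Tle by simp
      also have "\<sigma> r - r = r * e - inner (A z *v (\<gamma> r - z)) h" by (simp add: \<sigma>_def algebra_simps)
      also have "inner (A z *v (\<gamma> r - z)) h = - inner q (x - z)" using r by (simp add: q_def h_def)
      also have "r * e = C * (r * norm (x - z) + (norm (x - z))\<^sup>2 / r)"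
        unfolding e_def nh \<rho>_def[symmetric] using r by (simp add: field_simps power2_eq_square)
      finally show "d x \<le> d z + inner q (x - z) + C * (r * norm (x - z) + (norm (x - z))\<^sup>2 / r) + \<epsilon>" by simp
    qed
  qed
  show ?thesis by (rule that[OF \<delta>(1) C]) (use main in blast)
qed

lemma obstacle_dist_local_semiconcave:
  assumes pS: "p \<in> S" and pk: "p \<noteq> k\<^sub>0"
  obtains \<rho> C where "0 < \<rho>" "0 < C"
    "\<forall>x\<in>ball p \<rho> \<inter> S. \<forall>y\<in>ball p \<rho> \<inter> S. \<forall>c\<in>{0..1}. c *\<^sub>R x + (1 - c) *\<^sub>R y \<in> S \<longrightarrow>
       c * d x + (1 - c) * d y - d (c *\<^sub>R x + (1 - c) *\<^sub>R y) \<le> C * c * (1 - c) * norm (x - y) powr (1 + 1 / 2)"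
proof -
  obtain \<delta> C where \<delta>: "0 < \<delta>" and C: "0 < C" and up:
    "\<forall>z\<in>ball p \<delta> \<inter> S. \<forall>r \<epsilon>. 0 < r \<and> r < \<delta> \<and> 0 < \<epsilon> \<longrightarrow> (\<exists>q. \<forall>x\<in>ball p \<delta> \<inter> S. norm (x - z) \<le> \<delta> * r \<longrightarrow>
       d x \<le> d z + inner q (x - z) + C * (r * norm (x - z) + (norm (x - z))\<^sup>2 / r) + \<epsilon>)"
    by (rule obstacle_dist_upper[OF pS pk])
  \<comment> \<open>Two points of the ball are at a distance D < \<delta>^2, so r = sqrt D is below
    \<delta> and D \<le> \<delta> r.\<close>
  define \<rho> where "\<rho> = min \<delta> (\<delta>\<^sup>2 / 2)"
  have \<rho>: "0 < \<rho>" "\<rho> \<le> \<delta>" "2 * \<rho> \<le> \<delta>\<^sup>2" using \<delta> by (auto simp: \<rho>_def)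
  have "c * d x + (1 - c) * d y - d z \<le> 3 * C * c * (1 - c) * norm (x - y) powr (1 + 1 / 2)"
    if x: "x \<in> ball p \<rho> \<inter> S" and y: "y \<in> ball p \<rho> \<inter> S" and c: "c \<in> {0..1}"
      and zS: "z \<in> S" and zdef: "z = c *\<^sub>R x + (1 - c) *\<^sub>R y" for x y c z
  proof (cases "x = y")
    case True
    then show ?thesis using zdef by (simp add: algebra_simps)
  next
    case False
    define D where "D = norm (x - y)"
    have D: "0 < D" using False by (simp add: D_def)
    \<comment> \<open>This choice balances the error terms \<open>r * D\<close> and \<open>D\<^sup>2 / r\<close>.\<close>
    define r where "r = sqrt D"
    have r: "0 < r" "r * r = D" using D by (auto simp: r_def)
    have "D \<le> norm (x - p) + norm (y - p)"
      using norm_triangle_ineq4[of "x - p" "y - p"] by (simp add: D_def)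
    also have "\<dots> < \<rho> + \<rho>" using x y by (intro add_strict_mono) (auto simp: dist_norm norm_minus_commute)
    finally have "D < \<delta>\<^sup>2" using \<rho> by linarith
    then have r\<delta>: "r < \<delta>" using \<delta> by (simp add: r_def real_less_lsqrt)
    have "z \<in> ball p \<delta>"
      unfolding zdef using x y c \<rho> convexD[OF convex_ball, of x p \<delta> y c "1 - c"] by auto
    then have z: "z \<in> ball p \<delta> \<inter> S" using zS by simp
    have xz: "x - z = (1 - c) *\<^sub>R (x - y)" and yz: "y - z = (- c) *\<^sub>R (x - y)"
      by (simp_all add: zdef algebra_simps)
    have nx: "norm (x - z) = (1 - c) * D" and ny: "norm (y - z) = c * D"
      unfolding xz yz using c by (simp_all add: D_def)
    have rD: "D \<le> \<delta> * r" using mult_right_mono[of r \<delta> r] r r\<delta> by simp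
    have "(1 - c) * D \<le> D" "c * D \<le> D" using c D by (simp_all add: mult_left_le_one_le)
    then have cl: "norm (x - z) \<le> \<delta> * r" "norm (y - z) \<le> \<delta> * r" using rD nx ny by linarith+
    have DD: "D\<^sup>2 / r = r * D" using r by (simp add: power2_eq_square field_simps)
    \<comment> \<open>\<open>q\<close> varies with \<epsilon>, but it has cancelled before
      \<epsilon> tends to 0.\<close>
    have "c * d x + (1 - c) * d y \<le> d z + 3 * C * c * (1 - c) * (r * D) + \<epsilon>" if "\<epsilon> > 0" for \<epsilon>
    proof -
      from up z r r\<delta> that obtain q where q: "\<forall>x\<in>ball p \<delta> \<inter> S. norm (x - z) \<le> \<delta> * r \<longrightarrow>
         d x \<le> d z + inner q (x - z) + C * (r * norm (x - z) + (norm (x - z))\<^sup>2 / r) + \<epsilon>" by blast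
      let ?P = "inner q (x - y)"
      have "d x \<le> d z + inner q (x - z) + C * (r * norm (x - z) + (norm (x - z))\<^sup>2 / r) + \<epsilon>"
        using q x cl \<rho> by auto
      also have "(norm (x - z))\<^sup>2 / r = (1 - c)\<^sup>2 * (r * D)"
        unfolding nx power_mult_distrib DD[symmetric] by simp
      finally have 1: "d x \<le> d z + (1 - c) * ?P + C * ((1 - c) * (r * D) + (1 - c)\<^sup>2 * (r * D)) + \<epsilon>"
        unfolding nx unfolding xz D_def[symmetric] by (simp add: mult_ac)
      have "d y \<le> d z + inner q (y - z) + C * (r * norm (y - z) + (norm (y - z))\<^sup>2 / r) + \<epsilon>"
        using q y cl \<rho> by auto
      also have "(norm (y - z))\<^sup>2 / r = c\<^sup>2 * (r * D)"
        unfolding ny power_mult_distrib DD[symmetric] by simp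
      finally have 2: "d y \<le> d z - c * ?P + C * (c * (r * D) + c\<^sup>2 * (r * D)) + \<epsilon>"
        unfolding ny unfolding yz D_def[symmetric] by (simp add: mult_ac)
      have "c * d x + (1 - c) * d y \<le> c * (d z + (1 - c) * ?P + C * ((1 - c) * (r * D) + (1 - c)\<^sup>2 * (r * D)) + \<epsilon>)
          + (1 - c) * (d z - c * ?P + C * (c * (r * D) + c\<^sup>2 * (r * D)) + \<epsilon>)"
        using 1 2 c by (intro add_mono mult_left_mono) auto
      \<comment> \<open>The factor c (1 - c) appears because \<open>x\<close> and \<open>y\<close>
        are at distances (1 - c) D and c D from \<open>z\<close>; what remains is 1 + (1 - c) + 1 +
        c = 3.\<close>
      also have "\<dots> = d z + 3 * C * c * (1 - c) * (r * D) + \<epsilon>"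
        by (simp add: power2_eq_square algebra_simps)
      finally show ?thesis .
    qed
    then have "c * d x + (1 - c) * d y \<le> d z + 3 * C * c * (1 - c) * (r * D)"
      by (rule field_le_epsilon)
    also have "r * D = D powr (1 + 1 / 2)"
      unfolding r_def by (rule powr_three_halves[OF D, symmetric])
    finally show ?thesis by (simp add: D_def)
  qed
  then show ?thesis
    using C \<rho>(1) by (intro that[of \<rho> "3 * C"]) auto
qed

section \<open>From local estimates to compact sets\<close>

text \<open>Finitely many good balls cover the compact set. Pairs closer than the Lebesgue number
  \<open>e\<close> of the cover share a ball. For distant pairs a global Lipschitz bound suffices,
  since D \<le> D^(3/2) / sqrt e for D \<ge> e.\<close>

lemma obstacle_dist_SC_loc: "d \<in> SC_loc (1 / 2) (S - {k\<^sub>0})"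
  unfolding SC_loc_def
proof (intro CollectI allI impI)
  fix X assume "compact X \<and> X \<subseteq> S - {k\<^sub>0}"
  then have X: "compact X" "X \<subseteq> S" "k\<^sub>0 \<notin> X" by auto
  define good where "good p \<rho> C \<longleftrightarrow> 0 < \<rho> \<and> 0 < C \<and> C-lipschitz_on (ball p \<rho> \<inter> S) d \<and>
    (\<forall>x\<in>ball p \<rho> \<inter> S. \<forall>y\<in>ball p \<rho> \<inter> S. \<forall>c\<in>{0..1}. c *\<^sub>R x + (1 - c) *\<^sub>R y \<in> S \<longrightarrow>
       c * d x + (1 - c) * d y - d (c *\<^sub>R x + (1 - c) *\<^sub>R y) \<le> C * c * (1 - c) * norm (x - y) powr (1 + 1 / 2))"
    for p \<rho> C
  have "\<exists>s. good p (fst s) (snd s)" if p: "p \<in> X" for p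
  proof -
    have pS: "p \<in> S" "p \<noteq> k\<^sub>0" using p X by auto
    obtain R C where R: "0 < R" "0 < C" "C-lipschitz_on (ball p R \<inter> S) d"
      by (rule obstacle_dist_local_lipschitz[OF pS(1)])
    obtain \<rho> C' where \<rho>: "0 < \<rho>" "0 < C'"
      and sc: "\<forall>x\<in>ball p \<rho> \<inter> S. \<forall>y\<in>ball p \<rho> \<inter> S. \<forall>c\<in>{0..1}. c *\<^sub>R x + (1 - c) *\<^sub>R y \<in> S \<longrightarrow>
       c * d x + (1 - c) * d y - d (c *\<^sub>R x + (1 - c) *\<^sub>R y) \<le> C' * c * (1 - c) * norm (x - y) powr (1 + 1 / 2)"
      by (rule obstacle_dist_local_semiconcave[OF pS])
    have "good p (min R \<rho>) (max C C')"
      unfolding good_def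
    proof (intro conjI ballI impI)
      show "(max C C')-lipschitz_on (ball p (min R \<rho>) \<inter> S) d"
        by (rule lipschitz_on_mono[OF R(3)]) auto
      fix x y c assume *: "x \<in> ball p (min R \<rho>) \<inter> S" "y \<in> ball p (min R \<rho>) \<inter> S" and c: "c \<in> {0..1}"
        and z: "c *\<^sub>R x + (1 - c) *\<^sub>R y \<in> S"
      have "c * d x + (1 - c) * d y - d (c *\<^sub>R x + (1 - c) *\<^sub>R y) \<le> C' * c * (1 - c) * norm (x - y) powr (1 + 1 / 2)"
        using sc * c z by auto
      also have "\<dots> \<le> max C C' * c * (1 - c) * norm (x - y) powr (1 + 1 / 2)"
        using c by (intro mult_right_mono) auto
      finally show "c * d x + (1 - c) * d y - d (c *\<^sub>R x + (1 - c) *\<^sub>R y) \<le> max C C' * c * (1 - c) * norm (x - y) powr (1 + 1 / 2)" .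
    qed (use R \<rho> in auto)
    then show ?thesis by (intro exI[of _ "(min R \<rho>, max C C')"]) simp
  qed
  then have "\<forall>p\<in>X. \<exists>s. good p (fst s) (snd s)" by blast
  from bchoice[OF this] obtain f where f: "\<forall>p\<in>X. good p (fst (f p)) (snd (f p))" by (rule exE)
  define B where "B p = ball p (fst (f p))" for p
  define k where "k p = snd (f p)" for p
  have f0: "0 < fst (f p)" "0 < k p" and flip: "(k p)-lipschitz_on (B p \<inter> S) d" if "p \<in> X" for p
    using bspec[OF f that] by (auto simp: good_def B_def k_def)
  have fsc: "c * d x + (1 - c) * d y - d (c *\<^sub>R x + (1 - c) *\<^sub>R y) \<le> k p * c * (1 - c) * norm (x - y) powr (1 + 1 / 2)"
    if "p \<in> X" "x \<in> B p \<inter> S" "y \<in> B p \<inter> S" "c \<in> {0..1}" "c *\<^sub>R x + (1 - c) *\<^sub>R y \<in> S" for p x y c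
    using bspec[OF f that(1)] that(2-) by (auto simp: good_def B_def k_def)
  have cov: "X \<subseteq> (\<Union>p\<in>X. B p)" using f0 by (force simp: B_def)
  obtain P where P: "P \<subseteq> X" "finite P" "X \<subseteq> (\<Union>p\<in>P. B p)"
    by (rule compactE_image[OF X(1) _ cov]) (auto simp: B_def)
  obtain e where e: "0 < e" "\<And>x. x \<in> X \<Longrightarrow> \<exists>G \<in> B ` P. ball x e \<subseteq> G"
    by (rule Heine_Borel_lemma[OF X(1) P(3)]) (auto simp: B_def)
  have near: "\<exists>p\<in>P. x \<in> B p \<and> y \<in> B p" if x: "x \<in> X" and "norm (x - y) < e" for x y
  proof -
    obtain p where "p \<in> P" "ball x e \<subseteq> B p" using e(2)[OF x] by blast
    moreover have "x \<in> ball x e" "y \<in> ball x e" using that e(1) by (auto simp: dist_norm)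
    ultimately show ?thesis by blast
  qed
  have k0: "0 \<le> k p" if "p \<in> P" for p
    using f0(2)[of p] P(1) that by (simp add: less_imp_le subset_iff)
  \<comment> \<open>A sum rather than a maximum, so that an empty \<open>P\<close> causes no
    trouble.\<close>
  define C where "C = sum k P"
  have kC: "k p \<le> C" if "p \<in> P" for p
    unfolding C_def using P(2) k0 that by (intro member_le_sum) auto
  have C0: "0 \<le> C" unfolding C_def using k0 by (intro sum_nonneg)
  have lipnear: "\<bar>d x - d y\<bar> \<le> C * norm (x - y)" if x: "x \<in> X" and y: "y \<in> X" and xy: "norm (x - y) < e" for x y
  proof -
    obtain p where p: "p \<in> P" "x \<in> B p" "y \<in> B p" using near[OF x xy] by blast
    have "\<bar>d x - d y\<bar> \<le> k p * norm (x - y)"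
      using lipschitz_onD[OF flip, of p x y] p P x y X by (auto simp: dist_norm)
    also have "\<dots> \<le> C * norm (x - y)" using kC[OF p(1)] by (intro mult_right_mono) auto
    finally show ?thesis .
  qed
  define m where "m p = \<bar>d p\<bar> + k p * fst (f p)" for p
  define M where "M = sum m P"
  have m0: "0 \<le> m p" if "p \<in> P" for p using f0[of p] P that by (auto simp: m_def)
  have bd: "\<bar>d x\<bar> \<le> M" if x: "x \<in> X" for x
  proof -
    obtain p where p: "p \<in> P" "x \<in> B p" using P(3) x by blast
    have pX: "p \<in> X" using p P by blast
    have "\<bar>d x - d p\<bar> \<le> k p * norm (x - p)"
      using lipschitz_onD[OF flip[OF pX], of x p] p pX f0[OF pX] x X by (auto simp: dist_norm B_def)
    also have "\<dots> \<le> k p * fst (f p)"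
      using p(2) f0[OF pX] by (intro mult_left_mono) (auto simp: B_def dist_norm norm_minus_commute)
    finally have "\<bar>d x\<bar> \<le> m p" unfolding m_def by linarith
    also have "\<dots> \<le> M" unfolding M_def using p P m0 by (intro member_le_sum) auto
    finally show ?thesis .
  qed
  \<comment> \<open>\<open>X\<close> may be disconnected, so distant pairs are compared through the
    bound \<open>M\<close> on the values of \<open>d\<close>.\<close>
  define L where "L = C + 2 * M / e"
  have L: "\<bar>d x - d y\<bar> \<le> L * norm (x - y)" if x: "x \<in> X" and y: "y \<in> X" for x y
  proof (cases "norm (x - y) < e")
    case True
    have "0 \<le> M" using bd[OF x] by linarith
    then have "C * norm (x - y) \<le> L * norm (x - y)" using e(1) by (intro mult_right_mono) (auto simp: L_def)
    then show ?thesis using lipnear[OF x y True] by linarith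
  next
    case False
    have M0: "0 \<le> M" using bd[OF x] by linarith
    have "\<bar>d x - d y\<bar> \<le> 2 * M" using bd[OF x] bd[OF y] by linarith
    also have "\<dots> = 2 * M / e * e" using e by simp
    also have "\<dots> \<le> 2 * M / e * norm (x - y)" using False M0 e by (intro mult_left_mono) auto
    also have "\<dots> \<le> L * norm (x - y)" using C0 by (intro mult_right_mono) (auto simp: L_def)
    finally show ?thesis .
  qed
  \<comment> \<open>The 1 ensures positivity, the last term serves the distant pairs.\<close>
  define C' where "C' = 1 + C + 2 * \<bar>L\<bar> / sqrt e"
  have C': "C' > 0" using C0 e(1) by (auto simp: C'_def intro!: add_pos_nonneg)
  have C'C: "C \<le> C'" "2 * \<bar>L\<bar> / sqrt e \<le> C'" using C0 e(1) by (auto simp: C'_def)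
  have LL: "L * norm u \<le> \<bar>L\<bar> * norm u" for u :: "real ^ 'n" by (intro mult_right_mono) auto
  show "d \<in> SC (1 / 2) X"
    unfolding SC_def
  proof (intro CollectI conjI exI[of _ C'] ballI impI C')
    show "locally_lipschitz_on X d"
      unfolding locally_lipschitz_on_def
    proof
      fix x assume x: "x \<in> X"
      have "\<bar>L\<bar>-lipschitz_on (cball x 1 \<inter> X) d"
      proof (rule lipschitz_onI)
        fix a b assume "a \<in> cball x 1 \<inter> X" "b \<in> cball x 1 \<inter> X"
        then have "\<bar>d a - d b\<bar> \<le> L * norm (a - b)" by (intro L) auto
        also have "\<dots> \<le> \<bar>L\<bar> * norm (a - b)" by (intro mult_right_mono) auto
        finally show "dist (d a) (d b) \<le> \<bar>L\<bar> * dist a b" by (simp add: dist_norm dist_real_def)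
      qed simp
      then show "\<exists>\<epsilon>>0. \<exists>L. L-lipschitz_on (cball x \<epsilon> \<inter> X) d" by (intro exI[of _ 1] conjI exI[of _ "\<bar>L\<bar>"]) auto
    qed
    fix x y c assume x: "x \<in> X" and y: "y \<in> X" and seg: "closed_segment x y \<subseteq> X" and c: "c \<in> {0..1::real}"
    define z where "z = c *\<^sub>R x + (1 - c) *\<^sub>R y"
    \<comment> \<open>The segment parameter is the weight of \<open>y\<close>, that is, 1 -
      c.\<close>
    have "z = (1 - (1 - c)) *\<^sub>R x + (1 - c) *\<^sub>R y" by (simp add: z_def)
    then have "z \<in> closed_segment x y" unfolding in_segment using c by (intro exI[of _ "1 - c"]) auto
    then have zX: "z \<in> X" using seg by blast
    let ?D = "norm (x - y)"
    have cc: "0 \<le> c * (1 - c)" using c by (intro mult_nonneg_nonneg) auto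
    show "c * d x + (1 - c) * d y - d (c *\<^sub>R x + (1 - c) *\<^sub>R y) \<le> C' * c * (1 - c) * ?D powr (1 + 1 / 2)"
      unfolding z_def[symmetric]
    proof (cases "?D < e")
      case True
      obtain p where p: "p \<in> P" "x \<in> B p" "y \<in> B p" using near[OF x True] by blast
      have "c * d x + (1 - c) * d y - d z \<le> k p * c * (1 - c) * ?D powr (1 + 1 / 2)"
        unfolding z_def using p P x y X zX c by (intro fsc) (auto simp: z_def)
      also have "\<dots> = k p * (c * (1 - c) * ?D powr (1 + 1 / 2))" by simp
      also have "\<dots> \<le> C' * (c * (1 - c) * ?D powr (1 + 1 / 2))"
      proof (rule mult_right_mono)
        show "k p \<le> C'" using kC[OF p(1)] C'C by linarith
        show "0 \<le> c * (1 - c) * ?D powr (1 + 1 / 2)" by (rule mult_nonneg_nonneg[OF cc]) simp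
      qed
      finally show "c * d x + (1 - c) * d y - d z \<le> C' * c * (1 - c) * ?D powr (1 + 1 / 2)" by simp
    next
      case False
      have D: "0 < ?D" "e \<le> ?D" using False e(1) by linarith+
      have xz: "x - z = (1 - c) *\<^sub>R (x - y)" and yz: "y - z = (- c) *\<^sub>R (x - y)"
        by (simp_all add: z_def algebra_simps)
      have nx: "norm (x - z) = (1 - c) * ?D" and ny: "norm (y - z) = c * ?D"
        unfolding xz yz using c by simp_all
      \<comment> \<open>Comparing with \<open>z\<close>, instead of \<open>x\<close> with
        \<open>y\<close>, produces the required factor c (1 - c).\<close>
      have "d x - d z \<le> \<bar>L\<bar> * ((1 - c) * ?D)"
        using L[OF x zX] LL[of "x - z"] unfolding nx by linarith
      moreover have "d y - d z \<le> \<bar>L\<bar> * (c * ?D)"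
        using L[OF y zX] LL[of "y - z"] unfolding ny by linarith
      ultimately have "c * (d x - d z) + (1 - c) * (d y - d z) \<le> c * (\<bar>L\<bar> * ((1 - c) * ?D)) + (1 - c) * (\<bar>L\<bar> * (c * ?D))"
        using c by (intro add_mono mult_left_mono) auto
      then have "c * d x + (1 - c) * d y - d z \<le> (2 * \<bar>L\<bar> * ?D) * (c * (1 - c))"
        by (simp add: algebra_simps)
      also have "\<dots> \<le> (C' * ?D powr (1 + 1 / 2)) * (c * (1 - c))"
      proof (rule mult_right_mono[OF _ cc])
        have "sqrt e \<le> sqrt ?D" using D by simp
        then have "1 \<le> sqrt ?D / sqrt e" using e(1) by simp
        then have "2 * \<bar>L\<bar> * ?D * 1 \<le> 2 * \<bar>L\<bar> * ?D * (sqrt ?D / sqrt e)" by (intro mult_left_mono) auto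
        also have "\<dots> = 2 * \<bar>L\<bar> / sqrt e * ?D powr (1 + 1 / 2)"
          unfolding powr_three_halves[OF D(1)] by simp
        also have "\<dots> \<le> C' * ?D powr (1 + 1 / 2)" using C'C by (intro mult_right_mono) auto
        finally show "2 * \<bar>L\<bar> * ?D \<le> C' * ?D powr (1 + 1 / 2)" by simp
      qed
      finally show "c * d x + (1 - c) * d y - d z \<le> C' * c * (1 - c) * ?D powr (1 + 1 / 2)" by (simp add: mult_ac)
    qed
  qed
qed

end

theorem theorem2:
  fixes U Obs :: "(real ^ 'n) set"
    and k\<^sub>0 :: "real ^ 'n"
    and A :: "real ^ 'n \<Rightarrow> real ^ 'n ^ 'n"
  assumes "open U" and "bounded U" and "connected U" and "C2_boundary U"
    and "Obs = closure U"
    and "connected (- Obs)"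
    and "k\<^sub>0 \<in> - Obs"
    and "C2_on A UNIV"
    and "\<And>x. sym_pos_def (A x)"
  shows "obstacle_dist Obs A k\<^sub>0 \<in> SC_loc (1 / 2) (closure (- Obs) - {k\<^sub>0})"
proof -
  have C1: "C1_on A UNIV" using C2_imp_C1[OF assms(8)] .
  have "continuous_on UNIV A" by (rule C1_onE[OF C1])
  interpret regular_obstacle_problem Obs A k\<^sub>0
  proof
    show "continuous_on UNIV A" by fact
    show "sym_pos_def (A x)" for x by (rule assms(9))
    show "C1_on A UNIV" by (rule C1)
    show "k\<^sub>0 \<in> closure (- Obs)" using assms(7) closure_subset by blast
    show "connected (- Obs)" by (rule assms(6))
    fix p assume "p \<in> closure (- Obs)"
    from local_retraction_exists[OF assms(1,4,5) C1 assms(9) this]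
    show "\<exists>R>0. \<exists>C>0. \<exists>\<Phi>. local_retraction (closure (- Obs)) A (ball p R) C \<Phi>" by metis
  qed
  show ?thesis by (rule obstacle_dist_SC_loc)
qed

end
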